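(* Let $F=\sum_{n\ge0}a_n(F)q^n$ be a homogeneous element of the ring $\widetilde M_*$ of quasimodular forms satisfying $\mathrm{ev}[F](h)=A\,h^{-p}+\mathrm O(h^{1-p})$ as $h\to0$ for some integer $p\ge0$ and constant $A\ne0$. Then the sum of the first $N$ Fourier coefficients of $F$ has the asymptotic behavior $$\sum_{n=1}^Na_n(F)\;=\;A\,\frac{N^p}{p!}\;+\;\mathrm O\bigl(N^{p-1}\log N\bigr)\qquad(N\to\infty).$$
   Context: $\widetilde M_*=\mathbb Q[E_2,E_4,E_6]$ is the graded ring of quasimodular forms for $\mathrm{SL}(2,\mathbb Z)$, where $E_k=1-\frac{2k}{B_k}\sum_{m\ge1}\sigma_{k-1}(m)q^m$ has weight $k$ (with $B_k$ the $k$-th Bernoulli number and $\sigma_{k-1}(m)=\sum_{d\mid m}d^{k-1}$). Let $\mathrm{Ev}:\widetilde M_*\to\mathbb Q[X]$ be the $\mathbb Q$-algebra homomorphism with $E_2\mapsto X+12$, $E_4\mapsto X^2$, $E_6\mapsto X^3$. For $F$ homogeneous of weight $2k$ define the growth polynomial $\mathrm{ev}[F](h)=h^{-k}\,\mathrm{Ev}[F](-4\pi^2/h)\in\mathbb Q[\pi^2][1/h]$.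
   Formalization: F is assumed to have positive weight 2k > 0; in weight 0 the claim fails, since F = 1 has ev[F] = 1 (A = 1, p = 0) while its coefficients a_n with n ≥ 1 all vanish, so the sum is 0 rather than 1 + O(N^{-1} log N). *)

theory Defs
  imports
    "HOL-Analysis.Analysis"
    "HOL-Library.Landau_Symbols"
    "HOL-Library.Poly_Mapping"
    "HOL-Library.Product_Plus"
    "HOL-Computational_Algebra.Polynomial"
    "HOL-Computational_Algebra.Formal_Power_Series"
begin

subsection \<open>The Eisenstein series\<close>

text \<open>The generating function is \<open>x / (exp x - 1)\<close>, so \<open>B\<^sub>1 = -1/2\<close>.\<close>

definition bernoulli :: "nat \<Rightarrow> rat" where
  "bernoulli k = fact k * fps_nth (fps_X / (fps_exp 1 - 1)) k"

definition divisor_sigma :: "nat \<Rightarrow> nat \<Rightarrow> nat" where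
  "divisor_sigma r m = (\<Sum>d | d dvd m. d ^ r)"

definition eisenstein :: "nat \<Rightarrow> rat fps" where
  "eisenstein k = Abs_fps (\<lambda>m. if m = 0 then 1
     else - (2 * of_nat k / bernoulli k) * of_nat (divisor_sigma (k - 1) m))"

lemma bernoulli_recurrence:
  assumes "n > 0"
  shows "(\<Sum>k\<le>n. of_nat (Suc n choose k) * bernoulli k) = 0"
proof -
  define G :: "rat fps" where "G = fps_X / (fps_exp 1 - 1)"
  have nz: "fps_exp (1::rat) - 1 \<noteq> 0"
    by (metis diff_eq_diff_eq diff_zero fps_exp_0 fps_exp_eq_iff one_neq_zero right_minus_eq)
  have s: "subdegree (fps_exp (1::rat) - 1) = 1"
    by (intro subdegreeI) (auto simp: less_Suc_eq)
  have "G * (fps_exp 1 - 1) = fps_X"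
    unfolding G_def by (rule fps_times_divide_eq) (use nz s in auto)
  hence "fps_nth (G * (fps_exp 1 - 1)) (Suc n) = fps_nth fps_X (Suc n)" by simp
  hence "(\<Sum>k=0..Suc n. fps_nth G k * fps_nth (fps_exp 1 - 1) (Suc n - k)) = 0"
    using assms by (simp add: fps_mult_nth)
  hence *: "(\<Sum>k\<le>n. fps_nth G k / fact (Suc n - k)) = 0"
    by (simp add: atLeast0AtMost Suc_diff_le field_simps del: fact_Suc)
  have "(\<Sum>k\<le>n. of_nat (Suc n choose k) * bernoulli k)
      = fact (Suc n) * (\<Sum>k\<le>n. fps_nth G k / fact (Suc n - k))"
    unfolding sum_distrib_left
    by (intro sum.cong) (auto simp: binomial_fact bernoulli_def G_def)
  thus ?thesis using * by simp
qed

lemma bernoulli_0: "bernoulli 0 = 1"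
proof -
  have s: "subdegree (fps_exp (1::rat) - 1) = 1"
    by (intro subdegreeI) (auto simp: less_Suc_eq)
  hence "fps_exp (1::rat) - 1 \<noteq> 0" by (metis subdegree_0 zero_neq_one)
  hence "fps_X / (fps_exp 1 - 1) * (fps_exp 1 - 1) = (fps_X :: rat fps)"
    by (intro fps_times_divide_eq) (use s in auto)
  hence "fps_nth (fps_X / (fps_exp 1 - 1) * (fps_exp 1 - 1)) 1 = fps_nth (fps_X :: rat fps) 1"
    by simp
  thus ?thesis by (simp add: fps_mult_nth bernoulli_def)
qed

lemma bernoulli_values:
  "bernoulli 1 = -1/2" "bernoulli 2 = 1/6" "bernoulli 3 = 0"
  "bernoulli 4 = -1/30" "bernoulli 5 = 0" "bernoulli 6 = 1/42"
proof -
  show 1: "bernoulli 1 = -1/2"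
    using bernoulli_recurrence[of 1] by (simp add: bernoulli_0)
  show 2: "bernoulli 2 = 1/6"
    using bernoulli_recurrence[of 2] 1
    by (simp add: bernoulli_0 numeral_eq_Suc field_simps)
  show 3: "bernoulli 3 = 0"
    using bernoulli_recurrence[of 3] 1 2
    by (simp add: bernoulli_0 numeral_eq_Suc field_simps)
  show 4: "bernoulli 4 = -1/30"
    using bernoulli_recurrence[of 4] 1 2 3
    by (simp add: bernoulli_0 numeral_eq_Suc field_simps)
  show 5: "bernoulli 5 = 0"
    using bernoulli_recurrence[of 5] 1 2 3 4
    by (simp add: bernoulli_0 numeral_eq_Suc field_simps)
  show 6: "bernoulli 6 = 1/42"
    using bernoulli_recurrence[of 6] 1 2 3 4 5
    by (simp add: bernoulli_0 numeral_eq_Suc field_simps)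
qed

lemma eisenstein_values:
  assumes "m > 0"
  shows "fps_nth (eisenstein 2) m = - 24 * of_nat (\<Sum>d | d dvd m. d)"
    and "fps_nth (eisenstein 4) m = 240 * of_nat (\<Sum>d | d dvd m. d ^ 3)"
    and "fps_nth (eisenstein 6) m = - 504 * of_nat (\<Sum>d | d dvd m. d ^ 5)"
  using assms by (simp_all add: eisenstein_def divisor_sigma_def bernoulli_values)


subsection \<open>Quasimodular forms\<close>

text \<open>
  The ring \<open>\<rat>[E\<^sub>2, E\<^sub>4, E\<^sub>6]\<close> is represented as the polynomial ring over the rationals in three
  generators: the exponent \<open>(a, b, c)\<close> stands for the monomial \<open>E\<^sub>2\<^sup>a E\<^sub>4\<^sup>b E\<^sub>6\<^sup>c\<close>. The three series
  are algebraically independent, so this is the ring of the \<open>q\<close>-series themselves; nothing below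
  depends on it, since every representation of a \<open>q\<close>-series as a polynomial is admitted.
\<close>

type_synonym quasimodular = "(nat \<times> nat \<times> nat) \<Rightarrow>\<^sub>0 rat"

text \<open>The algebra homomorphism sending the generators to \<open>x\<close>, \<open>y\<close>, \<open>z\<close>, where \<open>\<iota>\<close> is the
  structure map of the target \<open>\<rat>\<close>-algebra.\<close>

definition substitute ::
  "(rat \<Rightarrow> 'a) \<Rightarrow> 'a \<Rightarrow> 'a \<Rightarrow> 'a \<Rightarrow> quasimodular \<Rightarrow> 'a::comm_ring_1" where
  "substitute \<iota> x y z F =
     (\<Sum>(a, b, c) \<in> Poly_Mapping.keys F.
        \<iota> (Poly_Mapping.lookup F (a, b, c)) * (x ^ a * y ^ b * z ^ c))"

definition q_expansion :: "quasimodular \<Rightarrow> rat fps" where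
  "q_expansion = substitute fps_const (eisenstein 2) (eisenstein 4) (eisenstein 6)"

definition fourier_coeff :: "quasimodular \<Rightarrow> nat \<Rightarrow> rat" where
  "fourier_coeff F n = fps_nth (q_expansion F) n"

definition homogeneous :: "nat \<Rightarrow> quasimodular \<Rightarrow> bool" where
  "homogeneous w F \<longleftrightarrow> (\<forall>(a, b, c) \<in> Poly_Mapping.keys F. 2 * a + 4 * b + 6 * c = w)"

definition Ev :: "quasimodular \<Rightarrow> rat poly" where
  "Ev = substitute (\<lambda>r. [:r:]) [:12, 1:] ([:0, 1:] ^ 2) ([:0, 1:] ^ 3)"

text \<open>The growth polynomial of a form of weight \<open>2 * k\<close>.\<close>

definition growth :: "nat \<Rightarrow> quasimodular \<Rightarrow> real \<Rightarrow> real" where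
  "growth k F h = poly (map_poly of_rat (Ev F)) (- 4 * pi\<^sup>2 / h) / h ^ k"


text \<open>\<^const>\<open>q_expansion\<close> and \<^const>\<open>Ev\<close> are homomorphisms of \<open>\<rat>\<close>-algebras with the prescribed values on generators.\<close>

locale rat_algebra =
  fixes \<iota> :: "rat \<Rightarrow> 'a::comm_ring_1"
  assumes \<iota>_0: "\<iota> 0 = 0" and \<iota>_1: "\<iota> 1 = 1"
    and \<iota>_add: "\<iota> (r + s) = \<iota> r + \<iota> s" and \<iota>_mult: "\<iota> (r * s) = \<iota> r * \<iota> s"
begin

lemma substitute_superset:
  assumes "finite A" "Poly_Mapping.keys F \<subseteq> A"
  shows "substitute \<iota> x y z F =
    (\<Sum>(a, b, c) \<in> A. \<iota> (Poly_Mapping.lookup F (a, b, c)) * (x ^ a * y ^ b * z ^ c))"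
  unfolding substitute_def
  by (rule sum.mono_neutral_left) (use assms in \<open>auto simp: in_keys_iff \<iota>_0\<close>)

lemma substitute_single:
  "substitute \<iota> x y z (Poly_Mapping.single (a, b, c) r) = \<iota> r * (x ^ a * y ^ b * z ^ c)"
  by (subst substitute_superset[of "{(a, b, c)}"]) auto

lemma substitute_add:
  "substitute \<iota> x y z (F + G) = substitute \<iota> x y z F + substitute \<iota> x y z G"
proof -
  let ?A = "Poly_Mapping.keys F \<union> Poly_Mapping.keys G"
  have fin: "finite ?A" by simp
  show ?thesis
    by (subst (1 2 3) substitute_superset[OF fin])
       (auto simp: Poly_Mapping.lookup_add \<iota>_add algebra_simps simp flip: sum.distrib
             intro!: sum.cong dest: set_mp[OF Poly_Mapping.keys_add])
qed

lemma substitute_0: "substitute \<iota> x y z 0 = 0"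
  by (simp add: substitute_def)

lemma substitute_const: "substitute \<iota> x y z (Poly_Mapping.single 0 r) = \<iota> r"
  using substitute_single[of x y z 0 0 0 r] by (simp add: zero_prod_def)

lemma quasimodular_induct [case_names zero add]:
  fixes P :: "quasimodular \<Rightarrow> bool"
  assumes "P 0" and "\<And>F a b c r. P F \<Longrightarrow> P (F + Poly_Mapping.single (a, b, c) r)"
  shows "P F"
proof (induction F rule: update_induct)
  case const
  thus ?case using assms(1) by simp
next
  case (update f e r)
  obtain a b c where e: "e = (a, b, c)" by (cases e)
  have "Poly_Mapping.update e r f = f + Poly_Mapping.single e r"
    using update.hyps
    by (intro poly_mapping_eqI)
       (auto simp: lookup_update Poly_Mapping.lookup_add lookup_single in_keys_iff when_def)
  thus ?case using assms(2)[OF update.IH, of a b c r] e by simp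
qed

lemma substitute_mult:
  "substitute \<iota> x y z (F * G) = substitute \<iota> x y z F * substitute \<iota> x y z G"
proof (induction F rule: quasimodular_induct)
  case zero
  show ?case by (simp add: substitute_0)
next
  case (add F a b c r)
  have "substitute \<iota> x y z (Poly_Mapping.single (a, b, c) r * G) =
        \<iota> r * (x ^ a * y ^ b * z ^ c) * substitute \<iota> x y z G"
  proof (induction G rule: quasimodular_induct)
    case zero
    show ?case by (simp add: substitute_0)
  next
    case (add G a' b' c' r')
    thus ?case
      by (simp add: distrib_left substitute_add mult_single substitute_single \<iota>_mult power_add
                    mult_ac)
  qed
  thus ?case using add
    by (simp add: distrib_right substitute_add substitute_single)
qed

end

interpretation q_expansion: rat_algebra "fps_const :: rat \<Rightarrow> rat fps"
  by unfold_locales auto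

interpretation Ev: rat_algebra "\<lambda>r::rat. [:r:]"
  by unfold_locales (auto simp: one_pCons)

lemma q_expansion_hom:
  "q_expansion (Poly_Mapping.single 0 r) = fps_const r"
  "q_expansion (F + G) = q_expansion F + q_expansion G"
  "q_expansion (F * G) = q_expansion F * q_expansion G"
  "q_expansion (Poly_Mapping.single (1, 0, 0) 1) = eisenstein 2"
  "q_expansion (Poly_Mapping.single (0, 1, 0) 1) = eisenstein 4"
  "q_expansion (Poly_Mapping.single (0, 0, 1) 1) = eisenstein 6"
  unfolding q_expansion_def
  by (simp_all add: q_expansion.substitute_const q_expansion.substitute_add
        q_expansion.substitute_mult q_expansion.substitute_single)

lemma Ev_hom:
  "Ev (Poly_Mapping.single 0 r) = [:r:]"
  "Ev (F + G) = Ev F + Ev G"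
  "Ev (F * G) = Ev F * Ev G"
  "Ev (Poly_Mapping.single (1, 0, 0) 1) = [:0, 1:] + [:12:]"
  "Ev (Poly_Mapping.single (0, 1, 0) 1) = [:0, 1:] ^ 2"
  "Ev (Poly_Mapping.single (0, 0, 1) 1) = [:0, 1:] ^ 3"
  unfolding Ev_def
  by (simp_all add: Ev.substitute_const Ev.substitute_add Ev.substitute_mult
        Ev.substitute_single one_pCons)

end

theory Submission
  imports Defs "HOL-Complex_Analysis.Complex_Analysis"
begin

text \<open>
  Write \<open>g\<^sub>l = c\<^sub>l + (\<Sum>n\<ge>1. \<sigma>\<^bsub>2l-1\<^esub>(n) q\<^sup>n)\<close> for the Eisenstein series of weight \<open>2l\<close>. Near a rational point
  \<open>-d/c\<close>, a quasimodular form of weight \<open>2k\<close> looks like \<open>Q(c j) / j\<^bsup>2k\<^esup>\<close> with \<open>j = c z + d\<close>, where \<open>Q\<close> is a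
  polynomial of degree at most \<open>k\<close> that carries the same information as the growth polynomial. The
  derivatives \<open>D\<^bsup>k-l\<^esup> g\<^sub>l\<close> with \<open>1 \<le> l \<le> k\<close> realise the monomials of degree less than \<open>k\<close>, and a monomial
  of degree \<open>k\<close> only contributes \<open>O(y\<^bsup>-k\<^esup>)\<close>, where \<open>y = Im z\<close>. So \<open>F\<close> is a combination of these derivatives, which
  have elementary coefficient sums, and of a series that is \<open>O(y\<^bsup>-k\<^esup>)\<close> on the whole half plane.
  Hecke's argument (Cauchy's formula on the circle with \<open>y = 1/N\<close>, and the \<open>log N\<close> bound for the Dirichlet
  kernel) bounds the coefficient sums of the latter by \<open>N\<^sup>k log N\<close>. This is absorbed because \<open>p = k\<close> cannot occur:
  the two lowest coefficients of \<open>Ev F\<close> are proportional.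
\<close>

subsection \<open>Lipschitz summation formula\<close>

text \<open>Up to errors exponentially small in \<open>v = y / |j|^2\<close>, the transformation
  laws turn \<open>E_4\<close> and \<open>E_6\<close> into pure powers of \<open>1 / j\<close>, and
  the additive term of weight 2 turns \<open>E_2\<close> into
  \<open>(1 + (6 i / pi) c j) / j^2\<close>. So \<open>E_2^a E_4^b E_6^c\<close> has
  \<open>Q = (1 + (6 i / pi) X)^a\<close>, whereas \<open>Ev\<close> gives
  \<open>(X + 12)^a X^(k - a)\<close>: one polynomial is the other read backwards and rescaled. The
  coefficient of \<open>h^(- k - l)\<close> in the growth polynomial reappears in degree
  \<open>k - l\<close> of \<open>Q\<close>; for \<open>l = 0\<close> there is no \<open>g_0\<close>
  to match it.

  The obstacle is uniformity: the difference must be estimated on the whole half plane, although the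
  expansion at \<open>z\<close> depends on the pair \<open>(c, d)\<close>. All constants therefore
  depend only on a lower bound for \<open>v\<close>, and every \<open>z\<close> admits a pair with
  \<open>v >= 1/2\<close>. Since \<open>F\<close> and the derivatives are compared only through
  \<open>Q\<close>, the values \<open>zeta (2 l)\<close> stay symbolic, except for the three that
  identify the generators, and cancel in the coefficient sums.\<close>

definition nome :: "complex \<Rightarrow> complex" where
  "nome z = exp (2 * of_real pi * \<i> * z)"

definition qser :: "complex fps \<Rightarrow> complex \<Rightarrow> complex" where
  "qser f z = eval_fps f (nome z)"

lemma norm_nome: "norm (nome z) = exp (- 2 * pi * Im z)"
  by (simp add: nome_def norm_exp_eq_Re)

lemma norm_nome_less_1: "Im z > 0 \<Longrightarrow> norm (nome z) < 1"
  by (simp add: norm_nome)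

lemma norm_nome_less_radius:
  assumes "fps_conv_radius f \<ge> 1" "Im z > 0"
  shows "ereal (norm (nome z)) < fps_conv_radius f"
proof -
  have "ereal (norm (nome z)) < 1"
    using norm_nome_less_1[OF assms(2)] by simp
  thus ?thesis using assms(1) by order
qed

lemma fps_conv_radius_XD:
  fixes f :: "'a::{banach,real_normed_field} fps"
  shows "fps_conv_radius f \<ge> 1 \<Longrightarrow> fps_conv_radius (fps_XD f) \<ge> 1"
  unfolding fps_XD_def o_def
  using fps_conv_radius_mult[of fps_X "fps_deriv f"] fps_conv_radius_deriv[of f]
  by (simp add: min_def)

text \<open>\<open>fps_XD\<close> is \<open>q d/dq\<close>, which in the variable \<open>z\<close>
  is \<open>D = (2 pi i)^(-1) d/dz\<close>.\<close>

lemma qser_has_field_derivative: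
  assumes "fps_conv_radius f \<ge> 1" "Im z > 0"
  shows "(qser f has_field_derivative 2 * of_real pi * \<i> * qser (fps_XD f) z) (at z)"
proof -
  let ?q = "nome z"
  note r = norm_nome_less_radius[OF assms]
  have rd: "ereal (norm ?q) < fps_conv_radius (fps_deriv f)"
    using r fps_conv_radius_deriv[of f] by order
  have "eval_fps (fps_X * fps_deriv f) ?q = ?q * eval_fps (fps_deriv f) ?q"
    by (subst eval_fps_mult) (use rd in auto)
  hence e: "eval_fps (fps_XD f) ?q = ?q * eval_fps (fps_deriv f) ?q"
    by (simp only: fps_XD_def o_def)
  have "((\<lambda>z. eval_fps f (nome z)) has_field_derivative
          eval_fps (fps_deriv f) ?q * (nome z * (2 * of_real pi * \<i>))) (at z)"
    by (rule DERIV_chain'[where f = "\<lambda>z. nome z"])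
       (auto simp: nome_def intro!: derivative_eq_intros has_field_derivative_eval_fps[OF r, unfolded nome_def])
  thus ?thesis unfolding qser_def[abs_def] e by (simp only: mult_ac)
qed

lemma qser_sums:
  assumes "fps_conv_radius f \<ge> 1" "Im z > 0"
  shows "(\<lambda>n. fps_nth f n * nome z ^ n) sums qser f z"
  unfolding qser_def by (rule sums_eval_fps[OF norm_nome_less_radius[OF assms]])

lemma qser_has_sum:
  assumes "fps_conv_radius f \<ge> 1" "Im z > 0"
  shows "((\<lambda>n. fps_nth f n * nome z ^ n) has_sum qser f z) UNIV"
  by (rule norm_summable_imp_has_sum[OF norm_summable_fps qser_sums])
     (use norm_nome_less_radius[OF assms] assms in auto)

section \<open>Polygamma functions and the cotangent\<close>

text \<open>Logarithmic derivative of
  \<open>Gamma z * Gamma (1 - z) = pi / sin (pi z)\<close>.\<close>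

lemma Digamma_reflection:
  fixes z :: complex
  assumes "z \<notin> \<int>"
  shows "Digamma (1 - z) - Digamma z = of_real pi * cot (of_real pi * z)"
proof -
  have nz: "z \<notin> \<int>\<^sub>\<le>\<^sub>0" "1 - z \<notin> \<int>\<^sub>\<le>\<^sub>0"
    using assms by (auto dest: nonpos_Ints_Int)
  have s: "sin (of_real pi * z) \<noteq> 0"
  proof
    assume "sin (of_real pi * z) = 0"
    then obtain n :: int where n: "of_real pi * z = of_real (of_int n * pi)"
      unfolding Complex_Transcendental.sin_eq_0 by blast
    hence "z = of_int n" by simp
    with assms show False by simp
  qed
  have op: "open (- \<int> :: complex set)" using closed_Ints by (simp add: open_Compl)
  have "((\<lambda>z. Gamma z * Gamma (1 - z)) has_field_derivative
          Gamma z * Digamma z * Gamma (1 - z) - Gamma z * (Gamma (1 - z) * Digamma (1 - z))) (at z)"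
    using nz by (auto intro!: derivative_eq_intros)
  moreover have "((\<lambda>z. of_real pi / sin (of_real pi * z)) has_field_derivative
       - (of_real pi * (cos (of_real pi * z) * of_real pi)) / (sin (of_real pi * z))\<^sup>2) (at z)"
    using s by (auto intro!: derivative_eq_intros simp: power2_eq_square)
  ultimately have "Gamma z * Digamma z * Gamma (1 - z) - Gamma z * (Gamma (1 - z) * Digamma (1 - z)) =
      - (of_real pi * (cos (of_real pi * z) * of_real pi)) / (sin (of_real pi * z))\<^sup>2"
    unfolding Gamma_reflection_complex using DERIV_unique by blast
  hence "(Gamma z * Gamma (1 - z)) * (Digamma (1 - z) - Digamma z) =
      (of_real pi / sin (of_real pi * z)) * (of_real pi * cot (of_real pi * z))"
    by (simp add: algebra_simps cot_def power2_eq_square)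
  thus ?thesis unfolding Gamma_reflection_complex using s by simp
qed

text \<open>The \<open>n\<close>-th derivative of
  \<open>Digamma (1 - z) - Digamma z = pi cot (pi z)\<close>. Expanding it once over the integers
  and once in powers of \<open>q\<close> yields the Lipschitz formula.\<close>

definition Polygamma_refl :: "nat \<Rightarrow> complex \<Rightarrow> complex" where
  "Polygamma_refl n z = (-1) ^ n * Polygamma n (1 - z) - Polygamma n z"

lemma Polygamma_refl_has_field_derivative:
  assumes "z \<notin> \<int>"
  shows "(Polygamma_refl n has_field_derivative Polygamma_refl (Suc n) z) (at z)"
proof -
  have nz: "z \<notin> \<int>\<^sub>\<le>\<^sub>0" "1 - z \<notin> \<int>\<^sub>\<le>\<^sub>0"
    using assms by (auto dest: nonpos_Ints_Int)
  show ?thesis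
    unfolding Polygamma_refl_def[abs_def] using nz by (auto intro!: derivative_eq_intros)
qed

text \<open>The induction step shared by the expansion in \<open>q\<close> and the polynomial in the
  cotangent: a closed form valid on an open set may be differentiated.\<close>

lemma Polygamma_refl_eqI:
  assumes "open S" "S \<inter> \<int> = {}" "z \<in> S"
    and "\<And>w. w \<in> S \<Longrightarrow> Polygamma_refl n w = g w"
    and "(g has_field_derivative g') (at z)"
  shows "Polygamma_refl (Suc n) z = g'"
proof -
  have "(g has_field_derivative Polygamma_refl (Suc n) z) (at z)"
    by (rule has_field_derivative_transform_within_open[OF
          Polygamma_refl_has_field_derivative assms(1)]) (use assms in auto)
  thus ?thesis using assms(5) DERIV_unique by blast
qed


lemma inverse_power_le:
  fixes r x :: real
  assumes "1 \<le> r" "r \<le> x" "n > 0"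
  shows "inverse (x ^ Suc n) \<le> inverse (r ^ 2)"
proof -
  have "r ^ 2 \<le> r ^ Suc n" by (rule power_increasing) (use assms in auto)
  also have "\<dots> \<le> x ^ Suc n" by (rule power_mono) (use assms in auto)
  finally show ?thesis by (rule le_imp_inverse_le) (use assms in auto)
qed

text \<open>Unconditional summation is what later allows two half lines of integers to be
  joined.\<close>

lemma Polygamma_has_sum:
  fixes w :: complex
  assumes "w \<noteq> 0" "n > 0"
  shows "((\<lambda>k::nat. inverse ((w + of_nat k) ^ Suc n)) has_sum ((-1) ^ Suc n * (Polygamma n w / fact n))) UNIV"
proof (rule norm_summable_imp_has_sum)
  show "(\<lambda>k. inverse ((w + of_nat k) ^ Suc n)) sums ((- 1) ^ Suc n * (Polygamma n w / fact n))"
    using Polygamma_LIMSEQ[OF assms] by (simp only: times_divide_eq_right)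
  show "summable (\<lambda>k. norm (inverse ((w + of_nat k) ^ Suc n)))"
  proof (rule summable_comparison_test_ev)
    show "summable (\<lambda>k. 4 * inverse (real k ^ 2))"
      by (intro summable_mult inverse_power_summable) auto
    \<comment> \<open>Beyond \<open>2 |w| + 2\<close> the shift by \<open>w\<close> costs at most
      half of \<open>k\<close>, so \<open>|w + k| >= k / 2 >= 1\<close>.\<close>
    have "\<forall>\<^sub>F k in sequentially. real k \<ge> 2 * norm w + 2"
      by (rule eventually_compose_filterlim[OF eventually_ge_at_top filterlim_real_sequentially])
    thus "\<forall>\<^sub>F k in sequentially. norm (norm (inverse ((w + of_nat k) ^ Suc n))) \<le> 4 * inverse (real k ^ 2)"
    proof eventually_elim
      case (elim k)
      have "norm (of_nat k :: complex) - norm w \<le> norm (of_nat k + w)"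
        by (rule norm_diff_ineq)
      hence k: "real k / 2 \<le> norm (w + of_nat k)" "1 \<le> real k / 2"
        using elim norm_ge_zero[of w] unfolding norm_of_nat add.commute[of w] by linarith+
      have "inverse (norm (w + of_nat k) ^ Suc n) \<le> inverse ((real k / 2) ^ 2)"
        by (rule inverse_power_le[OF k(2,1) assms(2)])
      also have "inverse ((real k / 2) ^ 2) = 4 * inverse (real k ^ 2)"
        by (simp add: power_divide inverse_eq_divide)
      finally show ?case unfolding real_norm_def norm_inverse norm_power by (simp del: power_Suc)
    qed
  qed
qed

text \<open>The series of \<open>Polygamma n z\<close> covers \<open>k >= 0\<close>; that of
  \<open>Polygamma n (1 - z)\<close> covers \<open>k < 0\<close>, because
  \<open>1 - z + k = - (z + (- k - 1))\<close>.\<close>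

lemma Polygamma_refl_has_sum:
  assumes "z \<notin> \<int>" "n > 0"
  shows "((\<lambda>k::int. 1 / (z + of_int k) ^ Suc n) has_sum ((-1) ^ n * Polygamma_refl n z / fact n)) UNIV"
proof -
  have nz: "z \<noteq> 0" "1 - z \<noteq> 0" using assms by auto
  have 1: "((\<lambda>k::int. 1 / (z + of_int k) ^ Suc n) has_sum ((-1) ^ Suc n * (Polygamma n z / fact n))) {0..}"
  proof (subst has_sum_reindex_bij_witness[of _ int nat UNIV "\<lambda>k. inverse ((z + of_nat k) ^ Suc n)"])
  qed (use Polygamma_has_sum[OF nz(1) assms(2)] in \<open>auto simp: inverse_eq_divide\<close>)
  have e: "inverse ((1 - z + of_nat k) ^ Suc n) = (-1) ^ Suc n * (1 / (z + of_int (- int k - 1)) ^ Suc n)"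
    for k
  proof -
    define w where "w = z + of_int (- int k - 1)"
    have "1 - z + of_nat k = - w" by (simp add: w_def)
    thus ?thesis unfolding w_def[symmetric]
      by (simp only: power_minus[of w] inverse_mult_distrib inverse_eq_divide) (cases "even n"; simp)
  qed
  have sq: "(-1) ^ m * ((-1) ^ m * x) = x" for x :: complex and m
    by (simp flip: mult.assoc power_mult_distrib)
  have "((\<lambda>k::nat. (-1) ^ Suc n * inverse ((1 - z + of_nat k) ^ Suc n)) has_sum
          (-1) ^ Suc n * ((-1) ^ Suc n * (Polygamma n (1 - z) / fact n))) UNIV"
    by (intro has_sum_cmult_right Polygamma_has_sum nz assms)
  hence "((\<lambda>k::nat. 1 / (z + of_int (- int k - 1)) ^ Suc n) has_sum (Polygamma n (1 - z) / fact n)) UNIV"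
    unfolding e sq .
  hence 2: "((\<lambda>k::int. 1 / (z + of_int k) ^ Suc n) has_sum (Polygamma n (1 - z) / fact n)) {..<0}"
    by (subst has_sum_reindex_bij_witness[of _ "\<lambda>k. - int k - 1" "\<lambda>k. nat (- k - 1)" UNIV]) auto
  have "(-1) ^ n * Polygamma_refl n z / fact n = (-1) ^ Suc n * (Polygamma n z / fact n) + Polygamma n (1 - z) / fact n"
    unfolding Polygamma_refl_def right_diff_distrib sq by (simp add: diff_divide_distrib)
  moreover have "{0..} \<union> {..<0} = (UNIV :: int set)" "{0..} \<inter> {..<0} = ({} :: int set)" by auto
  ultimately show ?thesis
    using has_sum_Un_disjoint[OF 1 2] by (simp only:)
qed

lemma cot_nome:
  assumes "Im z > 0"
  shows "of_real pi * cot (of_real pi * z) = - \<i> * pi - 2 * of_real pi * \<i> * (nome z / (1 - nome z))"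
proof -
  define u where "u = exp (\<i> * (of_real pi * z))"
  have u: "u \<noteq> 0" by (simp add: u_def)
  have q: "nome z = u ^ 2"
    by (simp add: nome_def u_def power2_eq_square mult_ac flip: exp_add)
  have "norm (u ^ 2) < 1" using norm_nome_less_1[OF assms] unfolding q .
  hence n: "1 - u ^ 2 \<noteq> 0" by auto
  have m: "exp (- (\<i> * (of_real pi * z))) = 1 / u"
    by (simp add: u_def exp_minus field_simps)
  have "cot (of_real pi * z) = (u + 1 / u) / 2 / ((u - 1 / u) / (2 * \<i>))"
    unfolding cot_def cos_exp_eq sin_exp_eq m u_def[symmetric] ..
  also have "\<dots> = \<i> * (u ^ 2 + 1) / (u ^ 2 - 1)"
    using u n by (simp add: field_simps power2_eq_square)
  also have "\<dots> = - \<i> - 2 * \<i> * (u ^ 2 / (1 - u ^ 2))"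
    using n by (simp add: divide_simps) (simp add: algebra_simps)
  finally show ?thesis unfolding q by (simp add: ring_distribs mult_ac)
qed

section \<open>Expansion in powers of q\<close>

text \<open>The series of \<open>r^n q^r\<close> over \<open>r >= 1\<close>. The constant term is
  removed by hand because \<open>0^0 = 1\<close> would spoil the case \<open>n = 0\<close>, which
  has to be \<open>q / (1 - q)\<close>.\<close>

definition power_fps :: "nat \<Rightarrow> complex fps" where
  "power_fps n = (fps_XD ^^ n) (Abs_fps (\<lambda>r. if r = 0 then 0 else 1))"

lemma power_fps_nth: "n > 0 \<Longrightarrow> fps_nth (power_fps n) r = of_nat r ^ n"
  by (simp add: power_fps_def fps_mult_fps_XD_shift)

lemma power_fps_Suc: "power_fps (Suc n) = fps_XD (power_fps n)"
  by (simp add: power_fps_def)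

lemma power_fps_conv_radius: "fps_conv_radius (power_fps n) \<ge> 1"
proof (induction n)
  case 0
  have "summable (\<lambda>r. fps_nth (power_fps 0) r * of_real x ^ r)" if "0 \<le> x" "x < 1" for x :: real
  proof (rule summable_comparison_test)
    show "summable (\<lambda>r. x ^ r)" using that by (intro summable_geometric) auto
  qed (use that in \<open>auto simp: power_fps_def norm_mult norm_power\<close>)
  thus ?case unfolding fps_conv_radius_def
    by (intro conv_radius_geI_ex') (auto simp: one_ereal_def)
qed (simp add: power_fps_def fps_conv_radius_XD)

lemma qser_power_fps_0:
  assumes "Im z > 0"
  shows "qser (power_fps 0) z = nome z / (1 - nome z)"
proof -
  let ?q = "nome z"
  have "(\<lambda>n. ?q * ?q ^ n) sums (?q * (1 / (1 - ?q)))"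
    by (intro sums_mult geometric_sums norm_nome_less_1 assms)
  also have "(\<lambda>n. ?q * ?q ^ n) = (\<lambda>n. fps_nth (power_fps 0) (Suc n) * ?q ^ Suc n)"
    by (simp add: power_fps_def)
  finally have "(\<lambda>n. fps_nth (power_fps 0) n * ?q ^ n) sums
      (?q * (1 / (1 - ?q)) + fps_nth (power_fps 0) 0 * ?q ^ 0)"
    by (subst (asm) sums_Suc_iff)
  moreover have "fps_nth (power_fps 0) 0 = 0" by (simp add: power_fps_def)
  ultimately have "(\<lambda>n. fps_nth (power_fps 0) n * ?q ^ n) sums (?q / (1 - ?q))"
    by simp
  from sums_unique2[OF qser_sums[OF power_fps_conv_radius assms] this] show ?thesis .
qed

lemma upper_half_plane_no_Ints: "{z. Im z > 0} \<inter> \<int> = {}"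
  by (auto elim!: Ints_cases)

text \<open>Repeated differentiation of the expansion of the cotangent; its constant term
  \<open>- i pi\<close> disappears at the first step.\<close>

lemma Polygamma_refl_nome:
  assumes "Im z > 0"
  shows "Polygamma_refl n z = (if n = 0 then - \<i> * pi else 0) - (2 * of_real pi * \<i>) ^ Suc n * qser (power_fps n) z"
  using assms
proof (induction n arbitrary: z)
  case 0
  have "z \<notin> \<int>" using upper_half_plane_no_Ints 0 by blast
  thus ?case using Digamma_reflection[of z] cot_nome[OF 0] qser_power_fps_0[OF 0]
    by (simp add: Polygamma_refl_def)
next
  case (Suc n)
  show ?case
  proof (rule Polygamma_refl_eqI[OF _ upper_half_plane_no_Ints])
    show "open {z. Im z > 0}" by (rule open_halfspace_Im_gt)
    have "(qser (power_fps n) has_field_derivative 2 * of_real pi * \<i> * qser (power_fps (Suc n)) z) (at z)"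
      unfolding power_fps_Suc by (rule qser_has_field_derivative[OF power_fps_conv_radius Suc.prems])
    thus "((\<lambda>z. (if n = 0 then - \<i> * pi else 0) - (2 * of_real pi * \<i>) ^ Suc n * qser (power_fps n) z)
      has_field_derivative (if Suc n = 0 then - \<i> * pi else 0) - (2 * of_real pi * \<i>) ^ Suc (Suc n) * qser (power_fps (Suc n)) z) (at z)"
      by (rule DERIV_cong[OF DERIV_diff[OF DERIV_const DERIV_cmult]]) simp
  qed (use Suc in auto)
qed

text \<open>Two expansions of the same derivative of the cotangent are compared: partial fractions
  on the left, powers of \<open>q\<close> on the right.\<close>

theorem Lipschitz_formula:
  assumes "Im z > 0" "n > 0"
  shows "((\<lambda>k::int. 1 / (z + of_int k) ^ Suc n) has_sum
           ((- 2 * of_real pi * \<i>) ^ Suc n / fact n * qser (power_fps n) z)) UNIV"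
proof -
  have "z \<notin> \<int>" using upper_half_plane_no_Ints assms by blast
  have "(- 2 * of_real pi * \<i>) ^ Suc n / fact n * qser (power_fps n) z = (-1) ^ n * Polygamma_refl n z / fact n"
    using assms(2) power_mult_distrib[of "-1" "2 * of_real pi * \<i>" "Suc n"]
    by (simp add: Polygamma_refl_nome[OF assms(1)])
  with Polygamma_refl_has_sum[OF \<open>z \<notin> \<int>\<close> assms(2)] show ?thesis by simp
qed

subsection \<open>Eisenstein series as lattice sums\<close>

lemma fps_conv_radius_ge_1_polynomial_growth:
  fixes f :: "complex fps"
  assumes "\<And>n. n > 0 \<Longrightarrow> norm (fps_nth f n) \<le> C * real n ^ e"
  shows "fps_conv_radius f \<ge> 1"
proof -
  have "summable (\<lambda>n. fps_nth f n * of_real x ^ n)" if x: "0 < x" "x < 1" for x :: real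
  proof (rule summable_comparison_test_ev)
    \<comment> \<open>The comparison series has exponent \<open>e + 1\<close>, so that
      \<open>power_fps_nth\<close>, which asks for a positive exponent, also covers
      \<open>e = 0\<close>.\<close>
    have "ereal (norm (of_real x :: complex)) < fps_conv_radius (power_fps (Suc e))"
      using power_fps_conv_radius[of "Suc e"] x
      by (intro less_le_trans[OF _ power_fps_conv_radius]) (auto simp: one_ereal_def)
    from norm_summable_fps[OF this]
    have "summable (\<lambda>n. real n ^ Suc e * x ^ n)"
      using x by (simp add: power_fps_nth norm_mult norm_power)
    thus "summable (\<lambda>n. \<bar>C\<bar> * (real n ^ Suc e * x ^ n))" by (rule summable_mult)
    show "\<forall>\<^sub>F n in sequentially. norm (fps_nth f n * of_real x ^ n) \<le> \<bar>C\<bar> * (real n ^ Suc e * x ^ n)"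
      using eventually_gt_at_top[of 0]
    proof eventually_elim
      case (elim n)
      have "norm (fps_nth f n) \<le> C * real n ^ e" using assms elim by blast
      also have "\<dots> \<le> \<bar>C\<bar> * real n ^ Suc e"
        using elim by (intro mult_mono power_increasing) auto
      finally have "norm (fps_nth f n) * x ^ n \<le> \<bar>C\<bar> * real n ^ Suc e * x ^ n"
        using x by (intro mult_right_mono) auto
      thus ?case using x by (simp add: norm_mult norm_power mult_ac)
    qed
  qed
  thus ?thesis unfolding fps_conv_radius_def
    by (intro conv_radius_geI_ex') (auto simp: one_ereal_def)
qed

lemma divisor_sigma_0: "divisor_sigma r 0 = 0"
  by (simp add: divisor_sigma_def)

lemma divisor_sigma_le: "divisor_sigma r n \<le> n ^ Suc r"
proof (cases "n = 0")
  case False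
  have "divisor_sigma r n \<le> (\<Sum>d | d dvd n. n ^ r)"
    unfolding divisor_sigma_def using False
    by (intro sum_mono power_mono) (auto intro: dvd_imp_le)
  also have "\<dots> = card {d. d dvd n} * n ^ r" by simp
  also have "card {d. d dvd n} \<le> card {1..n}"
    using False by (intro card_mono) (auto intro: dvd_imp_le gr0I)
  finally show ?thesis by simp
qed (simp add: divisor_sigma_0)

definition sigma_fps :: "nat \<Rightarrow> complex fps" where
  "sigma_fps r = Abs_fps (\<lambda>n. of_nat (divisor_sigma r n))"

lemma sigma_fps_conv_radius: "fps_conv_radius (sigma_fps r) \<ge> 1"
proof (rule fps_conv_radius_ge_1_polynomial_growth)
  fix n :: nat
  have "real (divisor_sigma r n) \<le> real (n ^ Suc r)"
    using divisor_sigma_le of_nat_le_iff by blast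
  thus "norm (fps_nth (sigma_fps r) n) \<le> 1 * real n ^ Suc r"
    by (simp add: sigma_fps_def)
qed

lemma nome_mult_of_nat: "nome (of_nat m * z) = nome z ^ m"
  unfolding nome_def by (subst exp_of_nat_mult[symmetric]) (simp only: mult_ac)

text \<open>Writing \<open>N = d m\<close> regroups \<open>\<sigma>(N) q^N\<close> by the cofactor
  \<open>m\<close> of the divisor \<open>d\<close>; absolute summability over the pairs justifies
  this.\<close>

theorem Lambert_series_has_sum:
  assumes "Im z > 0" "r > 0"
  shows "((\<lambda>m. qser (power_fps r) (of_nat m * z)) has_sum qser (sigma_fps r) z) {1..}"
proof -
  define q where "q = nome z"
  define T where "T = (\<lambda>(N::nat, d::nat). of_nat d ^ r * q ^ N :: complex)"
  have inner: "((\<lambda>d. g (of_nat d ^ r * q ^ N)) has_sum (\<Sum>d | d dvd N. g (of_nat d ^ r * q ^ N))) {d. d dvd N}"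
    if "N \<in> {1..}" for N :: nat and g :: "complex \<Rightarrow> 'a::{comm_monoid_add,topological_space}"
    using that by (intro has_sum_finite) auto
  have "(\<lambda>x. norm (T x)) summable_on Sigma {1..} (\<lambda>N. {d. d dvd N})"
  proof (rule summable_on_SigmaI[where g = "\<lambda>N. norm (fps_nth (sigma_fps r) N * q ^ N)"])
    fix N :: nat assume N: "N \<in> {1..}"
    \<comment> \<open>Divisor sums have nonnegative terms, so summing norms over \<open>d\<close>
      gives exactly the norm of the coefficient.\<close>
    have "(\<Sum>d | d dvd N. norm (of_nat d ^ r * q ^ N)) = norm (fps_nth (sigma_fps r) N * q ^ N)"
      by (simp add: sigma_fps_def divisor_sigma_def norm_mult norm_power del: of_nat_sum) (simp add: sum_distrib_right)
    thus "((\<lambda>d. norm (T (N, d))) has_sum norm (fps_nth (sigma_fps r) N * q ^ N)) {d. d dvd N}"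
      using inner[OF N, of norm] by (simp add: T_def)
  next
    have "summable (\<lambda>N. norm (fps_nth (sigma_fps r) N * q ^ N))" unfolding q_def
      by (intro norm_summable_fps norm_nome_less_radius sigma_fps_conv_radius assms)
    hence "(\<lambda>N. norm (fps_nth (sigma_fps r) N * q ^ N)) summable_on UNIV"
      by (simp add: summable_on_UNIV_nonneg_real_iff)
    thus "(\<lambda>N. norm (fps_nth (sigma_fps r) N * q ^ N)) summable_on {1..}"
      by (rule summable_on_subset) auto
  qed auto
  hence summ: "T summable_on Sigma {1..} (\<lambda>N. {d. d dvd N})"
    by (rule abs_summable_summable)
  have "((\<lambda>N. fps_nth (sigma_fps r) N * q ^ N) has_sum qser (sigma_fps r) z) UNIV"
    unfolding q_def by (intro qser_has_sum sigma_fps_conv_radius assms)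
  hence outer: "((\<lambda>N. fps_nth (sigma_fps r) N * q ^ N) has_sum qser (sigma_fps r) z) {1..}"
    by (rule has_sum_cong_neutral[THEN iffD1, rotated -1])
       (auto simp: sigma_fps_def divisor_sigma_0 not_le)
  have "(T has_sum qser (sigma_fps r) z) (Sigma {1..} (\<lambda>N. {d. d dvd N}))"
  proof (rule has_sum_SigmaI[OF _ outer summ])
    fix N :: nat assume N: "N \<in> {1..}"
    have "(\<Sum>d | d dvd N. of_nat d ^ r * q ^ N) = fps_nth (sigma_fps r) N * q ^ N"
      by (simp add: sigma_fps_def divisor_sigma_def sum_distrib_right)
    thus "((\<lambda>d. T (N, d)) has_sum (fps_nth (sigma_fps r) N * q ^ N)) {d. d dvd N}"
      using inner[OF N, of "\<lambda>x. x"] by (simp add: T_def)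
  qed
  also have "?this \<longleftrightarrow> ((\<lambda>(m, d). of_nat d ^ r * q ^ (d * m)) has_sum qser (sigma_fps r) z) ({1..} \<times> {1..})"
    by (rule has_sum_reindex_bij_witness[of _ "\<lambda>(m, d). (d * m, d)" "\<lambda>(N, d). (N div d, d)"])
       (auto simp: T_def Suc_le_eq elim!: dvdE intro: gr0I)
  finally have main: "((\<lambda>(m, d). of_nat d ^ r * q ^ (d * m)) has_sum qser (sigma_fps r) z) ({1..} \<times> {1..})" .
  show ?thesis
  proof (rule has_sum_SigmaD[OF main])
    fix m :: nat assume m: "m \<in> {1..}"
    have "Im (of_nat m * z) > 0" using m assms by simp
    have e: "nome (of_nat m * z) ^ d = q ^ (d * m)" for d
      by (simp add: nome_mult_of_nat q_def mult.commute[of d] power_mult)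
    from qser_has_sum[OF power_fps_conv_radius[of r] \<open>Im (of_nat m * z) > 0\<close>]
    have "((\<lambda>d. of_nat d ^ r * q ^ (d * m)) has_sum qser (power_fps r) (of_nat m * z)) UNIV"
      by (simp only: power_fps_nth[OF assms(2)] e)
    thus "((\<lambda>d. case (m, d) of (m, d) \<Rightarrow> of_nat d ^ r * q ^ (d * m)) has_sum qser (power_fps r) (of_nat m * z)) {1..}"
      unfolding prod.case
      by (rule has_sum_cong_neutral[THEN iffD1, rotated -1]) (use assms in \<open>auto simp: not_le\<close>)
  qed
qed

definition zeta_even :: "nat \<Rightarrow> real" where
  "zeta_even l = suminf (\<lambda>n. 1 / real (Suc n) ^ (2 * l))"

definition Lipschitz_const :: "nat \<Rightarrow> complex" where
  "Lipschitz_const l = (2 * of_real pi * \<i>) ^ (2 * l) / fact (2 * l - 1)"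

text \<open>Normalised to have coefficient 1 at \<open>q\<close>. For \<open>l > 0\<close> the
  constant term is \<open>- B_(2l) / (4 l)\<close>, written so that the lattice sum is
  \<open>2 * Lipschitz_const l\<close> times this series.\<close>

definition eis_fps :: "nat \<Rightarrow> complex fps" where
  "eis_fps l = fps_const (of_real (zeta_even l) / Lipschitz_const l) + sigma_fps (2 * l - 1)"

lemma eis_fps_conv_radius: "fps_conv_radius (eis_fps l) \<ge> 1"
  unfolding eis_fps_def using sigma_fps_conv_radius[of "2 * l - 1"]
    fps_conv_radius_add[of "fps_const (of_real (zeta_even l) / Lipschitz_const l)" "sigma_fps (2 * l - 1)"]
  by (simp add: min_def)

lemma qser_eis_fps:
  assumes "Im z > 0"
  shows "qser (eis_fps l) z = of_real (zeta_even l) / Lipschitz_const l + qser (sigma_fps (2 * l - 1)) z"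
  unfolding eis_fps_def qser_def
  by (subst eval_fps_add) (use norm_nome_less_radius[OF sigma_fps_conv_radius assms] in auto)

lemma zeta_even_sums: "l > 0 \<Longrightarrow> (\<lambda>n. 1 / real (Suc n) ^ (2 * l)) sums zeta_even l"
  unfolding zeta_even_def
  using inverse_power_summable[of "2 * l", where ?'a = real]
  by (intro summable_sums, subst summable_Suc_iff) (simp add: inverse_eq_divide)

lemma has_sum_int_split:
  fixes f :: "int \<Rightarrow> 'a::real_normed_vector"
  assumes "(f has_sum a) {1..}" "((\<lambda>m. f (- m)) has_sum b) {1..}"
  shows "(f has_sum (f 0 + (a + b))) UNIV"
proof -
  have "(f has_sum b) {..-1}"
    using assms(2) by (subst has_sum_reindex_bij_witness[of _ uminus uminus "{1..}" "\<lambda>m. f (- m)"]) auto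
  with assms(1) have "(f has_sum (a + b)) ({1..} \<union> {..-1})"
    by (rule has_sum_Un_disjoint) auto
  hence "(f has_sum (f 0 + (a + b))) (insert 0 ({1..} \<union> {..-1}))"
    by (intro has_sum_insert) auto
  also have "insert 0 ({1..} \<union> {..-1}) = (UNIV :: int set)" by auto
  finally show ?thesis .
qed

lemma zeta_even_has_sum_int:
  assumes "l > 0"
  shows "((\<lambda>n::int. 1 / of_int n ^ (2 * l) :: complex) has_sum (2 * of_real (zeta_even l))) UNIV"
proof -
  have "((\<lambda>n. 1 / real (Suc n) ^ (2 * l)) has_sum zeta_even l) UNIV"
    using zeta_even_sums[OF assms] by (intro sums_nonneg_imp_has_sum) auto
  hence "((\<lambda>n. of_real (1 / real (Suc n) ^ (2 * l)) :: complex) has_sum of_real (zeta_even l)) UNIV"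
    by (rule has_sum_of_real)
  also have "?this \<longleftrightarrow> ((\<lambda>n::int. 1 / of_int n ^ (2 * l) :: complex) has_sum of_real (zeta_even l)) {1..}"
    by (rule has_sum_reindex_bij_witness[of _ "\<lambda>n. nat (n - 1)" "\<lambda>n. int n + 1"]) (auto simp: add_ac)
  finally have *: "((\<lambda>n::int. 1 / of_int n ^ (2 * l) :: complex) has_sum of_real (zeta_even l)) {1..}" .
  \<comment> \<open>The term at \<open>n = 0\<close> is \<open>1 / 0 = 0\<close>, which leaves the
    two equal halves.\<close>
  have "(0::complex) ^ (2 * l) = 0" using assms by simp
  with has_sum_int_split[OF *, of "of_real (zeta_even l)"] * show ?thesis by simp
qed

lemma Lipschitz_even:
  assumes "Im z > 0" "l > 0"
  shows "((\<lambda>k::int. 1 / (z + of_int k) ^ (2 * l)) has_sum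
           (Lipschitz_const l * qser (power_fps (2 * l - 1)) z)) UNIV"
proof -
  have *: "Suc (2 * l - 1) = 2 * l" "2 * l - 1 > 0" using assms(2) by auto
  have "(- 2 * pi * \<i>) ^ (2 * l) = (2 * of_real pi * \<i>) ^ (2 * l)"
    by (simp add: power_mult power2_eq_square)
  thus ?thesis using Lipschitz_formula[OF assms(1) *(2)] unfolding * Lipschitz_const_def by simp
qed

text \<open>The term at the origin is \<open>1 / 0 = 0\<close>, so it need not be excluded.\<close>

definition lattice_row :: "nat \<Rightarrow> complex \<Rightarrow> int \<Rightarrow> complex" where
  "lattice_row l z m = (\<Sum>\<^sub>\<infinity>n::int. 1 / (of_int m * z + of_int n) ^ (2 * l))"

lemma lattice_row_has_sum_aux:
  assumes "Im z > 0" "l > 0"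
  shows "((\<lambda>n::int. 1 / (of_int m * z + of_int n) ^ (2 * l)) has_sum
     (if m = 0 then 2 * of_real (zeta_even l)
      else Lipschitz_const l * qser (power_fps (2 * l - 1)) (of_nat (nat \<bar>m\<bar>) * z))) UNIV"
proof (cases m "0 :: int" rule: linorder_cases)
  case equal
  thus ?thesis using zeta_even_has_sum_int[OF assms(2)] by simp
next
  case greater
  hence *: "Im (of_nat (nat \<bar>m\<bar>) * z) > 0" "of_int m = (of_nat (nat \<bar>m\<bar>) :: complex)" "m \<noteq> 0"
    using assms by auto
  from Lipschitz_even[OF *(1) assms(2)] show ?thesis unfolding *(2) if_not_P[OF *(3)] .
next
  case less
  hence *: "Im (of_nat (nat \<bar>m\<bar>) * z) > 0" "of_int m = - (of_nat (nat \<bar>m\<bar>) :: complex)" using assms less by (auto simp: mult_neg_pos)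
  have "((\<lambda>n::int. 1 / (of_nat (nat \<bar>m\<bar>) * z + of_int n) ^ (2 * l)) has_sum
      (Lipschitz_const l * qser (power_fps (2 * l - 1)) (of_nat (nat \<bar>m\<bar>) * z))) UNIV"
    by (rule Lipschitz_even[OF *(1) assms(2)])
  also have "?this \<longleftrightarrow> ((\<lambda>n::int. 1 / (of_int m * z + of_int n) ^ (2 * l)) has_sum
      (Lipschitz_const l * qser (power_fps (2 * l - 1)) (of_nat (nat \<bar>m\<bar>) * z))) UNIV"
  proof (rule has_sum_reindex_bij_witness[of _ uminus uminus])
    fix n :: int
    have "of_int m * z + of_int (- n) = - (of_nat (nat \<bar>m\<bar>) * z + of_int n)" using *(2) by simp
    thus "1 / (of_int m * z + of_int (- n)) ^ (2 * l) = 1 / (of_nat (nat \<bar>m\<bar>) * z + of_int n) ^ (2 * l)"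
      by (simp only:) (simp only: power_mult power2_minus)
  qed auto
  finally show ?thesis using less by simp
qed

lemma lattice_row_eq:
  assumes "Im z > 0" "l > 0"
  shows "lattice_row l z m = (if m = 0 then 2 * of_real (zeta_even l)
      else Lipschitz_const l * qser (power_fps (2 * l - 1)) (of_nat (nat \<bar>m\<bar>) * z))"
  unfolding lattice_row_def by (rule infsumI[OF lattice_row_has_sum_aux[OF assms]])

lemma lattice_row_has_sum:
  assumes "Im z > 0" "l > 0"
  shows "((\<lambda>n::int. 1 / (of_int m * z + of_int n) ^ (2 * l)) has_sum lattice_row l z m) UNIV"
  unfolding lattice_row_eq[OF assms] by (rule lattice_row_has_sum_aux[OF assms])

text \<open>Rows \<open>m\<close> and \<open>- m\<close> agree, and the positive rows form a Lambert
  series. Since rows are summed first, this includes the conditionally convergent case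
  \<open>l = 1\<close>.\<close>

lemma lattice_rows_has_sum:
  assumes "Im z > 0" "l > 0"
  shows "(lattice_row l z has_sum (2 * Lipschitz_const l * qser (eis_fps l) z)) UNIV"
proof -
  let ?L = "Lipschitz_const l * qser (sigma_fps (2 * l - 1)) z"
  have K: "Lipschitz_const l \<noteq> 0" by (simp add: Lipschitz_const_def)
  have "((\<lambda>m. Lipschitz_const l * qser (power_fps (2 * l - 1)) (of_nat m * z)) has_sum ?L) {1..}"
    using assms by (intro has_sum_cmult_right Lambert_series_has_sum) auto
  also have "?this \<longleftrightarrow> ((\<lambda>m. lattice_row l z m) has_sum ?L) {1..}"
    by (rule has_sum_reindex_bij_witness[of _ nat int]) (auto simp: lattice_row_eq assms)
  finally have 1: "((\<lambda>m. lattice_row l z m) has_sum ?L) {1..}" .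
  moreover have "lattice_row l z (- m) = lattice_row l z m" for m
    unfolding lattice_row_eq[OF assms] by simp
  ultimately have "((\<lambda>m. lattice_row l z (- m)) has_sum ?L) {1..}" by simp
  with 1 have "(lattice_row l z has_sum (lattice_row l z 0 + (?L + ?L))) UNIV"
    by (rule has_sum_int_split)
  moreover have "lattice_row l z 0 + (?L + ?L) = 2 * Lipschitz_const l * qser (eis_fps l) z"
    unfolding lattice_row_eq[OF assms] qser_eis_fps[OF assms(1)] using K by (simp add: distrib_left)
  ultimately show ?thesis by (simp only:)
qed

subsection \<open>Inversion formulas\<close>

text \<open>Of order \<open>|m|^(-1/2)\<close>. Splitting \<open>1 / |m z + n|\<close> evenly into a
  factor in \<open>m\<close> and a factor in \<open>n\<close> makes the cubes of these factors
  summable separately, hence a double series of cubic decay absolutely convergent.\<close>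

definition lattice_weight :: "int \<Rightarrow> real" where
  "lattice_weight m = 1 / sqrt (sqrt (1 + (real_of_int m)\<^sup>2))"

lemma lattice_weight_pos: "lattice_weight m > 0"
  unfolding lattice_weight_def by (auto intro!: divide_pos_pos real_sqrt_gt_zero add_pos_nonneg)

lemma lattice_weight_le_1: "lattice_weight m \<le> 1"
proof -
  have "1 \<le> sqrt (sqrt (1 + (real_of_int m)\<^sup>2))" by simp
  thus ?thesis unfolding lattice_weight_def by (rule divide_le_eq_1_pos[THEN iffD2, rotated]) (use \<open>1 \<le> _\<close> in linarith)
qed

lemma lattice_weight_Suc: "lattice_weight (m + 1) \<le> 2 * lattice_weight m"
proof -
  let ?a = "1 + (real_of_int m)\<^sup>2" and ?b = "1 + (real_of_int (m + 1))\<^sup>2"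
  have pos: "?a > 0" "?b > 0" by (auto intro: add_pos_nonneg)
  \<comment> \<open>Completing the square:
    \<open>15 * (16 * ?b - ?a) = (15 m + 16)^2 + 209\<close>.\<close>
  have "0 \<le> (15 * real_of_int m + 16)\<^sup>2" by simp
  hence "?a \<le> 16 * ?b" by (simp add: power2_eq_square algebra_simps)
  hence "sqrt (sqrt ?a) \<le> sqrt (sqrt (16 * ?b))" by (intro real_sqrt_le_mono)
  also have "\<dots> = 2 * sqrt (sqrt ?b)" by (simp only: real_sqrt_mult) simp
  finally show ?thesis unfolding lattice_weight_def
    using pos by (simp add: field_simps)
qed

lemma lattice_weight_summable: "(\<lambda>m. lattice_weight m ^ 3) summable_on UNIV"
proof -
  have le: "lattice_weight (int n) ^ 3 \<le> real n powr (-3/2)" if "n > 0" for n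
  proof -
    have "sqrt (real n) = sqrt (sqrt ((real_of_int (int n))\<^sup>2))" by simp
    also have "\<dots> \<le> sqrt (sqrt (1 + (real_of_int (int n))\<^sup>2))" by (intro real_sqrt_le_mono) simp
    finally have "lattice_weight (int n) \<le> 1 / sqrt (real n)"
      unfolding lattice_weight_def using that by (intro divide_left_mono) (auto intro!: mult_pos_pos add_pos_nonneg)
    also have "\<dots> = real n powr (-1/2)" using that powr_half_sqrt[of "real n"] by (simp add: powr_minus_divide)
    finally have "lattice_weight (int n) ^ 3 \<le> (real n powr (-1/2)) ^ 3"
      by (intro power_mono less_imp_le[OF lattice_weight_pos])
    also have "\<dots> = real n powr (-3/2)" using that by (simp flip: powr_realpow add: powr_powr)
    finally show ?thesis .
  qed
  have "summable (\<lambda>n. lattice_weight (int n) ^ 3)"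
  proof (rule summable_comparison_test_ev)
    show "summable (\<lambda>n. real n powr (-3/2))" by (subst summable_real_powr_iff) simp
    show "\<forall>\<^sub>F n in sequentially. norm (lattice_weight (int n) ^ 3) \<le> real n powr (-3/2)"
      using eventually_gt_at_top[of 0]
      by eventually_elim (use le lattice_weight_pos in \<open>auto simp: less_imp_le\<close>)
  qed
  hence "(\<lambda>n. lattice_weight (int n) ^ 3) summable_on UNIV"
    using less_imp_le[OF lattice_weight_pos] by (subst summable_on_UNIV_nonneg_real_iff) auto
  then obtain S where "((\<lambda>n. lattice_weight (int n) ^ 3) has_sum S) UNIV"
    by (auto simp: summable_on_def)
  hence "((\<lambda>n. lattice_weight (int n) ^ 3) has_sum (S - 1)) {1..}"
  proof -
    assume S: "((\<lambda>n. lattice_weight (int n) ^ 3) has_sum S) UNIV"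
    hence "(\<lambda>n. lattice_weight (int n) ^ 3) summable_on {1..}"
      by (intro summable_on_subset[OF has_sum_imp_summable[OF S]]) auto
    then obtain S' where S': "((\<lambda>n. lattice_weight (int n) ^ 3) has_sum S') {1..}"
      by (auto simp: summable_on_def)
    have "((\<lambda>n. lattice_weight (int n) ^ 3) has_sum (1 + S')) (insert 0 {1..})"
      using has_sum_insert[OF _ S', of 0] by (simp add: lattice_weight_def)
    also have "insert 0 {1..} = (UNIV :: nat set)" by auto
    finally have "1 + S' = S" using S has_sum_unique by blast
    hence "S' = S - 1" by simp
    with S' show ?thesis by (simp only:)
  qed
  also have "?this \<longleftrightarrow> ((\<lambda>n. lattice_weight n ^ 3) has_sum (S - 1)) {1..}"
    by (rule has_sum_reindex_bij_witness[of _ nat int]) auto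
  finally have 1: "((\<lambda>n. lattice_weight n ^ 3) has_sum (S - 1)) {1..}" .
  moreover have "lattice_weight (- n) = lattice_weight n" for n by (simp add: lattice_weight_def)
  ultimately show ?thesis
    using has_sum_int_split[OF 1, of "S - 1"] by (auto simp: summable_on_def)
qed

lemma lattice_summable:
  fixes f :: "int \<times> int \<Rightarrow> complex"
  assumes "\<And>m n. norm (f (m, n)) \<le> C * (lattice_weight m ^ 3 * lattice_weight n ^ 3)"
  shows "f summable_on UNIV"
proof -
  obtain S where S: "((\<lambda>m. lattice_weight m ^ 3) has_sum S) UNIV"
    using lattice_weight_summable by (auto simp: summable_on_def)
  have "(\<lambda>(m, n). lattice_weight m ^ 3 * lattice_weight n ^ 3) summable_on UNIV \<times> UNIV"
  proof (rule summable_on_SigmaI)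
    show "((\<lambda>n. case (m, n) of (m, n) \<Rightarrow> lattice_weight m ^ 3 * lattice_weight n ^ 3) has_sum
        (lattice_weight m ^ 3 * S)) UNIV" for m
      unfolding prod.case by (rule has_sum_cmult_right[OF S])
    show "(\<lambda>m. lattice_weight m ^ 3 * S) summable_on UNIV"
      by (rule summable_on_cmult_left[OF lattice_weight_summable])
  qed (auto intro!: mult_nonneg_nonneg zero_le_power less_imp_le[OF lattice_weight_pos])
  hence "(\<lambda>x. C * (case x of (m, n) \<Rightarrow> lattice_weight m ^ 3 * lattice_weight n ^ 3)) summable_on UNIV"
    by (intro summable_on_cmult_right) simp
  hence "(\<lambda>x. norm (f x)) summable_on UNIV"
    by (rule Infinite_Sum.abs_summable_on_comparison_test') (use assms in auto)
  thus ?thesis by (rule abs_summable_summable)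
qed

text \<open>With \<open>X = m z + n\<close>, the imaginary part of \<open>X\<close> controls
  \<open>|m|\<close>, and then \<open>|n| <= |X| + |m| |z|\<close>; so
  \<open>m^2 + n^2 <= D |X|^2\<close>. For integers not both 0,
  \<open>(1 + m^2) (1 + n^2) <= 4 (m^2 + n^2)^2\<close>, and the fourth root gives the claim. At the
  origin the left side is \<open>1 / 0 = 0\<close>.\<close>

lemma lattice_inverse_bound:
  assumes "Im z > 0"
  obtains C where "C > 0"
    "\<And>m n. norm (1 / (of_int m * z + of_int n)) \<le> C * (lattice_weight m * lattice_weight n)"
proof -
  define D where "D = (1 / Im z)\<^sup>2 + (1 + norm z / Im z)\<^sup>2"
  have D: "D > 0" unfolding D_def using assms by (intro add_pos_nonneg) auto
  have "norm (1 / (of_int m * z + of_int n)) \<le> sqrt (2 * D) * (lattice_weight m * lattice_weight n)" for m n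
  proof (cases "of_int m * z + of_int n = 0")
    case True
    thus ?thesis unfolding True using D less_imp_le[OF lattice_weight_pos] by (auto intro!: mult_nonneg_nonneg)
  next
    case False
    define X where "X = of_int m * z + of_int n"
    define a b where "a = \<bar>real_of_int m\<bar>" and "b = \<bar>real_of_int n\<bar>"
    have X: "norm X > 0" using False by (simp add: X_def)
    have nz: "m \<noteq> 0 \<or> n \<noteq> 0" using False by auto
    have "a * Im z = \<bar>Im X\<bar>" using assms by (simp add: a_def X_def abs_mult)
    also have "\<dots> \<le> norm X" by (rule abs_Im_le_cmod)
    finally have a: "a \<le> 1 / Im z * norm X" using assms by (simp add: field_simps)
    have "b = norm (X - of_int m * z)" by (simp add: X_def b_def)
    also have "\<dots> \<le> norm X + norm (of_int m * z)" by (rule norm_triangle_ineq4)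
    also have "norm (of_int m * z) = a * norm z" by (simp add: norm_mult a_def)
    also have "\<dots> \<le> 1 / Im z * norm X * norm z" by (intro mult_right_mono a) auto
    finally have b: "b \<le> (1 + norm z / Im z) * norm X" by (simp add: algebra_simps)
    have "a\<^sup>2 + b\<^sup>2 \<le> (1 / Im z * norm X)\<^sup>2 + ((1 + norm z / Im z) * norm X)\<^sup>2"
      using a b by (intro add_mono power_mono) (auto simp: a_def b_def)
    also have "\<dots> = D * (norm X)\<^sup>2" 
      unfolding D_def power_mult_distrib by (simp only: distrib_right)
    finally have s: "a\<^sup>2 + b\<^sup>2 \<le> D * (norm X)\<^sup>2" .
    have "1 \<le> m\<^sup>2 + n\<^sup>2"
      using nz zero_less_power2[of m] zero_less_power2[of n] zero_le_power2[of m] zero_le_power2[of n] by linarith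
    hence "real_of_int 1 \<le> real_of_int (m\<^sup>2 + n\<^sup>2)" by (simp only: of_int_le_iff)
    hence one: "1 \<le> a\<^sup>2 + b\<^sup>2" by (simp add: a_def b_def)
    have 2: "1 + p \<le> 2 * (p + q)" if "1 \<le> p + q" "0 \<le> p" "0 \<le> q" for p q :: real
      using that by simp
    have "1 + a\<^sup>2 \<le> 2 * (a\<^sup>2 + b\<^sup>2) \<and> 1 + b\<^sup>2 \<le> 2 * (a\<^sup>2 + b\<^sup>2)"
      using 2[OF one] 2[of "b\<^sup>2" "a\<^sup>2"] one by (simp add: add.commute)
    hence "(1 + a\<^sup>2) * (1 + b\<^sup>2) \<le> (2 * (a\<^sup>2 + b\<^sup>2)) * (2 * (a\<^sup>2 + b\<^sup>2))"
      by (intro mult_mono) auto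
    also have "\<dots> \<le> (2 * (D * (norm X)\<^sup>2)) * (2 * (D * (norm X)\<^sup>2))"
      using s one by (intro mult_mono) auto
    finally have "sqrt ((1 + a\<^sup>2) * (1 + b\<^sup>2)) \<le> 2 * (D * (norm X)\<^sup>2)"
      using D by (intro real_le_lsqrt) (auto simp: power2_eq_square)
    hence "sqrt (sqrt ((1 + a\<^sup>2) * (1 + b\<^sup>2))) \<le> sqrt (2 * D * (norm X)\<^sup>2)"
      by (intro real_sqrt_le_mono) (simp add: mult_ac)
    also have "\<dots> = sqrt (2 * D) * norm X" by (simp add: real_sqrt_mult)
    finally have le: "sqrt (sqrt (1 + a\<^sup>2)) * sqrt (sqrt (1 + b\<^sup>2)) \<le> sqrt (2 * D) * norm X"
      by (simp add: real_sqrt_mult)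
    have "lattice_weight m * lattice_weight n = 1 / (sqrt (sqrt (1 + a\<^sup>2)) * sqrt (sqrt (1 + b\<^sup>2)))"
      by (simp add: lattice_weight_def a_def b_def)
    moreover have "sqrt (sqrt (1 + a\<^sup>2)) * sqrt (sqrt (1 + b\<^sup>2)) > 0"
      by (intro mult_pos_pos real_sqrt_gt_zero add_pos_nonneg) auto
    ultimately have "1 \<le> sqrt (2 * D) * (lattice_weight m * lattice_weight n) * norm X"
      using le by (simp add: field_simps)
    thus ?thesis using X unfolding X_def[symmetric] norm_divide by (simp add: field_simps)
  qed
  moreover have "sqrt (2 * D) > 0" using D by simp
  ultimately show ?thesis using that by blast
qed

lemma Im_minus_inverse: "Im (- 1 / z) = Im z / (norm z)\<^sup>2"
  by (simp add: Im_divide cmod_power2)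

text \<open>Division by \<open>z\<close> turns \<open>m z + n\<close> into
  \<open>m - n (-1 / z)\<close>, so a column for \<open>z\<close> is a row for \<open>-1 / z\<close>
  after \<open>m\<close> is reflected.\<close>

lemma lattice_column_has_sum:
  assumes "Im z > 0" "l > 0"
  shows "((\<lambda>m::int. 1 / (of_int m * z + of_int n) ^ (2 * l)) has_sum (lattice_row l (- 1 / z) n / z ^ (2 * l))) UNIV"
proof -
  have z: "z \<noteq> 0" using assms by auto
  hence im: "Im (- 1 / z) > 0" unfolding Im_minus_inverse using assms by simp
  have "((\<lambda>m::int. 1 / (of_int n * (- 1 / z) + of_int m) ^ (2 * l) / z ^ (2 * l)) has_sum
      (lattice_row l (- 1 / z) n / z ^ (2 * l))) UNIV"
    by (intro has_sum_divide_const lattice_row_has_sum im assms)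
  also have "?this \<longleftrightarrow> ?thesis"
  proof (rule has_sum_reindex_bij_witness[of _ uminus uminus])
    fix m :: int
    have "(of_int n * (- 1 / z) + of_int m) * z = - (of_int (- m) * z + of_int n)"
      using z by (simp add: field_simps)
    hence "((of_int n * (- 1 / z) + of_int m) * z) ^ (2 * l) = (of_int (- m) * z + of_int n) ^ (2 * l)"
      by (simp only:) (simp only: power_mult power2_minus)
    thus "1 / (of_int (- m) * z + of_int n) ^ (2 * l) = 1 / (of_int n * (- 1 / z) + of_int m) ^ (2 * l) / z ^ (2 * l)"
      by (simp only: power_mult_distrib divide_divide_eq_left)
  qed auto
  finally show ?thesis .
qed

text \<open>For \<open>l >= 2\<close> the double series converges absolutely, so summation by rows
  and by columns agree.\<close>

theorem eis_inversion:
  assumes "Im z > 0" "l \<ge> 2"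
  shows "qser (eis_fps l) (- 1 / z) = z ^ (2 * l) * qser (eis_fps l) z"
proof -
  have l: "l > 0" using assms by simp
  have z: "z \<noteq> 0" using assms by auto
  hence im: "Im (- 1 / z) > 0" unfolding Im_minus_inverse using assms by simp
  define T where "T = (\<lambda>(m::int, n::int). 1 / (of_int m * z + of_int n) ^ (2 * l))"
  obtain C where C: "C > 0"
    "\<And>m n. norm (1 / (of_int m * z + of_int n)) \<le> C * (lattice_weight m * lattice_weight n)"
    using lattice_inverse_bound[OF assms(1)] by blast
  have "T summable_on UNIV"
  proof (rule lattice_summable)
    fix m n
    have "norm (T (m, n)) = norm (1 / (of_int m * z + of_int n)) ^ (2 * l)"
      by (simp add: T_def norm_divide norm_power power_one_over)
    also have "\<dots> \<le> (C * (lattice_weight m * lattice_weight n)) ^ (2 * l)"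
      by (intro power_mono C) auto
    also have "\<dots> = C ^ (2 * l) * (lattice_weight m * lattice_weight n) ^ (2 * l)"
      by (rule power_mult_distrib)
    \<comment> \<open>The weights are at most 1 and \<open>2 * l >= 3\<close>.\<close>
    also have "\<dots> \<le> C ^ (2 * l) * (lattice_weight m * lattice_weight n) ^ 3"
      using C(1) assms(2) lattice_weight_pos[of m] lattice_weight_pos[of n] lattice_weight_le_1[of m] lattice_weight_le_1[of n]
      by (intro mult_left_mono power_decreasing mult_le_one) auto
    finally show "norm (T (m, n)) \<le> C ^ (2 * l) * (lattice_weight m ^ 3 * lattice_weight n ^ 3)"
      by (simp only: power_mult_distrib)
  qed
  then obtain S where S: "(T has_sum S) (UNIV \<times> UNIV)" by (auto simp: summable_on_def)
  have "(lattice_row l z has_sum S) UNIV"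
    by (rule has_sum_SigmaD[OF S]) (use lattice_row_has_sum[OF assms(1) l] in \<open>simp add: T_def\<close>)
  hence 1: "S = 2 * Lipschitz_const l * qser (eis_fps l) z"
    using lattice_rows_has_sum[OF assms(1) l] has_sum_unique by blast
  have S': "((\<lambda>(n, m). T (m, n)) has_sum S) (UNIV \<times> UNIV)"
    using S by (subst (asm) has_sum_swap)
  have "((\<lambda>n. lattice_row l (- 1 / z) n / z ^ (2 * l)) has_sum S) UNIV"
    by (rule has_sum_SigmaD[OF S']) (use lattice_column_has_sum[OF assms(1) l] in \<open>simp add: T_def\<close>)
  moreover have "((\<lambda>n. lattice_row l (- 1 / z) n / z ^ (2 * l)) has_sum
      (2 * Lipschitz_const l * qser (eis_fps l) (- 1 / z) / z ^ (2 * l))) UNIV"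
    by (intro has_sum_divide_const lattice_rows_has_sum im l)
  ultimately have "S = 2 * Lipschitz_const l * qser (eis_fps l) (- 1 / z) / z ^ (2 * l)"
    using has_sum_unique by blast
  hence "2 * Lipschitz_const l * qser (eis_fps l) (- 1 / z) = S * z ^ (2 * l)"
    using z by (simp only: nonzero_divide_eq_eq[of "z ^ (2 * l)"] power_not_zero) simp
  also have "\<dots> = 2 * Lipschitz_const l * (z ^ (2 * l) * qser (eis_fps l) z)"
    unfolding 1 by (simp only: mult_ac)
  finally show ?thesis by (simp add: Lipschitz_const_def)
qed

section \<open>Weight 2: exchanging a conditionally convergent double sum\<close>

text \<open>The interval is half open so that telescoping over it leaves the values at the opposite
  points \<open>- M\<close> and \<open>M\<close>.\<close>

lemma has_sum_int_LIMSEQ: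
  fixes f :: "int \<Rightarrow> 'a::real_normed_vector"
  assumes "(f has_sum S) UNIV"
  shows "(\<lambda>M. \<Sum>n = - int M..<int M. f n) \<longlonglongrightarrow> S"
proof -
  have "filterlim (\<lambda>M. {- int M..<int M}) (finite_subsets_at_top UNIV) sequentially"
    unfolding filterlim_def le_filter_def eventually_filtermap eventually_finite_subsets_at_top
  proof safe
    fix P :: "int set \<Rightarrow> bool" and X :: "int set"
    assume X: "finite X" "\<forall>Y. finite Y \<and> X \<subseteq> Y \<and> Y \<subseteq> UNIV \<longrightarrow> P Y"
    define B where "B = (\<Sum>x\<in>X. nat \<bar>x\<bar>) + 1"
    have B: "nat \<bar>x\<bar> < B" if "x \<in> X" for x
      using member_le_sum[OF that, of "\<lambda>x. nat \<bar>x\<bar>"] X(1) by (simp add: B_def)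
    have "P {- int M..<int M}" if "M \<ge> B" for M
    proof -
      have "X \<subseteq> {- int M..<int M}"
      proof
        fix x assume "x \<in> X"
        from B[OF this] that show "x \<in> {- int M..<int M}" by auto
      qed
      with X(2) show ?thesis by simp
    qed
    thus "\<forall>\<^sub>F M in sequentially. P {- int M..<int M}"
      unfolding eventually_sequentially by blast
  qed
  with assms show ?thesis unfolding has_sum_def by (rule filterlim_compose)
qed

lemma has_sum_diff:
  fixes f g :: "'a \<Rightarrow> 'b::real_normed_vector"
  assumes "(f has_sum a) A" "(g has_sum b) A"
  shows "((\<lambda>x. f x - g x) has_sum (a - b)) A"
  using has_sum_add[OF assms(1), of "\<lambda>x. - g x" "- b"] assms(2) by (simp add: has_sum_uminus)

lemma has_sum_sum:
  fixes f :: "'i \<Rightarrow> 'a \<Rightarrow> 'b::real_normed_vector"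
  assumes "\<And>i. i \<in> I \<Longrightarrow> (f i has_sum a i) A"
  shows "((\<lambda>x. \<Sum>i\<in>I. f i x) has_sum (\<Sum>i\<in>I. a i)) A"
  using assms by (induction I rule: infinite_finite_induct) (auto intro: has_sum_add)

lemma sum_int_telescope:
  fixes f :: "int \<Rightarrow> 'a::ab_group_add"
  shows "(\<Sum>n = - int M..<int M. f n - f (n + 1)) = f (- int M) - f (int M)"
proof (induction M)
  case (Suc M)
  have "{- int (Suc M)..<int (Suc M)} = insert (- int (Suc M)) (insert (int M) {- int M..<int M})" by auto
  thus ?case using Suc by (simp add: algebra_simps)
qed simp

text \<open>Subtract the series of \<open>Digamma (1 - z)\<close> from that of
  \<open>Digamma (1 + z)\<close>, then use \<open>Digamma (1 + z) = Digamma z + 1 / z\<close> and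
  the reflection formula.\<close>

lemma cot_partial_fractions:
  fixes z :: complex
  assumes "z \<notin> \<int>"
  shows "(\<lambda>k. 1 / (of_nat (Suc k) - z) - 1 / (of_nat (Suc k) + z)) sums (1 / z - of_real pi * cot (of_real pi * z))"
proof -
  have nz: "z \<noteq> 0" "1 + z \<noteq> 0" "1 - z \<noteq> 0"
    using assms by (auto simp: add_eq_0_iff)
  have s: "(\<lambda>n. inverse (of_nat (Suc n)) - inverse (w + of_nat n)) sums (Digamma w + euler_mascheroni)"
    if "w \<noteq> 0" for w :: complex
    using summable_Digamma[OF that] by (simp add: Digamma_def summable_sums)
  have "(\<lambda>n. (inverse (of_nat (Suc n)) - inverse (1 + z + of_nat n)) - (inverse (of_nat (Suc n)) - inverse (1 - z + of_nat n)))
      sums ((Digamma (1 + z) + euler_mascheroni) - (Digamma (1 - z) + euler_mascheroni))"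
    by (intro sums_diff s nz)
  also have "(\<lambda>n. (inverse (of_nat (Suc n)) - inverse (1 + z + of_nat n)) - (inverse (of_nat (Suc n)) - inverse (1 - z + of_nat n)))
     = (\<lambda>k. 1 / (of_nat (Suc k) - z) - 1 / (of_nat (Suc k) + z))"
    by (simp add: inverse_eq_divide algebra_simps)
  also have "(Digamma (1 + z) + euler_mascheroni) - (Digamma (1 - z) + euler_mascheroni)
      = 1 / z - of_real pi * cot (of_real pi * z)"
    using Digamma_reflection[OF assms] Digamma_plus1[OF nz(1)] by (simp add: add.commute algebra_simps)
  finally show ?thesis .
qed

text \<open>The cotangent is odd, and at \<open>M w\<close> in the upper half plane it differs from
  its limit only through \<open>q^M\<close>, which tends to 0.\<close>

lemma cot_limit_lower:
  assumes "Im w > 0"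
  shows "(\<lambda>M. of_real pi * cot (of_real pi * (of_nat M * (- w)))) \<longlonglongrightarrow> \<i> * of_real pi"
proof -
  have "(\<lambda>M. nome w ^ M) \<longlonglongrightarrow> 0"
    by (rule LIMSEQ_power_zero[OF norm_nome_less_1[OF assms]])
  from tendsto_add[OF tendsto_const tendsto_mult[OF tendsto_const tendsto_divide[OF this tendsto_diff[OF tendsto_const this]]]]
  have "(\<lambda>M. \<i> * pi + 2 * of_real pi * \<i> * (nome w ^ M / (1 - nome w ^ M))) \<longlonglongrightarrow> \<i> * pi + 2 * of_real pi * \<i> * (0 / (1 - 0))"
    by simp
  hence "(\<lambda>M. \<i> * pi + 2 * of_real pi * \<i> * (nome w ^ M / (1 - nome w ^ M))) \<longlonglongrightarrow> \<i> * of_real pi"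
    by simp
  moreover have "\<forall>\<^sub>F M in sequentially. \<i> * pi + 2 * of_real pi * \<i> * (nome w ^ M / (1 - nome w ^ M))
      = of_real pi * cot (of_real pi * (of_nat M * (- w)))"
    using eventually_gt_at_top[of 0]
  proof eventually_elim
    case (elim M)
    have "cot (of_real pi * (of_nat M * (- w))) = - cot (of_real pi * (of_nat M * w))"
      by (simp add: cot_def)
    moreover have "Im (of_nat M * w) > 0" using elim assms by simp
    from cot_nome[OF this] have "of_real pi * cot (of_real pi * (of_nat M * w)) =
       - \<i> * pi - 2 * of_real pi * \<i> * (nome w ^ M / (1 - nome w ^ M))"
      unfolding nome_mult_of_nat .
    ultimately show ?case by simp
  qed
  ultimately show ?thesis by (rule Lim_transform_eventually)
qed

text \<open>
  In weight 2 the double sum converges only conditionally. Eisenstein's trick subtracts the telescoping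
  terms \<open>1 / (x (x + 1))\<close>, \<open>x = m z + n\<close>, which vanish when summed over \<open>n\<close> first; summed over \<open>m\<close> first
  they leave a cotangent, whose limit is the correction term.
\<close>

theorem eis_inversion_weight_2:
  assumes z: "Im z > 0"
  shows "qser (eis_fps 1) (- 1 / z) = z ^ 2 * qser (eis_fps 1) z + \<i> / (4 * of_real pi) * z"
proof -
  have nz: "z \<noteq> 0" using z by auto
  hence im: "Im (- 1 / z) > 0" unfolding Im_minus_inverse using z by simp
  define x where "x = (\<lambda>m n. of_int m * z + of_int n :: complex)"
  have x_nz: "x m n \<noteq> 0" if "m \<noteq> 0" for m n
  proof
    assume "x m n = 0"
    hence "Im (x m n) = 0" by simp
    thus False using that z by (simp add: x_def)
  qed
  have x_Suc: "x m (n + 1) = x m n + 1" for m n by (simp add: x_def)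
  \<comment> \<open>\<open>B\<close> is the telescoping term \<open>1 / (x (x + 1))\<close> and
    \<open>D\<close> is \<open>1 / x^2 - B\<close>, of cubic decay and hence absolutely summable.
    Row \<open>m = 0\<close>, where \<open>x\<close> can vanish, is set to 0 and restored
    later.\<close>
  define D where "D = (\<lambda>(m, n). if m = 0 then 0 else 1 / (x m n ^ 2 * x m (n + 1)))"
  define B where "B = (\<lambda>m n. 1 / x m n - 1 / x m (n + 1))"
  have AB: "B m n = 1 / x m n ^ 2 - D (m, n)" if "m \<noteq> 0" for m n
  proof -
    have "x m n \<noteq> 0" "x m n + 1 \<noteq> 0" using x_nz[OF that, of n] x_nz[OF that, of "n + 1"] by (auto simp: x_Suc)
    thus ?thesis using that unfolding B_def D_def x_Suc prod.case
      by (simp add: divide_simps) (simp add: power2_eq_square algebra_simps)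
  qed
  have B_telescope: "(\<Sum>n = - int M..<int M. B m n) = 1 / x m (- int M) - 1 / x m (int M)" for m M
    unfolding B_def by (rule sum_int_telescope)
  obtain C where C: "C > 0"
    "\<And>m n. norm (1 / x m n) \<le> C * (lattice_weight m * lattice_weight n)"
    using lattice_inverse_bound[OF z] unfolding x_def by blast
  have "D summable_on UNIV"
  proof (rule lattice_summable)
    fix m n
    have "norm (D (m, n)) \<le> norm (1 / x m n) * norm (1 / x m n) * norm (1 / x m (n + 1))"
      by (simp add: D_def norm_divide norm_mult power2_eq_square)
    also have "\<dots> \<le> (C * (lattice_weight m * lattice_weight n)) * (C * (lattice_weight m * lattice_weight n)) *
         (C * (lattice_weight m * (2 * lattice_weight n)))"
    proof (intro mult_mono C(2) order_trans[OF C(2)] order_refl lattice_weight_Suc)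
    qed (use C(1) lattice_weight_pos in \<open>auto simp: less_imp_le intro!: mult_nonneg_nonneg\<close>)
    finally show "norm (D (m, n)) \<le> 2 * C ^ 3 * (lattice_weight m ^ 3 * lattice_weight n ^ 3)"
      by (simp add: power3_eq_cube mult_ac)
  qed
  then obtain S where S: "(D has_sum S) (UNIV \<times> UNIV)" by (auto simp: summable_on_def)
  hence S': "((\<lambda>(n, m). D (m, n)) has_sum S) (UNIV \<times> UNIV)" by (subst (asm) has_sum_swap)
  have D_rows: "(\<lambda>n. D (m, n)) summable_on UNIV" for m
    using summable_on_SigmaD1[of "\<lambda>m n. D (m, n)" UNIV "\<lambda>_. UNIV" m] has_sum_imp_summable[OF S] by (simp add: cond_case_prod_eta)
  have D_cols: "(\<lambda>m. D (m, n)) summable_on UNIV" for n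
    using summable_on_SigmaD1[of "\<lambda>n m. D (m, n)" UNIV "\<lambda>_. UNIV" n] has_sum_imp_summable[OF S'] by simp
  define R where "R = lattice_row 1 z"
  define I where "I = 2 * Lipschitz_const 1 * qser (eis_fps 1) z"
  define I' where "I' = 2 * Lipschitz_const 1 * qser (eis_fps 1) (- 1 / z)"
  have R: "((\<lambda>n. 1 / x m n ^ 2) has_sum R m) UNIV" for m
    using lattice_row_has_sum[OF z, of 1 m] by (simp add: R_def x_def)
  have R_sum: "(R has_sum I) UNIV"
    using lattice_rows_has_sum[OF z, of 1] by (simp add: R_def I_def)

  \<comment> \<open>Along a row with \<open>m \<noteq> 0\<close> the telescoping terms add up to 0,
    so \<open>D\<close> has the same row sums as \<open>1 / x^2\<close>.\<close>
  have "((\<lambda>n. D (m, n)) has_sum (if m = 0 then 0 else R m)) UNIV" for m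
  proof (cases "m = 0")
    case False
    from D_rows[of m] obtain d where d: "((\<lambda>n. D (m, n)) has_sum d) UNIV" by (auto simp: summable_on_def)
    from has_sum_diff[OF R[of m] d] have "(B m has_sum (R m - d)) UNIV"
      by (simp only: AB[OF False, symmetric])
    from has_sum_int_LIMSEQ[OF this] have "(\<lambda>M. 1 / x m (- int M) - 1 / x m (int M)) \<longlonglongrightarrow> R m - d"
      unfolding B_telescope .
    moreover have "(\<lambda>M. 1 / x m (- int M) - 1 / x m (int M)) \<longlonglongrightarrow> 0 - 0"
    proof (intro tendsto_diff tendsto_divide_0[OF tendsto_const])
      show "filterlim (\<lambda>M. x m (int M)) at_infinity sequentially"
        unfolding x_def of_int_of_nat_eq by (intro tendsto_add_filterlim_at_infinity[OF tendsto_const] tendsto_of_nat)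
      have "filterlim (\<lambda>M. - of_int m * z + of_nat M) at_infinity sequentially"
        by (intro tendsto_add_filterlim_at_infinity[OF tendsto_const] tendsto_of_nat)
      hence "filterlim (\<lambda>M. - (- of_int m * z + of_nat M)) at_infinity sequentially"
        unfolding filterlim_at_infinity_conv_norm_at_top norm_minus_cancel .
      thus "filterlim (\<lambda>M. x m (- int M)) at_infinity sequentially"
        by (simp add: x_def)
    qed
    ultimately have "R m - d = 0 - 0" by (rule LIMSEQ_unique)
    hence "d = R m" by simp
    with d False show ?thesis by simp
  qed (simp add: D_def)
  from has_sum_SigmaD[OF S this] have "((\<lambda>m. if m = 0 then 0 else R m) has_sum S) UNIV" by simp
  hence "(R has_sum S) (UNIV - {0})"
    by (rule has_sum_cong_neutral[THEN iffD1, rotated -1]) auto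
  hence "(R has_sum (R 0 + S)) (insert 0 (UNIV - {0}))" by (intro has_sum_insert) auto
  moreover have "insert 0 (UNIV - {0}) = (UNIV :: int set)" by auto
  ultimately have "(R has_sum (R 0 + S)) UNIV" by (simp only:)
  with R_sum have SI: "I = R 0 + S" by (rule has_sum_unique)

  define c where "c = (\<lambda>n. lattice_row 1 (- 1 / z) n / z ^ 2)"
  have col: "((\<lambda>m. 1 / x m n ^ 2) has_sum c n) UNIV" for n
    using lattice_column_has_sum[OF z, of 1 n] by (simp add: c_def x_def)
  have c_sum: "(c has_sum (I' / z ^ 2)) UNIV"
    unfolding c_def I'_def using lattice_rows_has_sum[OF im, of 1] by (intro has_sum_divide_const) simp
  define d where "d = (\<lambda>n. \<Sum>\<^sub>\<infinity>m. D (m, n))"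
  have d: "((\<lambda>m. D (m, n)) has_sum d n) UNIV" for n
    unfolding d_def using D_cols by simp
  have d_sum: "(d has_sum S) UNIV"
    using has_sum_SigmaD[OF S', of d] d by simp
  have B_col: "((\<lambda>m. B m n) has_sum (c n - d n - 1 / of_int n ^ 2)) (UNIV - {0})" for n
  proof -
    have "((\<lambda>m. 1 / x m n ^ 2 - D (m, n)) has_sum (c n - d n)) UNIV"
      by (rule has_sum_diff[OF col d])
    moreover have "((\<lambda>m. 1 / x m n ^ 2 - D (m, n)) has_sum (1 / of_int n ^ 2)) {0}"
      by (rule has_sum_finiteI) (auto simp: x_def D_def)
    ultimately have "((\<lambda>m. 1 / x m n ^ 2 - D (m, n)) has_sum (c n - d n - 1 / of_int n ^ 2)) (UNIV - {0})"
      by (rule has_sum_Diff) auto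
    thus ?thesis by (rule has_sum_cong[THEN iffD1, rotated]) (simp add: AB)
  qed
  \<comment> \<open>Summed over \<open>n\<close>, the column sums of the telescoping terms are
    exactly the defect \<open>I' / z^2 - I\<close> of invariance.\<close>
  have "((\<lambda>n. c n - d n - 1 / of_int n ^ 2) has_sum (I' / z ^ 2 - S - R 0)) UNIV"
    using R[of 0] by (intro has_sum_diff c_sum d_sum) (simp add: x_def)
  hence beta: "((\<lambda>n. c n - d n - 1 / of_int n ^ 2) has_sum (I' / z ^ 2 - I)) UNIV"
    by (simp only: SI diff_diff_eq add.commute)

  \<comment> \<open>For finitely many \<open>n\<close> the two summations commute: telescoping over
    \<open>n\<close> leaves the partial fractions of the cotangent at \<open>M / z\<close>.\<close>
  have partial: "(\<Sum>n = - int M..<int M. c n - d n - 1 / of_int n ^ 2)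
      = 2 / z * (1 / (of_nat M / z) - of_real pi * cot (of_real pi * (of_nat M / z)))" if "M > 0" for M
  proof -
    define Z where "Z = of_nat M / z"
    define W where "W = - 1 / z"
    have "Z = - (of_nat M * W)" by (simp add: Z_def W_def)
    hence "Im Z = - (real M * Im W)" by simp
    moreover have "Im W > 0" using im by (simp only: W_def)
    ultimately have "Im Z \<noteq> 0" using that by simp
    hence Z: "Z \<notin> \<int>" by (auto elim!: Ints_cases)
    define f where "f = (\<lambda>m::int. if m = 0 then 0 else 1 / z * (1 / (of_int m - Z) - 1 / (of_int m + Z)))"
    define s where "s = 1 / z * (1 / Z - of_real pi * cot (of_real pi * Z))"
    have f: "1 / x m (- int M) - 1 / x m (int M) = f m" if "m \<noteq> 0" for m
    proof -
      have "x m (- int M) = z * (of_int m - Z)" "x m (int M) = z * (of_int m + Z)"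
        using nz by (simp_all add: x_def Z_def algebra_simps)
      thus ?thesis using that by (simp add: f_def right_diff_distrib)
    qed
    have "((\<lambda>m. \<Sum>n = - int M..<int M. B m n) has_sum (\<Sum>n = - int M..<int M. c n - d n - 1 / of_int n ^ 2)) (UNIV - {0})"
      by (rule has_sum_sum) (use B_col in auto)
    hence "(f has_sum (\<Sum>n = - int M..<int M. c n - d n - 1 / of_int n ^ 2)) (UNIV - {0})"
      unfolding B_telescope by (rule has_sum_cong[THEN iffD1, rotated]) (use f in auto)
    hence f_sum: "(f has_sum (\<Sum>n = - int M..<int M. c n - d n - 1 / of_int n ^ 2)) UNIV"
      by (rule has_sum_cong_neutral[THEN iffD1, rotated -1]) (auto simp: f_def)
    then obtain t where t: "(f has_sum t) {1..}"
      using summable_on_subset[OF has_sum_imp_summable[OF f_sum], of "{1..}"] by (auto simp: summable_on_def)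
    have "((\<lambda>k. f (int (Suc k))) has_sum t) UNIV"
      using t by (subst has_sum_reindex_bij_witness[of UNIV "\<lambda>m. nat (m - 1)" "\<lambda>k. int (Suc k)" "{1..}" f]) auto
    from has_sum_imp_sums[OF this] have "(\<lambda>k. f (int (Suc k))) sums t" .
    moreover have "(\<lambda>k. f (int (Suc k))) = (\<lambda>k. 1 / z * (1 / (of_nat (Suc k) - Z) - 1 / (of_nat (Suc k) + Z)))"
      by (simp add: f_def)
    moreover have "(\<lambda>k. 1 / z * (1 / (of_nat (Suc k) - Z) - 1 / (of_nat (Suc k) + Z))) sums s"
      unfolding s_def by (intro sums_mult cot_partial_fractions Z)
    ultimately have "t = s" using sums_unique2 by metis
    have "1 / (- of_int m - Z) = - (1 / (of_int m + Z))" "1 / (- of_int m + Z) = - (1 / (of_int m - Z))" for m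
      by (simp_all add: divide_minus1 minus_divide_right)
    hence "f (- m) = f m" for m by (simp add: f_def)
    with t have "((\<lambda>m. f (- m)) has_sum t) {1..}" by simp
    from has_sum_int_split[OF t this] have "(f has_sum (2 * t)) UNIV" by (simp add: f_def)
    with f_sum have "(\<Sum>n = - int M..<int M. c n - d n - 1 / of_int n ^ 2) = 2 * t" by (rule has_sum_unique)
    thus ?thesis unfolding \<open>t = s\<close> s_def Z_def by simp
  qed
  have "(\<lambda>M. 2 / z * (1 / (of_nat M / z) - of_real pi * cot (of_real pi * (of_nat M / z)))) \<longlonglongrightarrow> I' / z ^ 2 - I"
    using has_sum_int_LIMSEQ[OF beta]
  proof (rule Lim_transform_eventually)
    show "\<forall>\<^sub>F M in sequentially. (\<Sum>n = - int M..<int M. c n - d n - 1 / of_int n ^ 2)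
      = 2 / z * (1 / (of_nat M / z) - of_real pi * cot (of_real pi * (of_nat M / z)))"
      using eventually_gt_at_top[of 0] by eventually_elim (rule partial)
  qed
  moreover have "(\<lambda>M. 2 / z * (1 / (of_nat M / z) - of_real pi * cot (of_real pi * (of_nat M / z)))) \<longlonglongrightarrow> 2 / z * (0 - \<i> * of_real pi)"
  proof (rule tendsto_mult[OF tendsto_const tendsto_diff])
    show "(\<lambda>M. 1 / (of_nat M / z)) \<longlonglongrightarrow> 0"
      using nz tendsto_mult_right_zero[OF lim_inverse_n, of z] by (simp add: field_simps)
    show "(\<lambda>M. of_real pi * cot (of_real pi * (of_nat M / z))) \<longlonglongrightarrow> \<i> * of_real pi"
      using cot_limit_lower[OF im] by simp
  qed
  ultimately have "I' / z ^ 2 - I = 2 / z * (0 - \<i> * of_real pi)" by (rule LIMSEQ_unique)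
  hence "I' / z ^ 2 = I + 2 / z * (0 - \<i> * of_real pi)" by (simp only: diff_eq_eq add.commute)
  hence "I' / z ^ 2 * z ^ 2 = (I + 2 / z * (0 - \<i> * of_real pi)) * z ^ 2" by (simp only:)
  hence "I' = z ^ 2 * I - 2 * \<i> * of_real pi * z"
    using nz by (simp add: left_diff_distrib) (simp add: power2_eq_square)
  \<comment> \<open>The correction is \<open>- 2 pi i z / (- 8 pi^2) = i z / (4 pi)\<close>.\<close>
  moreover have K: "2 * Lipschitz_const 1 = - 8 * of_real pi ^ 2"
    by (simp add: Lipschitz_const_def power_mult_distrib)
  ultimately have "- 8 * of_real pi ^ 2 * qser (eis_fps 1) (- 1 / z)
      = - 8 * of_real pi ^ 2 * (z ^ 2 * qser (eis_fps 1) z) - 2 * \<i> * of_real pi * z"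
    unfolding I_def I'_def K by (simp only: mult_ac)
  also have "\<dots> = - 8 * of_real pi ^ 2 * (z ^ 2 * qser (eis_fps 1) z + \<i> / (4 * of_real pi) * z)"
    by (simp add: distrib_left power2_eq_square)
  finally show ?thesis by (subst (asm) mult_left_cancel) simp_all
qed

subsection \<open>Special values and reduction to large imaginary part\<close>

text \<open>The derivative of \<open>p(cot (\<pi> z))\<close> is the step applied to \<open>p\<close>, evaluated at \<open>cot (\<pi> z)\<close>; at \<open>z = 1/2\<close> the cotangent vanishes.\<close>

definition cot_poly_step :: "complex poly \<Rightarrow> complex poly" where
  "cot_poly_step p = smult (- of_real pi) ([:1, 0, 1:] * pderiv p)"

lemma Polygamma_refl_cot_poly:
  assumes "z \<notin> \<int>"
  shows "Polygamma_refl n z = poly ((cot_poly_step ^^ n) [:0, of_real pi:]) (cot (of_real pi * z))"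
  using assms
proof (induction n arbitrary: z)
  case 0
  thus ?case using Digamma_reflection[of z] by (simp add: Polygamma_refl_def mult.commute)
next
  case (Suc n)
  let ?p = "(cot_poly_step ^^ n) [:0, of_real pi:]"
  have s: "sin (of_real pi * z) \<noteq> 0"
  proof
    assume "sin (of_real pi * z) = 0"
    then obtain n :: int where n: "of_real pi * z = of_real (of_int n * pi)"
      unfolding Complex_Transcendental.sin_eq_0 by blast
    hence "z = of_int n" by simp
    with Suc.prems show False by simp
  qed
  have quot: "(- s * p * s - c * (c * p)) / (s * s) = - p * (1 + (c / s) ^ 2)" if "s \<noteq> 0" for s c p :: complex
    using that by (simp add: field_simps power2_eq_square)
  have "((\<lambda>z. cos (of_real pi * z) / sin (of_real pi * z)) has_field_derivative
      (- sin (of_real pi * z) * of_real pi * sin (of_real pi * z) - cos (of_real pi * z) * (cos (of_real pi * z) * of_real pi)) /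
        (sin (of_real pi * z) * sin (of_real pi * z))) (at z)"
    using s by (auto intro!: derivative_eq_intros)
  also have "(- sin (of_real pi * z) * of_real pi * sin (of_real pi * z) - cos (of_real pi * z) * (cos (of_real pi * z) * of_real pi)) /
        (sin (of_real pi * z) * sin (of_real pi * z)) = - of_real pi * (1 + cot (of_real pi * z) ^ 2)"
    unfolding cot_def by (rule quot[OF s])
  finally have c: "((\<lambda>z. cot (of_real pi * z)) has_field_derivative - of_real pi * (1 + cot (of_real pi * z) ^ 2)) (at z)"
    by (simp add: cot_def)
  show ?case
  proof (rule Polygamma_refl_eqI[of "- \<int>"])
    show "open (- \<int> :: complex set)" using closed_Ints by (simp add: open_Compl)
    show "((\<lambda>z. poly ?p (cot (of_real pi * z))) has_field_derivative
      poly ((cot_poly_step ^^ Suc n) [:0, of_real pi:]) (cot (of_real pi * z))) (at z)"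
      by (rule DERIV_cong[OF DERIV_chain'[OF c poly_DERIV]])
         (simp add: cot_poly_step_def power2_eq_square algebra_simps)
  qed (use Suc in auto)
qed

text \<open>At \<open>1/2\<close> the points \<open>z\<close> and \<open>1 - z\<close> coincide, so
  for odd order the reflected function is \<open>- 2\<close> times the polygamma value. The series
  of that value runs over the odd integers and equals \<open>4^l (1 - 4^(-l)) zeta (2 l)\<close> up
  to the factorial.\<close>

lemma zeta_even_half:
  assumes "l > 0"
  shows "of_real ((4 ^ l - 1) * zeta_even l) =
    - poly ((cot_poly_step ^^ (2 * l - 1)) [:0, of_real pi:]) 0 / (2 * fact (2 * l - 1))"
proof -
  have odd: "odd (2 * l - 1)" "Suc (2 * l - 1) = 2 * l" "2 * l - 1 > 0" using assms by auto
  define h where "h = (\<lambda>n::nat. of_real (1 / real (Suc n) ^ (2 * l)) :: complex)"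
  have "((\<lambda>n. 1 / real (Suc n) ^ (2 * l)) has_sum zeta_even l) UNIV"
    using zeta_even_sums[OF assms] by (intro sums_nonneg_imp_has_sum) auto
  hence h: "(h has_sum of_real (zeta_even l)) UNIV" unfolding h_def by (rule has_sum_of_real)
  have "((\<lambda>n. h n / 4 ^ l) has_sum (of_real (zeta_even l) / 4 ^ l)) UNIV"
    by (rule has_sum_divide_const[OF h])
  \<comment> \<open>\<open>h n\<close> belongs to the integer \<open>n + 1\<close>, so odd indices
    are the even integers.\<close>
  also have "?this \<longleftrightarrow> (h has_sum (of_real (zeta_even l) / 4 ^ l)) {n. odd n}"
  proof (rule has_sum_reindex_bij_witness[of _ "\<lambda>n. n div 2" "\<lambda>n. 2 * n + 1"])
    fix n :: nat
    have "real (Suc (2 * n + 1)) = 2 * real (Suc n)" by simp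
    hence "real (Suc (2 * n + 1)) ^ (2 * l) = 4 ^ l * real (Suc n) ^ (2 * l)"
      by (simp only: power_mult_distrib) (simp add: power_mult)
    thus "h (2 * n + 1) = h n / 4 ^ l" unfolding h_def by (simp only:) (simp add: mult.commute)
  qed (auto elim!: oddE)
  finally have "(h has_sum (of_real (zeta_even l) - of_real (zeta_even l) / 4 ^ l)) (UNIV - {n. odd n})"
    by (intro has_sum_Diff h) auto
  also have "?this \<longleftrightarrow> ((\<lambda>n. h (2 * n)) has_sum (of_real (zeta_even l) - of_real (zeta_even l) / 4 ^ l)) UNIV"
    by (rule has_sum_reindex_bij_witness[of _ "\<lambda>n. 2 * n" "\<lambda>n. n div 2"]) auto
  finally have "((\<lambda>n. 4 ^ l * h (2 * n)) has_sum (4 ^ l * (of_real (zeta_even l) - of_real (zeta_even l) / 4 ^ l))) UNIV"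
    by (rule has_sum_cmult_right)
  moreover have "4 ^ l * h (2 * n) = inverse ((1 / 2 + of_nat n) ^ Suc (2 * l - 1))" for n
  proof -
    have "(1 / 2 + of_nat n) = (of_nat (Suc (2 * n)) / 2 :: complex)" by simp
    thus ?thesis unfolding odd(2) h_def
      by (simp only: power_divide) (simp add: power_mult)
  qed
  ultimately have "((\<lambda>n. inverse ((1 / 2 + of_nat n :: complex) ^ Suc (2 * l - 1))) has_sum
      (4 ^ l * (of_real (zeta_even l) - of_real (zeta_even l) / 4 ^ l))) UNIV"
    by (simp only:)
  moreover have "((\<lambda>n. inverse ((1 / 2 + of_nat n :: complex) ^ Suc (2 * l - 1))) has_sum
      ((-1) ^ Suc (2 * l - 1) * (Polygamma (2 * l - 1) (1 / 2) / fact (2 * l - 1)))) UNIV"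
    by (rule Polygamma_has_sum) (use odd in auto)
  ultimately have "4 ^ l * (of_real (zeta_even l) - of_real (zeta_even l) / 4 ^ l) =
      (-1) ^ Suc (2 * l - 1) * (Polygamma (2 * l - 1) (1 / 2 :: complex) / fact (2 * l - 1))"
    by (rule has_sum_unique)
  hence 1: "of_real ((4 ^ l - 1) * zeta_even l) = Polygamma (2 * l - 1) (1 / 2 :: complex) / fact (2 * l - 1)"
    using odd by (simp add: right_diff_distrib left_diff_distrib)
  have "(1 / 2 :: complex) \<notin> \<int>"
  proof
    assume "(1 / 2 :: complex) \<in> \<int>"
    then obtain k where "1 / 2 = (of_int k :: complex)" by (auto elim: Ints_cases)
    hence "of_int (k * 2) = (of_int 1 :: complex)" by simp
    hence "k * 2 = 1" by (simp only: of_int_eq_iff)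
    thus False by presburger
  qed
  from Polygamma_refl_cot_poly[OF this, of "2 * l - 1"]
  have P: "- 2 * Polygamma (2 * l - 1) (1 / 2 :: complex) = poly ((cot_poly_step ^^ (2 * l - 1)) [:0, of_real pi:]) 0"
    using odd(1) by (simp add: Polygamma_refl_def cot_def cos_of_real_pi_half)
  have "Polygamma (2 * l - 1) (1 / 2 :: complex) = - poly ((cot_poly_step ^^ (2 * l - 1)) [:0, of_real pi:]) 0 / 2"
    unfolding P[symmetric] by simp
  with 1 show ?thesis by (simp only: divide_divide_eq_left)
qed

text \<open>These closed forms match the constant terms of \<open>eis_fps\<close> with the
  normalisation of \<open>E_2\<close>, \<open>E_4\<close> and \<open>E_6\<close>.\<close>

lemma zeta_even_values:
  "zeta_even 1 = pi ^ 2 / 6" "zeta_even 2 = pi ^ 4 / 90" "zeta_even 3 = pi ^ 6 / 945"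
proof -
  show "zeta_even 1 = pi ^ 2 / 6"
  proof (rule sums_unique2[OF _ inverse_squares_sums])
    show "(\<lambda>n. 1 / real ((n + 1)\<^sup>2)) sums zeta_even 1"
      using zeta_even_sums[of 1] by (simp only: Suc_eq_plus1 of_nat_power mult_1_right zero_less_one simp_thms)
  qed
  have "of_real ((4 ^ 2 - 1) * zeta_even 2) = (of_real (pi ^ 4 / 6) :: complex)"
    by (subst zeta_even_half) (simp_all add: eval_nat_numeral cot_poly_step_def pderiv_pCons field_simps)
  thus "zeta_even 2 = pi ^ 4 / 90" by (simp only: of_real_eq_iff) simp
  have "of_real ((4 ^ 3 - 1) * zeta_even 3) = (of_real (pi ^ 6 / 15) :: complex)"
    by (subst zeta_even_half) (simp_all add: eval_nat_numeral cot_poly_step_def pderiv_pCons field_simps)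
  thus "zeta_even 3 = pi ^ 6 / 945" by (simp only: of_real_eq_iff) simp
qed

section \<open>The generators over the complex numbers\<close>

definition complex_fps :: "rat fps \<Rightarrow> complex fps" where
  "complex_fps f = Abs_fps (\<lambda>n. of_rat (fps_nth f n))"

lemma complex_fps_nth [simp]: "fps_nth (complex_fps f) n = of_rat (fps_nth f n)"
  by (simp add: complex_fps_def)

lemma complex_fps_const: "complex_fps (fps_const c) = fps_const (of_rat c)"
  by (simp add: fps_eq_iff)

lemma complex_fps_mult: "complex_fps (f * g) = complex_fps f * complex_fps g"
  by (simp add: fps_eq_iff fps_mult_nth of_rat_sum of_rat_mult)

lemma complex_fps_sum: "complex_fps (\<Sum>i\<in>I. f i) = (\<Sum>i\<in>I. complex_fps (f i))"
  by (simp add: fps_eq_iff fps_sum_nth of_rat_sum)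

lemma complex_fps_power: "complex_fps (f ^ n) = complex_fps f ^ n"
  by (induction n) (simp_all add: complex_fps_mult complex_fps_const flip: fps_const_1_eq_1)

lemma Lipschitz_const_values:
  "Lipschitz_const 1 = - 4 * of_real pi ^ 2" "Lipschitz_const 2 = of_real pi ^ 4 * 16 / 6"
  "Lipschitz_const 3 = - (of_real pi ^ 6 * 64 / 120)"
  by (simp_all add: Lipschitz_const_def power_mult_distrib fact_numeral numeral_eq_Suc)

lemma complex_fps_eisenstein:
  "complex_fps (eisenstein 2) = fps_const (- 24) * eis_fps 1"
  "complex_fps (eisenstein 4) = fps_const 240 * eis_fps 2"
  "complex_fps (eisenstein 6) = fps_const (- 504) * eis_fps 3"
proof -
  have 0: "fps_nth (eisenstein k) 0 = 1" for k by (simp add: eisenstein_def)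
  have d: "of_rat (of_nat n) = (of_nat n :: complex)" for n by simp
  show "complex_fps (eisenstein 2) = fps_const (- 24) * eis_fps 1"
  proof (rule fps_ext)
    fix n show "fps_nth (complex_fps (eisenstein 2)) n = fps_nth (fps_const (- 24) * eis_fps 1) n"
      using eisenstein_values(1)[of n] unfolding eis_fps_def zeta_even_values Lipschitz_const_values
      by (cases "n = 0") (simp_all add: 0 sigma_fps_def divisor_sigma_def of_rat_mult of_rat_minus del: of_nat_sum)
  qed
  show "complex_fps (eisenstein 4) = fps_const 240 * eis_fps 2"
  proof (rule fps_ext)
    fix n show "fps_nth (complex_fps (eisenstein 4)) n = fps_nth (fps_const 240 * eis_fps 2) n"
      using eisenstein_values(2)[of n] unfolding eis_fps_def zeta_even_values Lipschitz_const_values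
      by (cases "n = 0") (simp_all add: 0 sigma_fps_def divisor_sigma_def of_rat_mult of_rat_minus del: of_nat_sum)
  qed
  show "complex_fps (eisenstein 6) = fps_const (- 504) * eis_fps 3"
  proof (rule fps_ext)
    fix n show "fps_nth (complex_fps (eisenstein 6)) n = fps_nth (fps_const (- 504) * eis_fps 3) n"
      using eisenstein_values(3)[of n] unfolding eis_fps_def zeta_even_values Lipschitz_const_values
      by (cases "n = 0") (simp_all add: 0 sigma_fps_def divisor_sigma_def of_rat_mult of_rat_minus del: of_nat_sum)
  qed
qed

text \<open>
  The pair \<open>(c, d)\<close> is the bottom row of a matrix acting as \<open>\<phi>\<close>. Demanding the transformation laws as part
  of the definition avoids generators of the modular group: a pair is only ever built along the
  reduction of a point.
\<close>

definition modular_pair :: "int \<Rightarrow> int \<Rightarrow> bool" where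
  "modular_pair c d \<longleftrightarrow> (\<exists>\<phi>. \<forall>z. Im z > 0 \<longrightarrow>
     of_int c * z + of_int d \<noteq> 0 \<and>
     Im (\<phi> z) = Im z / (norm (of_int c * z + of_int d))\<^sup>2 \<and>
     (\<forall>l\<ge>1. qser (eis_fps l) z = qser (eis_fps l) (\<phi> z) / (of_int c * z + of_int d) ^ (2 * l) +
        (if l = 1 then - \<i> / (4 * of_real pi) * of_int c / (of_int c * z + of_int d) else 0)))"

lemma nome_periodic: "nome (z + of_int n) = nome z"
proof -
  have "nome (z + of_int n) = nome z * exp (of_real (2 * of_int n * pi) * \<i>)"
    unfolding nome_def by (subst exp_add[symmetric]) (simp add: algebra_simps)
  also have "exp (of_real (2 * of_int n * pi) * \<i>) = 1"
    using exp_integer_2pi[of "of_int n"] by (simp add: mult_ac)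
  finally show ?thesis by simp
qed

lemma qser_periodic: "qser f (z + of_int n) = qser f z"
  unfolding qser_def nome_periodic ..

lemma modular_pair_0_1: "modular_pair 0 1"
  unfolding modular_pair_def by (intro exI[of _ "\<lambda>z. z"]) auto

text \<open>The new action is \<open>z \<mapsto> \<phi> (-1 / (z + n))\<close>. Automorphy factors
  multiply, \<open>j = w * j1\<close>, and the additive term of weight 2 is compatible because
  \<open>w * j1 = w d - c\<close>, which gives \<open>c / j1 + w = w d / j1\<close>.\<close>

lemma modular_pair_step:
  assumes "modular_pair c d"
  shows "modular_pair d (n * d - c)"
proof -
  obtain \<phi> where \<phi>: "\<And>z. Im z > 0 \<Longrightarrow> of_int c * z + of_int d \<noteq> 0"
     "\<And>z. Im z > 0 \<Longrightarrow> Im (\<phi> z) = Im z / (norm (of_int c * z + of_int d))\<^sup>2"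
     "\<And>z l. Im z > 0 \<Longrightarrow> l \<ge> 1 \<Longrightarrow> qser (eis_fps l) z = qser (eis_fps l) (\<phi> z) / (of_int c * z + of_int d) ^ (2 * l) +
        (if l = 1 then - \<i> / (4 * of_real pi) * of_int c / (of_int c * z + of_int d) else 0)"
    using assms unfolding modular_pair_def by blast
  show ?thesis unfolding modular_pair_def
  proof (intro exI[of _ "\<lambda>z. \<phi> (- 1 / (z + of_int n))"] allI impI)
    fix z :: complex assume z: "Im z > 0"
    define w where "w = z + of_int n"
    define w1 where "w1 = - 1 / w"
    define j where "j = of_int d * z + of_int (n * d - c)"
    define j1 where "j1 = of_int c * w1 + of_int d"
    have w: "Im w > 0" "w \<noteq> 0" using z by (auto simp: w_def complex_eq_iff)
    have w1: "Im w1 > 0" "Im w1 = Im w / (norm w)\<^sup>2"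
      unfolding w1_def Im_minus_inverse using w by simp_all
    have j: "j = w * j1" using w(2) by (simp add: j_def j1_def w1_def w_def field_simps)
    have j1: "j1 \<noteq> 0" unfolding j1_def by (rule \<phi>(1)[OF w1(1)])
    have Im: "Im (\<phi> w1) = Im z / (norm j)\<^sup>2"
      unfolding \<phi>(2)[OF w1(1)] w1(2) j norm_mult power_mult_distrib j1_def[symmetric]
      by (simp add: w_def)
    have E: "qser (eis_fps l) z = qser (eis_fps l) (\<phi> w1) / j ^ (2 * l) +
        (if l = 1 then - \<i> / (4 * of_real pi) * of_int d / j else 0)" if l: "l \<ge> 1" for l
    proof (cases "l = 1")
      case True
      have "qser (eis_fps 1) w1 = w ^ 2 * qser (eis_fps 1) z + \<i> / (4 * of_real pi) * w"
        unfolding w1_def using eis_inversion_weight_2[OF w(1)] by (simp add: w_def qser_periodic)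
      moreover have "qser (eis_fps 1) w1 = qser (eis_fps 1) (\<phi> w1) / j1 ^ 2 - \<i> / (4 * of_real pi) * of_int c / j1"
        using \<phi>(3)[OF w1(1), of 1] by (simp add: j1_def)
      ultimately have "w ^ 2 * qser (eis_fps 1) z = qser (eis_fps 1) (\<phi> w1) / j1 ^ 2
          - \<i> / (4 * of_real pi) * (of_int c / j1 + w)"
        by (simp add: distrib_left) (simp only: algebra_simps)
      also have "of_int c / j1 + w = w * of_int d / j1"
        using j1 w(2) by (simp add: field_simps) (simp add: j1_def w1_def field_simps)
      finally have "qser (eis_fps 1) z = (qser (eis_fps 1) (\<phi> w1) / j1 ^ 2
          - \<i> / (4 * of_real pi) * (w * of_int d / j1)) / w ^ 2"
        using w(2) by (simp add: field_simps)
      thus ?thesis using True w(2) unfolding j by (simp add: diff_divide_distrib power_mult_distrib) (simp add: power2_eq_square mult_ac)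
    next
      case False
      have "qser (eis_fps l) w1 = w ^ (2 * l) * qser (eis_fps l) z"
        unfolding w1_def using eis_inversion[OF w(1), of l] False l by (simp add: w_def qser_periodic)
      hence "qser (eis_fps l) z = qser (eis_fps l) w1 / w ^ (2 * l)" using w(2) by simp
      also have "qser (eis_fps l) w1 = qser (eis_fps l) (\<phi> w1) / j1 ^ (2 * l)"
        using \<phi>(3)[OF w1(1) l] False by (simp add: j1_def)
      finally show ?thesis using False unfolding j by (simp add: power_mult_distrib mult.commute)
    qed
    show "of_int d * z + of_int (n * d - c) \<noteq> 0 \<and>
         Im (\<phi> (- 1 / (z + of_int n))) = Im z / (norm (of_int d * z + of_int (n * d - c)))\<^sup>2 \<and>
         (\<forall>l\<ge>1. qser (eis_fps l) z = qser (eis_fps l) (\<phi> (- 1 / (z + of_int n))) / (of_int d * z + of_int (n * d - c)) ^ (2 * l) +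
        (if l = 1 then - \<i> / (4 * of_real pi) * of_int d / (of_int d * z + of_int (n * d - c)) else 0))"
      unfolding w_def[symmetric] w1_def[symmetric] j_def[symmetric]
      using Im E j j1 w(2) by simp
  qed
qed

text \<open>After translation to \<open>|Re w| <= 1/2\<close>, a point with
  \<open>Im w < 1/2\<close> has \<open>|w|^2 <= 1/2\<close>, so inversion at least doubles the
  imaginary part. The number \<open>N\<close> of doublings that suffice is the induction
  variable.\<close>

lemma modular_pair_reach:
  assumes "Im z > 0"
  obtains c d where "modular_pair c d" "Im z / (norm (of_int c * z + of_int d))\<^sup>2 \<ge> 1 / 2"
proof -
  have "\<exists>c d. modular_pair c d \<and> Im z / (norm (of_int c * z + of_int d))\<^sup>2 \<ge> 1 / 2"
    if "Im z > 0" "Im z * 2 ^ N \<ge> 1 / 2" for N z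
    using that
  proof (induction N arbitrary: z)
    case 0
    thus ?case using modular_pair_0_1 by (intro exI[of _ 0] exI[of _ 1]) auto
  next
    case (Suc N)
    show ?case
    proof (cases "Im z \<ge> 1 / 2")
      case True
      thus ?thesis using modular_pair_0_1 by (intro exI[of _ 0] exI[of _ 1]) auto
    next
      case False
      define n where "n = - round (Re z)"
      define w where "w = z + of_int n"
      define w1 where "w1 = - 1 / w"
      have "\<bar>Re w\<bar> \<le> 1 / 2"
        using of_int_round_abs_le[of "Re z"] by (simp add: w_def n_def abs_minus_commute)
      hence re: "(Re w)\<^sup>2 \<le> (1 / 2)\<^sup>2" by (simp only: abs_le_square_iff[symmetric])
      have imw: "Im w = Im z" by (simp add: w_def)
      have "(Im w)\<^sup>2 \<le> (1 / 2)\<^sup>2" using False Suc.prems imw by (intro power_mono) auto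
      hence nw: "(norm w)\<^sup>2 \<le> 1 / 2" using re unfolding cmod_power2 by (simp add: power_divide)
      have w0: "w \<noteq> 0" using Suc.prems imw by auto
      hence pos: "(norm w)\<^sup>2 > 0" by simp
      have w1: "Im w1 = Im z / (norm w)\<^sup>2"
        unfolding w1_def Im_minus_inverse imw ..
      have "Im z * 2 \<le> Im w1" unfolding w1 using nw pos Suc.prems(1)
        by (simp add: field_simps mult_left_le)
      hence "Im z * 2 * 2 ^ N \<le> Im w1 * 2 ^ N" by (intro mult_right_mono) auto
      hence "Im w1 * 2 ^ N \<ge> 1 / 2" using Suc.prems(2) unfolding power_Suc by (simp only: mult.assoc)
      moreover have "Im w1 > 0" using w1 pos Suc.prems(1) by simp
      ultimately obtain c d where cd: "modular_pair c d" "Im w1 / (norm (of_int c * w1 + of_int d))\<^sup>2 \<ge> 1 / 2"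
        using Suc.IH by blast
      have "of_int d * z + of_int (n * d - c) = w * (of_int c * w1 + of_int d)"
        using w0 by (simp add: w1_def w_def field_simps)
      hence "Im z / (norm (of_int d * z + of_int (n * d - c)))\<^sup>2 = Im w1 / (norm (of_int c * w1 + of_int d))\<^sup>2"
        by (simp only: norm_mult power_mult_distrib w1 divide_divide_eq_left)
      with cd(2) modular_pair_step[OF cd(1), of n] show ?thesis by (metis (no_types))
    qed
  qed
  moreover obtain N where "1 / 2 / Im z < 2 ^ N" using real_arch_pow[of 2] by auto
  hence "Im z * 2 ^ N \<ge> 1 / 2" using assms by (simp add: field_simps)
  ultimately show ?thesis using assms that by blast
qed

subsection \<open>Growth at the cusps\<close>

text \<open>
  Here \<open>v\<close> is the imaginary part of the image of \<open>z\<close>. The error has to decay faster than every power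
  of \<open>v\<close>, since otherwise products of error terms with principal parts could not be controlled.
\<close>

definition cusp_growth :: "nat \<Rightarrow> complex poly \<Rightarrow> complex fps \<Rightarrow> bool" where
  "cusp_growth k Q f \<longleftrightarrow> fps_conv_radius f \<ge> 1 \<and>
     (\<forall>M. \<forall>v0>0. \<exists>C. \<forall>c d z. modular_pair c d \<longrightarrow> Im z > 0 \<longrightarrow>
        (let j = of_int c * z + of_int d; v = Im z / (norm j)\<^sup>2 in
          v \<ge> v0 \<longrightarrow> norm (qser f z - poly Q (of_int c * j) / j ^ (2 * k)) \<le> C / (Im z ^ k * v ^ M)))"

lemma cusp_growthD:
  assumes "cusp_growth k Q f" "v0 > 0"
  obtains C where "C \<ge> 0"
    "\<And>c d z j v. modular_pair c d \<Longrightarrow> Im z > 0 \<Longrightarrow> j = of_int c * z + of_int d \<Longrightarrow> v = Im z / (norm j)\<^sup>2 \<Longrightarrow>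
      v \<ge> v0 \<Longrightarrow> norm (qser f z - poly Q (of_int c * j) / j ^ (2 * k)) \<le> C / (Im z ^ k * v ^ M)"
proof -
  obtain C where C: "\<forall>c d z. modular_pair c d \<longrightarrow> Im z > 0 \<longrightarrow>
        (let j = of_int c * z + of_int d; v = Im z / (norm j)\<^sup>2 in
          v \<ge> v0 \<longrightarrow> norm (qser f z - poly Q (of_int c * j) / j ^ (2 * k)) \<le> C / (Im z ^ k * v ^ M))"
    using assms unfolding cusp_growth_def by blast
  show ?thesis
  proof (rule that[of "max C 0"])
    fix c d z j v
    assume a: "modular_pair c d" "Im z > 0" "j = of_int c * z + of_int d" "v = Im z / (norm j)\<^sup>2" "v \<ge> v0"
    have "norm (qser f z - poly Q (of_int c * j) / j ^ (2 * k)) \<le> C / (Im z ^ k * v ^ M)"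
      using C[rule_format, OF a(1,2)] a(3-5) by (simp add: Let_def)
    also have "\<dots> \<le> max C 0 / (Im z ^ k * v ^ M)"
      using a assms(2) by (intro divide_right_mono) auto
    finally show "norm (qser f z - poly Q (of_int c * j) / j ^ (2 * k)) \<le> max C 0 / (Im z ^ k * v ^ M)" .
  qed simp
qed

lemma cusp_growthI:
  assumes "fps_conv_radius f \<ge> 1"
    and "\<And>M v0. v0 > 0 \<Longrightarrow> \<exists>C. \<forall>c d z j v. modular_pair c d \<longrightarrow> Im z > 0 \<longrightarrow> j = of_int c * z + of_int d \<longrightarrow>
      v = Im z / (norm j)\<^sup>2 \<longrightarrow> v \<ge> v0 \<longrightarrow>
      norm (qser f z - poly Q (of_int c * j) / j ^ (2 * k)) \<le> C / (Im z ^ k * v ^ M)"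
  shows "cusp_growth k Q f"
  unfolding cusp_growth_def Let_def using assms by meson

lemma modular_pair_nonzero: "modular_pair c d \<Longrightarrow> Im z > 0 \<Longrightarrow> of_int c * z + of_int d \<noteq> 0"
  unfolding modular_pair_def by blast

lemma modular_pair_automorphy_le:
  fixes c d :: int
  assumes "Im z > 0" "j = of_int c * z + of_int d"
  shows "\<bar>real_of_int c\<bar> * Im z \<le> norm j"
proof -
  have "\<bar>real_of_int c\<bar> * Im z = \<bar>Im j\<bar>" using assms by (simp add: abs_mult)
  also have "\<dots> \<le> norm j" by (rule abs_Im_le_cmod)
  finally show ?thesis .
qed

text \<open>Keeps the argument of \<open>Q\<close> in the disc of radius \<open>1 / v0\<close>,
  where \<open>Q\<close> is bounded independently of the pair.\<close>

lemma modular_pair_cj_le: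
  fixes c d :: int
  assumes "Im z > 0" "j = of_int c * z + of_int d" "j \<noteq> 0" "v = Im z / (norm j)\<^sup>2"
  shows "norm (of_int c * j) \<le> 1 / v"
proof -
  have "norm (of_int c * j) * Im z = \<bar>real_of_int c\<bar> * Im z * norm j" by (simp add: norm_mult)
  also have "\<dots> \<le> norm j * norm j" by (intro mult_right_mono modular_pair_automorphy_le[OF assms(1,2)]) auto
  finally show ?thesis unfolding assms(4) using assms(1) by (simp add: field_simps power2_eq_square)
qed

lemma poly_bounded_on_cball:
  fixes Q :: "complex poly"
  obtains B where "B \<ge> 0" "\<And>w. norm w \<le> r \<Longrightarrow> norm (poly Q w) \<le> B"
proof -
  have "compact (poly Q ` cball 0 r)" by (intro compact_continuous_image continuous_intros) auto
  hence "bounded (poly Q ` cball 0 r)" by (rule compact_imp_bounded)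
  then obtain B where "\<forall>w\<in>cball 0 r. norm (poly Q w) \<le> B" unfolding bounded_iff by auto
  thus ?thesis by (intro that[of "max B 0"]) (auto intro: max.coboundedI1)
qed

lemma cusp_growth_add:
  assumes "cusp_growth k Q f" "cusp_growth k R g"
  shows "cusp_growth k (Q + R) (f + g)"
proof (rule cusp_growthI)
  have rad: "fps_conv_radius f \<ge> 1" "fps_conv_radius g \<ge> 1" using assms unfolding cusp_growth_def by auto
  thus "fps_conv_radius (f + g) \<ge> 1" using fps_conv_radius_add[of f g] by (meson min.boundedI order_trans)
  fix M and v0 :: real assume v0: "v0 > 0"
  obtain C where C: "\<And>c d z j v. modular_pair c d \<Longrightarrow> Im z > 0 \<Longrightarrow> j = of_int c * z + of_int d \<Longrightarrow> v = Im z / (norm j)\<^sup>2 \<Longrightarrow>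
      v \<ge> v0 \<Longrightarrow> norm (qser f z - poly Q (of_int c * j) / j ^ (2 * k)) \<le> C / (Im z ^ k * v ^ M)"
    using cusp_growthD[OF assms(1) v0] by metis
  obtain D where D: "\<And>c d z j v. modular_pair c d \<Longrightarrow> Im z > 0 \<Longrightarrow> j = of_int c * z + of_int d \<Longrightarrow> v = Im z / (norm j)\<^sup>2 \<Longrightarrow>
      v \<ge> v0 \<Longrightarrow> norm (qser g z - poly R (of_int c * j) / j ^ (2 * k)) \<le> D / (Im z ^ k * v ^ M)"
    using cusp_growthD[OF assms(2) v0] by metis
  show "\<exists>C. \<forall>c d z j v. modular_pair c d \<longrightarrow> Im z > 0 \<longrightarrow> j = of_int c * z + of_int d \<longrightarrow>
      v = Im z / (norm j)\<^sup>2 \<longrightarrow> v \<ge> v0 \<longrightarrow>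
      norm (qser (f + g) z - poly (Q + R) (of_int c * j) / j ^ (2 * k)) \<le> C / (Im z ^ k * v ^ M)"
  proof (intro exI[of _ "C + D"] allI impI)
    fix c d z j v
    assume a: "modular_pair c d" "Im z > 0" "j = of_int c * z + of_int d" "v = Im z / (norm j)\<^sup>2" "v0 \<le> v"
    have "qser (f + g) z = qser f z + qser g z"
      unfolding qser_def by (rule eval_fps_add) (use norm_nome_less_radius[OF _ a(2)] rad in auto)
    hence "norm (qser (f + g) z - poly (Q + R) (of_int c * j) / j ^ (2 * k)) =
       norm ((qser f z - poly Q (of_int c * j) / j ^ (2 * k)) + (qser g z - poly R (of_int c * j) / j ^ (2 * k)))"
      by (simp only: poly_add add_divide_distrib add_diff_add)
    also have "\<dots> \<le> C / (Im z ^ k * v ^ M) + D / (Im z ^ k * v ^ M)"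
      by (intro norm_triangle_mono C[OF a] D[OF a])
    finally show "norm (qser (f + g) z - poly (Q + R) (of_int c * j) / j ^ (2 * k)) \<le> (C + D) / (Im z ^ k * v ^ M)"
      by (simp add: add_divide_distrib)
  qed
qed

lemma cusp_growth_0: "cusp_growth k 0 0"
  by (rule cusp_growthI) (auto simp: qser_def intro!: exI[of _ 0])

lemma cusp_growth_1: "cusp_growth 0 1 1"
  by (rule cusp_growthI) (auto simp: qser_def intro!: exI[of _ 0])

lemma cusp_growth_sum:
  assumes "\<And>i. i \<in> I \<Longrightarrow> cusp_growth k (Q i) (f i)"
  shows "cusp_growth k (\<Sum>i\<in>I. Q i) (\<Sum>i\<in>I. f i)"
  using assms by (induction I rule: infinite_finite_induct) (auto intro: cusp_growth_add cusp_growth_0)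

text \<open>With principal parts \<open>P\<close>, \<open>S\<close> and errors \<open>e\<close>,
  \<open>e'\<close>, the new error is \<open>e S + P e' + e e'\<close>. Principal parts can be as
  large as \<open>(v / y)^k\<close>, which is why rapid decay of the errors in \<open>v\<close> is
  required.\<close>

lemma cusp_growth_mult:
  assumes "cusp_growth k Q f" "cusp_growth l R g"
  shows "cusp_growth (k + l) (Q * R) (f * g)"
proof (rule cusp_growthI)
  have rad: "fps_conv_radius f \<ge> 1" "fps_conv_radius g \<ge> 1" using assms unfolding cusp_growth_def by auto
  thus "fps_conv_radius (f * g) \<ge> 1" using fps_conv_radius_mult[of f g] by (meson min.boundedI order_trans)
  fix M and v0 :: real assume v0: "v0 > 0"
  \<comment> \<open>The exponents \<open>M + l\<close> here and \<open>M + k\<close> below absorb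
    the growth \<open>v^l\<close> and \<open>v^k\<close> of the other factor's principal
    part.\<close>
  obtain C where C: "C \<ge> 0" "\<And>c d z j v. modular_pair c d \<Longrightarrow> Im z > 0 \<Longrightarrow> j = of_int c * z + of_int d \<Longrightarrow> v = Im z / (norm j)\<^sup>2 \<Longrightarrow>
      v \<ge> v0 \<Longrightarrow> norm (qser f z - poly Q (of_int c * j) / j ^ (2 * k)) \<le> C / (Im z ^ k * v ^ (M + l))"
    using cusp_growthD[OF assms(1) v0] by metis
  obtain D where D: "D \<ge> 0" "\<And>c d z j v. modular_pair c d \<Longrightarrow> Im z > 0 \<Longrightarrow> j = of_int c * z + of_int d \<Longrightarrow> v = Im z / (norm j)\<^sup>2 \<Longrightarrow>
      v \<ge> v0 \<Longrightarrow> norm (qser g z - poly R (of_int c * j) / j ^ (2 * l)) \<le> D / (Im z ^ l * v ^ (M + k))"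
    using cusp_growthD[OF assms(2) v0] by metis
  obtain A where A: "A \<ge> 0" "\<And>w. norm w \<le> 1 / v0 \<Longrightarrow> norm (poly Q w) \<le> A" using poly_bounded_on_cball by blast
  obtain B where B: "B \<ge> 0" "\<And>w. norm w \<le> 1 / v0 \<Longrightarrow> norm (poly R w) \<le> B" using poly_bounded_on_cball by blast
  show "\<exists>C. \<forall>c d z j v. modular_pair c d \<longrightarrow> Im z > 0 \<longrightarrow> j = of_int c * z + of_int d \<longrightarrow>
      v = Im z / (norm j)\<^sup>2 \<longrightarrow> v \<ge> v0 \<longrightarrow>
      norm (qser (f * g) z - poly (Q * R) (of_int c * j) / j ^ (2 * (k + l))) \<le> C / (Im z ^ (k + l) * v ^ M)"
  proof (intro exI[of _ "C * B + A * D + C * D / v0 ^ (M + k + l)"] allI impI)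
    fix c d z j v
    assume a: "modular_pair c d" "Im z > 0" "j = of_int c * z + of_int d" "v = Im z / (norm j)\<^sup>2" "v0 \<le> v"
    have j0: "j \<noteq> 0" unfolding a(3) by (rule modular_pair_nonzero[OF a(1,2)])
    have v: "v > 0" using a v0 by linarith
    define y where "y = Im z"
    have y: "y > 0" using a by (simp add: y_def)
    have nj: "norm j ^ (2 * n) = y ^ n / v ^ n" for n
    proof -
      have "(norm j)\<^sup>2 = y / v" using j0 y unfolding a(4) y_def[symmetric] by (simp add: field_simps)
      thus ?thesis by (simp add: power_mult power_divide)
    qed
    have "norm (of_int c * j) \<le> 1 / v" by (rule modular_pair_cj_le[OF a(2,3) j0 a(4)])
    also have "\<dots> \<le> 1 / v0" using a(5) v0 by (simp add: field_simps)
    finally have w: "norm (of_int c * j) \<le> 1 / v0" .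
    define P S where "P = poly Q (of_int c * j) / j ^ (2 * k)" and "S = poly R (of_int c * j) / j ^ (2 * l)"
    define e e' where "e = qser f z - P" and "e' = qser g z - S"
    have P: "norm P \<le> A * v ^ k / y ^ k" unfolding P_def norm_divide norm_power nj
      using A(2)[OF w] v y by (simp add: field_simps mult_right_mono)
    have S: "norm S \<le> B * v ^ l / y ^ l" unfolding S_def norm_divide norm_power nj
      using B(2)[OF w] v y by (simp add: field_simps mult_right_mono)
    have e: "norm e \<le> C / (y ^ k * v ^ (M + l))" unfolding e_def P_def y_def by (rule C(2)[OF a])
    have e': "norm e' \<le> D / (y ^ l * v ^ (M + k))" unfolding e'_def S_def y_def by (rule D(2)[OF a])
    have "qser (f * g) z = qser f z * qser g z"
      unfolding qser_def by (rule eval_fps_mult) (use norm_nome_less_radius[OF _ a(2)] rad in auto)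
    hence "qser (f * g) z - poly (Q * R) (of_int c * j) / j ^ (2 * (k + l)) = (P + e) * (S + e') - P * S"
      by (simp add: e_def e'_def P_def S_def distrib_left power_add)
    also have "\<dots> = e * S + P * e' + e * e'" by (simp add: algebra_simps)
    also have "norm \<dots> \<le> norm e * norm S + norm P * norm e' + norm e * norm e'"
      by (intro order_trans[OF norm_triangle_ineq] add_mono) (auto simp: norm_mult)
    also have "\<dots> \<le> C / (y ^ k * v ^ (M + l)) * (B * v ^ l / y ^ l) + A * v ^ k / y ^ k * (D / (y ^ l * v ^ (M + k)))
       + C / (y ^ k * v ^ (M + l)) * (D / (y ^ l * v ^ (M + k)))"
      using A B C D v y by (intro add_mono mult_mono e e' P S) auto
    also have "\<dots> = (C * B + A * D + C * D / v ^ (M + k + l)) / (y ^ (k + l) * v ^ M)"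
      using v y by (simp add: power_add field_simps)
    also have "\<dots> \<le> (C * B + A * D + C * D / v0 ^ (M + k + l)) / (y ^ (k + l) * v ^ M)"
      using A B C D v y v0 a(5)
      by (intro divide_right_mono add_mono divide_left_mono power_mono mult_nonneg_nonneg) auto
    finally show "norm (qser (f * g) z - poly (Q * R) (of_int c * j) / j ^ (2 * (k + l)))
        \<le> (C * B + A * D + C * D / v0 ^ (M + k + l)) / (Im z ^ (k + l) * v ^ M)" unfolding y_def .
  qed
qed

lemma cusp_growth_power:
  assumes "cusp_growth k Q f"
  shows "cusp_growth (n * k) (Q ^ n) (f ^ n)"
  using assms by (induction n) (auto intro: cusp_growth_1 cusp_growth_mult)

lemma cusp_growth_const: "cusp_growth 0 [:c:] (fps_const c)"
  by (rule cusp_growthI) (auto simp: qser_def intro!: exI[of _ 0])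

lemma cusp_growth_cmult:
  assumes "cusp_growth k Q f"
  shows "cusp_growth k (smult c Q) (fps_const c * f)"
  using cusp_growth_mult[OF cusp_growth_const[of c] assms] by simp

text \<open>A Cauchy estimate on a disc of radius \<open>Im z / 2\<close>, on which \<open>v\<close> varies only by a bounded factor.\<close>

lemma cusp_growth_XD:
  assumes "cusp_growth k Q f"
  shows "cusp_growth (Suc k) (smult (1 / (2 * of_real pi * \<i>)) ([:0, 0, 1:] * pderiv Q - smult (of_nat (2 * k)) ([:0, 1:] * Q))) (fps_XD f)"
proof (rule cusp_growthI)
  let ?Q = "smult (1 / (2 * of_real pi * \<i>)) ([:0, 0, 1:] * pderiv Q - smult (of_nat (2 * k)) ([:0, 1:] * Q))"
  have rad: "fps_conv_radius f \<ge> 1" using assms unfolding cusp_growth_def by auto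
  thus "fps_conv_radius (fps_XD f) \<ge> 1" by (rule fps_conv_radius_XD)
  fix M and v0 :: real assume v0: "v0 > 0"
  \<comment> \<open>On the disc \<open>Im w >= y / 2\<close> and \<open>|J w| <= 3/2 |j|\<close>, so
    \<open>v\<close> shrinks at most by the factor \<open>2/9\<close>; \<open>1/9\<close> leaves
    room.\<close>
  hence "v0 / 9 > 0" by simp
  from cusp_growthD[OF assms this] obtain C where C: "C \<ge> 0" "\<And>c d z j v. modular_pair c d \<Longrightarrow> Im z > 0 \<Longrightarrow> j = of_int c * z + of_int d \<Longrightarrow> v = Im z / (norm j)\<^sup>2 \<Longrightarrow>
      v \<ge> v0 / 9 \<Longrightarrow> norm (qser f z - poly Q (of_int c * j) / j ^ (2 * k)) \<le> C / (Im z ^ k * v ^ M)"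
    by metis
  show "\<exists>C. \<forall>c d z j v. modular_pair c d \<longrightarrow> Im z > 0 \<longrightarrow> j = of_int c * z + of_int d \<longrightarrow>
      v = Im z / (norm j)\<^sup>2 \<longrightarrow> v \<ge> v0 \<longrightarrow>
      norm (qser (fps_XD f) z - poly ?Q (of_int c * j) / j ^ (2 * Suc k)) \<le> C / (Im z ^ Suc k * v ^ M)"
  proof (intro exI[of _ "C * 2 ^ k * 9 ^ M * 2"] allI impI)
    fix c d z j v
    assume a: "modular_pair c d" "Im z > 0" "j = of_int c * z + of_int d" "v = Im z / (norm j)\<^sup>2" "v0 \<le> v"
    define y where "y = Im z"
    have y: "y > 0" using a by (simp add: y_def)
    have j0: "j \<noteq> 0" unfolding a(3) by (rule modular_pair_nonzero[OF a(1,2)])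
    define J where "J = (\<lambda>w. of_int c * w + of_int d :: complex)"
    define H where "H = (\<lambda>w. qser f w - poly Q (of_int c * J w) / J w ^ (2 * k))"
    have Jz: "J z = j" by (simp add: J_def a(3))
    have im: "Im w \<ge> y / 2" if "w \<in> cball z (y / 2)" for w
    proof -
      have "\<bar>Im (z - w)\<bar> \<le> norm (z - w)" by (rule abs_Im_le_cmod)
      also have "\<dots> \<le> y / 2" using that by (simp add: dist_norm)
      finally have "Im z - Im w \<le> y / 2" unfolding minus_complex.sel by linarith
      thus ?thesis by (simp add: y_def)
    qed
    have im2: "Im w > 0" if "w \<in> cball z (y / 2)" for w using im[OF that] y by linarith
    have J0: "J w \<noteq> 0" if "Im w > 0" for w unfolding J_def by (rule modular_pair_nonzero[OF a(1) that])
    have JQ: "(J has_field_derivative of_int c) (at w)" for w unfolding J_def by (auto intro!: derivative_eq_intros)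
    have H_deriv: "(H has_field_derivative (2 * of_real pi * \<i> * qser (fps_XD f) w
         - ((of_int c ^ 2 * poly (pderiv Q) (of_int c * J w)) / J w ^ (2 * k)
          - of_nat (2 * k) * of_int c * poly Q (of_int c * J w) / J w ^ Suc (2 * k)))) (at w)" if "Im w > 0" for w
    proof -
      have 1: "((\<lambda>w. poly Q (of_int c * J w)) has_field_derivative poly (pderiv Q) (of_int c * J w) * (of_int c * of_int c)) (at w)"
        by (rule DERIV_chain'[OF DERIV_cmult[OF JQ] poly_DERIV])
      have 2: "((\<lambda>w. J w ^ (2 * k)) has_field_derivative of_nat (2 * k) * (of_int c * J w ^ (2 * k - 1))) (at w)"
        using DERIV_power[OF JQ[of w], of "2 * k"] by simp
      have 3: "of_nat (2 * k) * (of_int c * J w ^ (2 * k - 1)) / (J w ^ (2 * k) * J w ^ (2 * k)) = of_nat (2 * k) * of_int c / (J w ^ Suc (2 * k))"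
        using J0[OF that] by (cases k) (simp_all add: field_simps)
      have "((\<lambda>w. poly Q (of_int c * J w) / J w ^ (2 * k)) has_field_derivative
         (poly (pderiv Q) (of_int c * J w) * (of_int c * of_int c) * J w ^ (2 * k)
           - poly Q (of_int c * J w) * (of_nat (2 * k) * (of_int c * J w ^ (2 * k - 1)))) / (J w ^ (2 * k) * J w ^ (2 * k))) (at w)"
        by (rule DERIV_divide[OF 1 2]) (use J0[OF that] in auto)
      also have "(poly (pderiv Q) (of_int c * J w) * (of_int c * of_int c) * J w ^ (2 * k)
           - poly Q (of_int c * J w) * (of_nat (2 * k) * (of_int c * J w ^ (2 * k - 1)))) / (J w ^ (2 * k) * J w ^ (2 * k))
         = of_int c ^ 2 * poly (pderiv Q) (of_int c * J w) / J w ^ (2 * k)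
           - poly Q (of_int c * J w) * (of_nat (2 * k) * of_int c / J w ^ Suc (2 * k))"
        unfolding 3[symmetric] diff_divide_distrib using J0[OF that] by (simp add: power2_eq_square mult_ac)
      finally show ?thesis unfolding H_def
        by (rule DERIV_cong[OF DERIV_diff[OF qser_has_field_derivative[OF rad that]]]) (simp add: mult_ac)
    qed
    \<comment> \<open>Differentiating \<open>Q (c j) / j^(2 k)\<close> and writing
      \<open>c^2 = (c j)^2 / j^2\<close> and \<open>c / j = (c j) / j^2\<close> brings everything
      over \<open>j^(2 k + 2)\<close> as a polynomial in \<open>c j\<close>.\<close>
    have main: "2 * of_real pi * \<i> * (qser (fps_XD f) z - poly ?Q (of_int c * j) / j ^ (2 * Suc k)) = deriv H z"
    proof -
      have "deriv H z = 2 * of_real pi * \<i> * qser (fps_XD f) z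
         - ((of_int c ^ 2 * poly (pderiv Q) (of_int c * j)) / j ^ (2 * k)
          - of_nat (2 * k) * of_int c * poly Q (of_int c * j) / j ^ Suc (2 * k))"
        using DERIV_imp_deriv[OF H_deriv[OF a(2)]] by (simp only: Jz)
      moreover have "2 * of_real pi * \<i> * (poly ?Q (of_int c * j) / j ^ (2 * Suc k)) =
          ((of_int c * j) * (of_int c * j) * poly (pderiv Q) (of_int c * j)
            - of_nat (2 * k) * ((of_int c * j) * poly Q (of_int c * j))) / (j ^ (2 * k) * (j * j))"
      proof -
        have "poly ?Q w = 1 / (2 * of_real pi * \<i>) * (w * w * poly (pderiv Q) w - of_nat (2 * k) * (w * poly Q w))" for w
          unfolding poly_smult poly_diff poly_mult by simp
        moreover have "j ^ (2 * Suc k) = j ^ (2 * k) * (j * j)" by simp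
        ultimately show ?thesis by (simp only: times_divide_eq_right[symmetric] mult.assoc[symmetric]) simp
      qed
      moreover have "((of_int c * j) * (of_int c * j) * P
            - of_nat (2 * k) * ((of_int c * j) * P')) / (J * (j * j)) = (of_int c ^ 2 * P) / J
          - of_nat (2 * k) * of_int c * P' / (j * J)" if "J \<noteq> 0" for P P' J :: complex
        using j0 that by (simp add: diff_divide_distrib power2_eq_square mult_ac)
      from this[of "j ^ (2 * k)"] have "((of_int c * j) * (of_int c * j) * poly (pderiv Q) (of_int c * j)
            - of_nat (2 * k) * ((of_int c * j) * poly Q (of_int c * j))) / (j ^ (2 * k) * (j * j)) =
          (of_int c ^ 2 * poly (pderiv Q) (of_int c * j)) / j ^ (2 * k)
          - of_nat (2 * k) * of_int c * poly Q (of_int c * j) / j ^ Suc (2 * k)"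
        using j0 by simp
      ultimately show ?thesis unfolding right_diff_distrib by metis
    qed
    have bound: "norm (H w) \<le> C * 2 ^ k * 9 ^ M / (y ^ k * v ^ M)" if w: "w \<in> cball z (y / 2)" for w
    proof -
      define u where "u = Im w / (norm (J w))\<^sup>2"
      have "J w = j + of_int c * (w - z)" by (simp add: J_def a(3) algebra_simps)
      hence "norm (J w) \<le> norm j + norm (of_int c * (w - z))" using norm_triangle_ineq by metis
      also have "norm (of_int c * (w - z)) \<le> \<bar>real_of_int c\<bar> * (y / 2)"
      proof -
        have "norm (w - z) \<le> y / 2" using w by (simp add: dist_norm norm_minus_commute)
        thus ?thesis unfolding norm_mult norm_of_int by (rule mult_left_mono) simp
      qed
      also have "\<dots> \<le> norm j / 2" using modular_pair_automorphy_le[OF a(2,3)] by (simp add: y_def)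
      finally have nJ: "norm (J w) \<le> 3 / 2 * norm j" by simp
      have "(norm (J w))\<^sup>2 \<le> (3 / 2 * norm j)\<^sup>2" by (intro power_mono nJ) auto
      hence nJ2: "(norm (J w))\<^sup>2 \<le> 9 / 4 * (norm j)\<^sup>2" by (simp add: power_mult_distrib power2_eq_square)
      have pos: "(norm (J w))\<^sup>2 > 0" using J0[OF im2[OF w]] by simp
      have "v / 9 = y / (9 * (norm j)\<^sup>2)" by (simp add: a(4) y_def)
      also have "\<dots> \<le> (y / 2) / (9 / 4 * (norm j)\<^sup>2)" using y j0 by (simp add: field_simps)
      also have "\<dots> \<le> (y / 2) / (norm (J w))\<^sup>2"
        using y pos nJ2 j0 by (intro divide_left_mono) auto
      also have "\<dots> \<le> u" unfolding u_def using im[OF w] pos by (intro divide_right_mono) auto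
      finally have u: "v / 9 \<le> u" .
      have "norm (H w) \<le> C / (Im w ^ k * u ^ M)"
        unfolding H_def by (rule C(2)[OF a(1) im2[OF w] _ u_def]) (use u a(5) in \<open>auto simp: J_def\<close>)
      also have "\<dots> \<le> C / ((y / 2) ^ k * (v / 9) ^ M)"
        using C(1) y v0 a(5) u im[OF w] im2[OF w]
        by (intro divide_left_mono mult_mono power_mono mult_pos_pos zero_less_power) auto
      also have "\<dots> = C * 2 ^ k * 9 ^ M / (y ^ k * v ^ M)"
        by (simp add: power_divide)
      finally show ?thesis .
    qed
    have "norm ((deriv ^^ 1) H z) \<le> fact 1 * (C * 2 ^ k * 9 ^ M / (y ^ k * v ^ M)) / (y / 2) ^ 1"
    proof (rule Cauchy_inequality)
      have "H field_differentiable (at w)" if "w \<in> cball z (y / 2)" for w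
        using H_deriv[OF im2[OF that]] field_differentiable_def by blast
      hence "H holomorphic_on cball z (y / 2)"
        using field_differentiable_at_within unfolding holomorphic_on_def by blast
      thus "continuous_on (cball z (y / 2)) H" "H holomorphic_on ball z (y / 2)"
        using holomorphic_on_imp_continuous_on holomorphic_on_subset ball_subset_cball by blast+
    qed (use y bound in \<open>auto simp: dist_norm\<close>)
    hence "norm (deriv H z) \<le> C * 2 ^ k * 9 ^ M * 2 / (y ^ Suc k * v ^ M)" by (simp add: mult_ac)
    moreover have "norm X \<le> norm (2 * of_real pi * \<i> * X)" for X
    proof -
      have "1 \<le> norm (2 * of_real pi * \<i> :: complex)" using pi_gt3 by (simp add: norm_mult)
      from mult_right_mono[OF this norm_ge_zero[of X]] show ?thesis unfolding norm_mult by (simp only: mult_1)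
    qed
    note this[of "qser (fps_XD f) z - poly ?Q (of_int c * j) / j ^ (2 * Suc k)"]
    ultimately show "norm (qser (fps_XD f) z - poly ?Q (of_int c * j) / j ^ (2 * Suc k)) \<le> C * 2 ^ k * 9 ^ M * 2 / (Im z ^ Suc k * v ^ M)"
      unfolding main y_def by (rule order_trans[rotated])
  qed
qed

section \<open>Principal parts of the Eisenstein series and their derivatives\<close>

lemma power_le_exp: "(x::real) ^ M \<le> real M ^ M * exp x" if "x \<ge> 0"
proof (cases "M = 0")
  case False
  have "x / real M \<le> exp (x / real M)" using exp_ge_add_one_self[of "x / real M"] by linarith
  hence "(x / real M) ^ M \<le> exp (x / real M) ^ M" using that by (intro power_mono) auto
  also have "\<dots> = exp x" using False by (simp flip: exp_of_nat_mult)
  finally show ?thesis using False by (simp add: power_divide field_simps)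
qed (use that in auto)

lemma qser_rapid_decay:
  assumes "fps_conv_radius f \<ge> 1" "fps_nth f 0 = 0" "v0 > 0"
  obtains B where "B \<ge> 0" "\<And>w. Im w \<ge> v0 \<Longrightarrow> norm (qser f w) \<le> B / Im w ^ M"
proof -
  \<comment> \<open>Half of the exponent \<open>2 pi v\<close> is kept for convergence of the
    series, the other half pays for the power \<open>v^M\<close>; the latter uses that the constant
    term vanishes.\<close>
  define r where "r = exp (- pi * v0)"
  have "r < 1" using assms(3) by (simp add: r_def)
  hence "ereal (norm r) < fps_conv_radius f"
    by (intro less_le_trans[OF _ assms(1)]) (auto simp: one_ereal_def r_def)
  hence "ereal (norm (of_real r :: complex)) < fps_conv_radius f" by simp
  from norm_summable_fps[OF this] have summ: "summable (\<lambda>n. norm (fps_nth f n) * r ^ n)"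
    by (simp add: norm_mult norm_power r_def)
  define S where "S = suminf (\<lambda>n. norm (fps_nth f n) * r ^ n)"
  have "norm (qser f w) \<le> (real M ^ M * S) / Im w ^ M" if w: "Im w \<ge> v0" for w
  proof -
    define v where "v = Im w"
    have v: "v \<ge> v0" "v > 0" using w assms(3) by (auto simp: v_def)
    have vM: "v ^ M * exp (- pi * v) \<le> real M ^ M"
    proof -
      have "v ^ M \<le> (pi * v) ^ M" using v pi_ge_two by (intro power_mono) (auto simp: mult_le_cancel_right1)
      also have "\<dots> \<le> real M ^ M * exp (pi * v)" using v by (intro power_le_exp) auto
      finally show ?thesis by (simp add: exp_minus field_simps)
    qed
    have le: "norm (fps_nth f n * nome w ^ n) \<le> real M ^ M / v ^ M * (norm (fps_nth f n) * r ^ n)" for n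
    proof (cases "n = 0")
      case False
      have "norm (nome w ^ n) = exp (- 2 * pi * v) ^ n" by (simp only: norm_power norm_nome v_def)
      also have "\<dots> = exp (- pi * (real n * v)) * exp (- pi * v) ^ n"
        by (simp add: algebra_simps flip: exp_of_nat_mult exp_add)
      also have "\<dots> \<le> exp (- pi * v) * r ^ n"
        using v False unfolding r_def
        by (intro mult_mono power_mono) (auto simp: mult_le_cancel_right1)
      also have "exp (- pi * v) \<le> real M ^ M / v ^ M" using vM v by (simp add: field_simps)
      finally have "norm (nome w ^ n) \<le> real M ^ M / v ^ M * r ^ n" by (simp add: r_def mult_right_mono)
      hence "norm (fps_nth f n) * norm (nome w ^ n) \<le> norm (fps_nth f n) * (real M ^ M / v ^ M * r ^ n)"
        by (intro mult_left_mono) auto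
      thus ?thesis by (simp only: norm_mult mult_ac)
    qed (use assms(2) v in \<open>auto simp: r_def\<close>)
    have "norm (qser f w) \<le> suminf (\<lambda>n. real M ^ M / v ^ M * (norm (fps_nth f n) * r ^ n))"
      unfolding qser_def eval_fps_def by (rule norm_suminf_le[OF le summable_mult[OF summ]])
    also have "\<dots> = real M ^ M / v ^ M * S" unfolding S_def by (rule suminf_mult[OF summ])
    finally show ?thesis by (simp add: v_def)
  qed
  moreover have "S \<ge> 0" unfolding S_def by (intro suminf_nonneg summ) (auto simp: r_def)
  ultimately show ?thesis using that[of "real M ^ M * S"] by simp
qed

text \<open>At the image point all but the constant term decays exponentially. The anomaly of weight
  2 is \<open>c / j = (c j) / j^2\<close>, hence a linear monomial. Decay of order
  \<open>l + M\<close> is requested since dividing by \<open>|j|^(2 l) = (y / v)^l\<close> costs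
  \<open>v^l\<close>.\<close>

lemma cusp_growth_eis_fps:
  assumes "l \<ge> 1"
  shows "cusp_growth l (monom (of_real (zeta_even l) / Lipschitz_const l) 0 +
     monom (if l = 1 then - \<i> / (4 * of_real pi) else 0) 1) (eis_fps l)" (is "cusp_growth l ?Q _")
proof (rule cusp_growthI[OF eis_fps_conv_radius])
  fix M and v0 :: real assume v0: "v0 > 0"
  have "fps_nth (sigma_fps (2 * l - 1)) 0 = 0" by (simp add: sigma_fps_def divisor_sigma_0)
  from qser_rapid_decay[OF sigma_fps_conv_radius this v0]
  obtain B where B: "B \<ge> 0" "\<And>w. Im w \<ge> v0 \<Longrightarrow> norm (qser (sigma_fps (2 * l - 1)) w) \<le> B / Im w ^ (l + M)" by blast
  show "\<exists>C. \<forall>c d z j v. modular_pair c d \<longrightarrow> Im z > 0 \<longrightarrow> j = of_int c * z + of_int d \<longrightarrow>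
      v = Im z / (norm j)\<^sup>2 \<longrightarrow> v \<ge> v0 \<longrightarrow>
      norm (qser (eis_fps l) z - poly ?Q (of_int c * j) / j ^ (2 * l)) \<le> C / (Im z ^ l * v ^ M)"
  proof (intro exI[of _ B] allI impI)
    fix c d z j v
    assume a: "modular_pair c d" "Im z > 0" "j = of_int c * z + of_int d" "v = Im z / (norm j)\<^sup>2" "v0 \<le> v"
    from a(1) obtain \<phi> where \<phi>: "\<And>z. Im z > 0 \<Longrightarrow> Im (\<phi> z) = Im z / (norm (of_int c * z + of_int d))\<^sup>2"
     "\<And>z l. Im z > 0 \<Longrightarrow> l \<ge> 1 \<Longrightarrow> qser (eis_fps l) z = qser (eis_fps l) (\<phi> z) / (of_int c * z + of_int d) ^ (2 * l) +
        (if l = 1 then - \<i> / (4 * of_real pi) * of_int c / (of_int c * z + of_int d) else 0)"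
      unfolding modular_pair_def by blast
    have j0: "j \<noteq> 0" unfolding a(3) by (rule modular_pair_nonzero[OF a(1,2)])
    have v: "v > 0" "Im (\<phi> z) = v" using a v0 \<phi>(1) by auto
    have nj: "norm j ^ (2 * l) = Im z ^ l / v ^ l"
    proof -
      have "(norm j)\<^sup>2 = Im z / v" using j0 a(2) unfolding a(4) by (simp add: field_simps)
      thus ?thesis by (simp add: power_mult power_divide)
    qed
    have "qser (eis_fps l) z - poly ?Q (of_int c * j) / j ^ (2 * l) = qser (sigma_fps (2 * l - 1)) (\<phi> z) / j ^ (2 * l)"
    proof -
      have "qser (eis_fps l) (\<phi> z) = of_real (zeta_even l) / Lipschitz_const l + qser (sigma_fps (2 * l - 1)) (\<phi> z)"
        using v by (intro qser_eis_fps) simp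
      thus ?thesis unfolding \<phi>(2)[OF a(2) assms] a(3)[symmetric] using j0
        by (cases "l = 1") (simp_all add: poly_monom add_divide_distrib diff_divide_distrib power2_eq_square)
    qed
    also have "norm \<dots> \<le> B / v ^ (l + M) / norm j ^ (2 * l)"
      unfolding norm_divide norm_power using B(2)[of "\<phi> z"] v a(5) by (intro divide_right_mono) auto
    also have "\<dots> = B / (Im z ^ l * v ^ M)" unfolding nj using v by (simp add: power_add)
    finally show "norm (qser (eis_fps l) z - poly ?Q (of_int c * j) / j ^ (2 * l)) \<le> B / (Im z ^ l * v ^ M)" .
  qed
qed

text \<open>\<open>D\<close> sends \<open>X^i\<close> in weight \<open>2 k\<close> to
  \<open>(i - 2 k) / (2 pi i) X^(i+1)\<close>, where the \<open>i\<close> in \<open>2 pi i\<close>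
  is the imaginary unit. Two neighbouring monomials are tracked because of the anomaly of weight
  2.\<close>

lemma cusp_growth_XD_monom:
  assumes "cusp_growth k (monom a i + monom b (Suc i)) f"
  shows "cusp_growth (Suc k) (monom (a * (of_nat i - of_nat (2 * k)) / (2 * of_real pi * \<i>)) (Suc i) +
     monom (b * (of_nat (Suc i) - of_nat (2 * k)) / (2 * of_real pi * \<i>)) (Suc (Suc i))) (fps_XD f)"
proof -
  have m: "smult (1 / (2 * of_real pi * \<i>)) ([:0, 0, 1:] * pderiv (monom a i) - smult (of_nat (2 * k)) ([:0, 1:] * monom a i))
      = monom (a * (of_nat i - of_nat (2 * k)) / (2 * of_real pi * \<i>)) (Suc i)" for a :: complex and i
    by (cases i; intro poly_eqI) (auto simp: pderiv_monom coeff_pCons algebra_simps diff_divide_distrib split: nat.splits)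
  have "smult (1 / (2 * of_real pi * \<i>)) ([:0, 0, 1:] * pderiv (p + q) - smult (of_nat (2 * k)) ([:0, 1:] * (p + q))) =
    smult (1 / (2 * of_real pi * \<i>)) ([:0, 0, 1:] * pderiv p - smult (of_nat (2 * k)) ([:0, 1:] * p)) +
    smult (1 / (2 * of_real pi * \<i>)) ([:0, 0, 1:] * pderiv q - smult (of_nat (2 * k)) ([:0, 1:] * q))" for p q :: "complex poly"
    by (simp add: pderiv_add smult_add_right smult_diff_right distrib_left)
  from cusp_growth_XD[OF assms, unfolded this m] show ?thesis .
qed

text \<open>Coefficient of \<open>X^t\<close> in the principal part of \<open>D^t g_l\<close>. The
  start value is \<open>zeta (2 l) (2 l - 1)! / (2 pi i)^(2 l)\<close>, and passing from
  \<open>t\<close> to \<open>t + 1\<close> multiplies by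
  \<open>- (2 l + t) / (2 pi i)\<close>.\<close>

definition eis_principal :: "nat \<Rightarrow> nat \<Rightarrow> complex" where
  "eis_principal l t = of_real (zeta_even l) / (2 * of_real pi * \<i>) ^ (2 * l) * fact (2 * l + t - 1) / (- 2 * of_real pi * \<i>) ^ t"

text \<open>The coefficient \<open>b\<close> is the trace of the weight 2 anomaly. For
  \<open>l = 1\<close> and \<open>l + t = k\<close> it sits in degree \<open>k\<close>, which is
  harmless, so its value is left open.\<close>

lemma cusp_growth_XD_eis_fps:
  assumes "l \<ge> 1"
  shows "\<exists>b. cusp_growth (l + t) (monom (eis_principal l t) t + monom b (Suc t)) ((fps_XD ^^ t) (eis_fps l)) \<and> (l \<noteq> 1 \<longrightarrow> b = 0)"
proof (induction t)
  case 0
  have "eis_principal l 0 = of_real (zeta_even l) / Lipschitz_const l"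
    by (simp add: eis_principal_def Lipschitz_const_def)
  thus ?case using cusp_growth_eis_fps[OF assms] by (auto simp: One_nat_def)
next
  case (Suc t)
  then obtain b where b: "cusp_growth (l + t) (monom (eis_principal l t) t + monom b (Suc t)) ((fps_XD ^^ t) (eis_fps l))" "l \<noteq> 1 \<longrightarrow> b = 0"
    by blast
  have f: "fact (2 * l + Suc t - 1) = of_nat (2 * l + t) * (fact (2 * l + t - 1) :: complex)"
    using assms by (cases "2 * l + t") auto
  have i: "of_nat t - of_nat (2 * (l + t)) = - (of_nat (2 * l + t) :: complex)" by simp
  have "eis_principal l t * (of_nat t - of_nat (2 * (l + t))) / (2 * of_real pi * \<i>) = eis_principal l (Suc t)"
  proof -
    define g where "g = 2 * of_real pi * \<i>"
    have "- 2 * of_real pi * \<i> = - g" by (simp add: g_def)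
    moreover define m :: complex where "m = of_nat (2 * l + t)"
    ultimately show ?thesis unfolding eis_principal_def f i g_def[symmetric] m_def[symmetric]
      by (simp add: mult_ac)
  qed
  with cusp_growth_XD_monom[OF b(1)] b(2) show ?case by auto
qed

section \<open>Principal part of a general form and its reduction\<close>

text \<open>The substitution \<open>E_2 \<mapsto> 1 + (6 i / pi) X\<close>,
  \<open>E_4, E_6 \<mapsto> 1\<close>; the slope is \<open>-24\<close> times
  \<open>- i / (4 pi)\<close>, the anomaly of \<open>eis_fps 1\<close>.\<close>

definition principal_poly :: "quasimodular \<Rightarrow> complex poly" where
  "principal_poly F = (\<Sum>(a, b, c)\<in>Poly_Mapping.keys F. smult (of_rat (Poly_Mapping.lookup F (a, b, c))) ([:1, 6 * \<i> / of_real pi:] ^ a))"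

lemma complex_fps_q_expansion:
  "complex_fps (q_expansion F) = (\<Sum>(a, b, c)\<in>Poly_Mapping.keys F. fps_const (of_rat (Poly_Mapping.lookup F (a, b, c))) *
     (complex_fps (eisenstein 2) ^ a * complex_fps (eisenstein 4) ^ b * complex_fps (eisenstein 6) ^ c))"
  unfolding q_expansion_def substitute_def complex_fps_sum
  by (intro sum.cong) (auto simp: complex_fps_mult complex_fps_power complex_fps_const)

lemma cusp_growth_eisenstein:
  "cusp_growth 1 [:1, 6 * \<i> / of_real pi:] (complex_fps (eisenstein 2))"
  "cusp_growth 2 1 (complex_fps (eisenstein 4))"
  "cusp_growth 3 1 (complex_fps (eisenstein 6))"
proof -
  have "smult (- 24) (monom (of_real (zeta_even 1) / Lipschitz_const 1) 0 + monom (- \<i> / (4 * of_real pi)) 1) = [:1, 6 * \<i> / of_real pi:]"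
    by (simp only: zeta_even_values Lipschitz_const_values) (simp add: monom_Suc monom_0)
  thus "cusp_growth 1 [:1, 6 * \<i> / of_real pi:] (complex_fps (eisenstein 2))"
    using cusp_growth_cmult[OF cusp_growth_eis_fps[of 1], of "- 24"] by (simp add: complex_fps_eisenstein)
  have "smult 240 (monom (of_real (zeta_even 2) / Lipschitz_const 2) 0 + monom 0 1) = 1"
    by (simp only: zeta_even_values Lipschitz_const_values) (simp add: monom_Suc monom_0 one_pCons)
  thus "cusp_growth 2 1 (complex_fps (eisenstein 4))"
    using cusp_growth_cmult[OF cusp_growth_eis_fps[of 2], of 240] by (simp add: complex_fps_eisenstein)
  have "smult (- 504) (monom (of_real (zeta_even 3) / Lipschitz_const 3) 0 + monom 0 1) = 1"
    by (simp only: zeta_even_values Lipschitz_const_values) (simp add: monom_Suc monom_0 one_pCons)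
  thus "cusp_growth 3 1 (complex_fps (eisenstein 6))"
    using cusp_growth_cmult[OF cusp_growth_eis_fps[of 3], of "- 504"] by (simp add: complex_fps_eisenstein)
qed

lemma cusp_growth_q_expansion:
  assumes "homogeneous (2 * k) F"
  shows "cusp_growth k (principal_poly F) (complex_fps (q_expansion F))"
  unfolding principal_poly_def complex_fps_q_expansion
proof (rule cusp_growth_sum)
  fix e assume e: "e \<in> Poly_Mapping.keys F"
  obtain a b c where abc: "e = (a, b, c)" by (cases e)
  have "k = a * 1 + b * 2 + c * 3" using assms e abc unfolding homogeneous_def by auto
  moreover have "cusp_growth (a * 1 + b * 2 + c * 3) ([:1, 6 * \<i> / of_real pi:] ^ a * 1 ^ b * 1 ^ c)
     (complex_fps (eisenstein 2) ^ a * complex_fps (eisenstein 4) ^ b * complex_fps (eisenstein 6) ^ c)"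
    by (intro cusp_growth_mult cusp_growth_power cusp_growth_eisenstein)
  ultimately show "cusp_growth k (case e of (a, b, c) \<Rightarrow> smult (of_rat (Poly_Mapping.lookup F (a, b, c))) ([:1, 6 * \<i> / of_real pi:] ^ a))
     (case e of (a, b, c) \<Rightarrow> fps_const (of_rat (Poly_Mapping.lookup F (a, b, c))) *
     (complex_fps (eisenstein 2) ^ a * complex_fps (eisenstein 4) ^ b * complex_fps (eisenstein 6) ^ c))"
    unfolding abc prod.case by (intro cusp_growth_cmult) simp
qed

lemma degree_principal_poly:
  assumes "homogeneous (2 * k) F"
  shows "degree (principal_poly F) \<le> k"
  unfolding principal_poly_def
proof (rule degree_sum_le)
  fix e assume e: "e \<in> Poly_Mapping.keys F"
  obtain a b c where abc: "e = (a, b, c)" by (cases e)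
  have "a \<le> k" using assms e abc unfolding homogeneous_def by auto
  have "degree (smult (of_rat (Poly_Mapping.lookup F (a, b, c))) ([:1, 6 * \<i> / of_real pi:] ^ a)) \<le> degree ([:1, 6 * \<i> / of_real pi:] ^ a)"
    by (rule degree_smult_le)
  also have "\<dots> \<le> degree [:1, 6 * \<i> / of_real pi:] * a" by (rule degree_power_le)
  also have "\<dots> \<le> k" using \<open>a \<le> k\<close> by simp
  finally show "degree (case e of (a, b, c) \<Rightarrow> smult (of_rat (Poly_Mapping.lookup F (a, b, c))) ([:1, 6 * \<i> / of_real pi:] ^ a)) \<le> k"
    unfolding abc by simp
qed simp

definition eis_coordinate :: "nat \<Rightarrow> quasimodular \<Rightarrow> nat \<Rightarrow> complex" where
  "eis_coordinate k F l = coeff (principal_poly F) (k - l) / eis_principal l (k - l)"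

text \<open>The derivatives match the degrees below \<open>k\<close> only; what remains of the
  principal part is a multiple of \<open>X^k\<close>.\<close>

definition cuspidal_part :: "nat \<Rightarrow> quasimodular \<Rightarrow> complex fps" where
  "cuspidal_part k F = complex_fps (q_expansion F) - (\<Sum>l=1..k. fps_const (eis_coordinate k F l) * (fps_XD ^^ (k - l)) (eis_fps l))"

lemma zeta_even_pos: "l > 0 \<Longrightarrow> zeta_even l > 0"
  using zeta_even_sums[of l] unfolding zeta_even_def
  by (intro suminf_pos) (auto simp: sums_iff)

lemma eis_principal_nonzero: "l > 0 \<Longrightarrow> eis_principal l t \<noteq> 0"
  unfolding eis_principal_def using zeta_even_pos[of l] by simp

lemma cusp_growth_cuspidal_part:
  assumes "homogeneous (2 * k) F" "k > 0"
  obtains \<beta> where "cusp_growth k (monom \<beta> k) (cuspidal_part k F)"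
proof -
  define Q where "Q = principal_poly F"
  define \<alpha> where "\<alpha> = eis_coordinate k F"
  have "\<forall>l\<in>{1..k}. \<exists>b. cusp_growth k (monom (eis_principal l (k - l)) (k - l) + monom b (Suc (k - l))) ((fps_XD ^^ (k - l)) (eis_fps l)) \<and> (l \<noteq> 1 \<longrightarrow> b = 0)"
    using cusp_growth_XD_eis_fps by (metis atLeastAtMost_iff le_add_diff_inverse)
  then obtain b where b: "\<And>l. l \<in> {1..k} \<Longrightarrow> cusp_growth k (monom (eis_principal l (k - l)) (k - l) + monom (b l) (Suc (k - l))) ((fps_XD ^^ (k - l)) (eis_fps l))"
     "\<And>l. l \<in> {1..k} \<Longrightarrow> l \<noteq> 1 \<Longrightarrow> b l = 0"
    by metis
  define P where "P = (\<Sum>l=1..k. smult (\<alpha> l) (monom (eis_principal l (k - l)) (k - l) + monom (b l) (Suc (k - l))))"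
  have 1: "cusp_growth k P (\<Sum>l=1..k. fps_const (\<alpha> l) * (fps_XD ^^ (k - l)) (eis_fps l))"
    unfolding P_def by (intro cusp_growth_sum cusp_growth_cmult b)
  have "cusp_growth k (Q + smult (- 1) P) (complex_fps (q_expansion F) + fps_const (- 1) * (\<Sum>l=1..k. fps_const (\<alpha> l) * (fps_XD ^^ (k - l)) (eis_fps l)))"
    unfolding Q_def by (intro cusp_growth_add cusp_growth_q_expansion assms cusp_growth_cmult 1)
  moreover have "fps_const (- 1) = (- 1 :: complex fps)" by (simp add: fps_eq_iff)
  ultimately have cg: "cusp_growth k (Q - P) (cuspidal_part k F)"
    by (simp add: cuspidal_part_def \<alpha>_def)
  have "P = (\<Sum>l=1..k. monom (coeff Q (k - l)) (k - l)) + (\<Sum>l=1..k. monom (\<alpha> l * b l) (Suc (k - l)))"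
    unfolding P_def sum.distrib[symmetric]
    by (intro sum.cong refl) (simp add: smult_add_right smult_monom \<alpha>_def eis_coordinate_def Q_def eis_principal_nonzero)
  \<comment> \<open>Second monomials come from \<open>l = 1\<close> alone, and
    \<open>Suc (k - 1) = k\<close>.\<close>
  also have "(\<Sum>l=1..k. monom (\<alpha> l * b l) (Suc (k - l))) = (\<Sum>l\<in>{1}. monom (\<alpha> l * b l) (Suc (k - l)))"
    using assms(2) b(2) by (intro sum.mono_neutral_right) auto
  also have "\<dots> = monom (\<alpha> 1 * b 1) k" using assms(2) by simp
  also have "(\<Sum>l=1..k. monom (coeff Q (k - l)) (k - l)) = (\<Sum>i<k. monom (coeff Q i) i)"
    by (rule sum.reindex_bij_witness[of _ "\<lambda>i. k - i" "\<lambda>l. k - l"]) auto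
  finally have P: "P = (\<Sum>i<k. monom (coeff Q i) i) + monom (\<alpha> 1 * b 1) k" .
  have "Q = (\<Sum>i\<le>k. monom (coeff Q i) i)"
    using degree_principal_poly[OF assms(1)] unfolding Q_def
    by (simp add: poly_eq_iff coeff_sum coeff_eq_0)
  also have "\<dots> = (\<Sum>i<k. monom (coeff Q i) i) + monom (coeff Q k) k"
    by (simp add: lessThan_Suc_atMost[symmetric])
  finally have Q: "Q = (\<Sum>i<k. monom (coeff Q i) i) + monom (coeff Q k) k" .
  have "Q - P = monom (coeff Q k) k - monom (\<alpha> 1 * b 1) k"
    by (subst P, subst (1) Q) (rule add_diff_cancel_left)
  also have "\<dots> = monom (coeff Q k - \<alpha> 1 * b 1) k" by (simp add: diff_monom)
  finally have "Q - P = monom (coeff Q k - \<alpha> 1 * b 1) k" .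
  with cg that show ?thesis by simp
qed

lemma cuspidal_part_bound:
  assumes "homogeneous (2 * k) F" "k > 0"
  obtains C where "C \<ge> 0" "\<And>z. Im z > 0 \<Longrightarrow> norm (qser (cuspidal_part k F) z) \<le> C / Im z ^ k"
proof -
  obtain \<beta> where \<beta>: "cusp_growth k (monom \<beta> k) (cuspidal_part k F)"
    using cusp_growth_cuspidal_part[OF assms] by blast
  obtain C where C: "C \<ge> 0" "\<And>c d z j v. modular_pair c d \<Longrightarrow> Im z > 0 \<Longrightarrow> j = of_int c * z + of_int d \<Longrightarrow> v = Im z / (norm j)\<^sup>2 \<Longrightarrow>
      v \<ge> 1 / 2 \<Longrightarrow> norm (qser (cuspidal_part k F) z - poly (monom \<beta> k) (of_int c * j) / j ^ (2 * k)) \<le> C / (Im z ^ k * v ^ 0)"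
    using cusp_growthD[OF \<beta>, of "1 / 2" 0] by (metis half_gt_zero_iff zero_less_one)
  show ?thesis
  proof (rule that[of "C + norm \<beta>"])
    fix z :: complex assume z: "Im z > 0"
    obtain c d where cd: "modular_pair c d" "Im z / (norm (of_int c * z + of_int d))\<^sup>2 \<ge> 1 / 2"
      using modular_pair_reach[OF z] by blast
    define j where "j = of_int c * z + of_int d"
    have j0: "j \<noteq> 0" unfolding j_def by (rule modular_pair_nonzero[OF cd(1) z])
    have "norm (qser (cuspidal_part k F) z - poly (monom \<beta> k) (of_int c * j) / j ^ (2 * k)) \<le> C / Im z ^ k"
      using C(2)[OF cd(1) z j_def refl] cd(2) by (simp add: j_def)
    \<comment> \<open>In degree \<open>k\<close> the quotient is
      \<open>(c j)^k / j^(2 k) = (c / j)^k\<close>, and \<open>|c| y <= |j|\<close> for every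
      pair.\<close>
    moreover have "norm (poly (monom \<beta> k) (of_int c * j) / j ^ (2 * k)) \<le> norm \<beta> / Im z ^ k"
    proof -
      have "poly (monom \<beta> k) (of_int c * j) / j ^ (2 * k) = \<beta> * (of_int c / j) ^ k"
        using j0 by (simp add: poly_monom power_mult_distrib power_divide power_mult power2_eq_square)
      also have "norm \<dots> = norm \<beta> * (\<bar>real_of_int c\<bar> / norm j) ^ k" by (simp add: norm_mult norm_power norm_divide)
      also have "\<dots> \<le> norm \<beta> * (1 / Im z) ^ k"
        using modular_pair_automorphy_le[OF z j_def] j0 z
        by (intro mult_left_mono power_mono) (auto simp: field_simps)
      finally show ?thesis by (simp add: power_one_over)
    qed
    ultimately have "norm (qser (cuspidal_part k F) z - poly (monom \<beta> k) (of_int c * j) / j ^ (2 * k)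
      + poly (monom \<beta> k) (of_int c * j) / j ^ (2 * k)) \<le> C / Im z ^ k + norm \<beta> / Im z ^ k"
      by (rule norm_triangle_mono)
    thus "norm (qser (cuspidal_part k F) z) \<le> (C + norm \<beta>) / Im z ^ k" by (simp add: add_divide_distrib)
  qed (use C(1) in simp)
qed

lemma cuspidal_part_conv_radius:
  assumes "homogeneous (2 * k) F" "k > 0"
  shows "fps_conv_radius (cuspidal_part k F) \<ge> 1"
  using cusp_growth_cuspidal_part[OF assms] unfolding cusp_growth_def by blast

subsection \<open>Partial sums of coefficients\<close>

lemma sin_ge_half:
  fixes t :: real
  assumes "0 \<le> t" "t \<le> pi / 2"
  shows "t / 2 \<le> sin t"
proof -
  have "\<bar>sin t - (\<Sum>m<3. sin_coeff m * t ^ m)\<bar> \<le> inverse (fact 3) * \<bar>t\<bar> ^ 3"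
    by (rule Maclaurin_sin_bound)
  hence "\<bar>sin t - t\<bar> \<le> t ^ 3 / 6"
    using assms by (simp add: sin_coeff_def eval_nat_numeral)
  hence "t - t ^ 3 / 6 \<le> sin t" by linarith
  \<comment> \<open>\<open>pi / 2 <= 8/5\<close> and \<open>(8/5)^2 < 3\<close>, so the cubic term
    takes away at most half of \<open>t\<close>.\<close>
  moreover have "t ^ 2 \<le> (8 / 5) ^ 2"
    using assms pi_less_4 pi_approx(2) by (intro power_mono) auto
  hence "t * t ^ 2 \<le> t * 3" using assms by (intro mult_left_mono) (auto simp: power2_eq_square)
  hence "t ^ 3 / 6 \<le> t / 2" by (simp add: power3_eq_cube power2_eq_square)
  ultimately show ?thesis by linarith
qed

text \<open>For \<open>w = \<rho> cis (2 pi x)\<close> one has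
  \<open>|w - 1|^2 = (\<rho> - 1)^2 + 4 \<rho> sin^2 (pi x)\<close>. The first square gives the
  bound \<open>y\<close>, the second the distance of \<open>x\<close> to the nearest integer, and
  the two bounds are averaged.\<close>

lemma norm_nome_minus_1_ge:
  assumes "0 \<le> x" "x \<le> 1" "0 < y"
  shows "norm (nome (of_real x + \<i> * of_real (- y)) - 1) \<ge> (min x (1 - x) + y) / 2"
proof -
  define \<rho> where "\<rho> = exp (2 * pi * y)"
  have \<rho>: "\<rho> \<ge> 1 + 2 * pi * y" unfolding \<rho>_def by (rule exp_ge_add_one_self)
  have \<rho>1: "\<rho> \<ge> 1" using \<rho> assms by (auto intro: order_trans[rotated])
  have w: "nome (of_real x + \<i> * of_real (- y)) = of_real \<rho> * cis (2 * pi * x)"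
    unfolding nome_def \<rho>_def cis_conv_exp exp_of_real[symmetric]
    by (subst exp_add[symmetric]) (simp add: algebra_simps)
  have s: "sin (pi * x) \<ge> min x (1 - x)"
  proof (cases "x \<le> 1 / 2")
    case True
    have "pi * x / 2 \<le> sin (pi * x)" using True assms by (intro sin_ge_half) auto
    moreover have "x * 2 \<le> x * pi" using assms pi_ge_two by (intro mult_left_mono) auto
    ultimately show ?thesis using True by (simp add: mult.commute min_def)
  next
    case False
    have "pi * (1 - x) / 2 \<le> sin (pi * (1 - x))" using False assms by (intro sin_ge_half) auto
    also have "sin (pi * (1 - x)) = sin (pi * x)" by (simp add: right_diff_distrib sin_diff)
    finally have "pi * (1 - x) / 2 \<le> sin (pi * x)" .
    moreover have "(1 - x) * 2 \<le> (1 - x) * pi" using assms pi_ge_two by (intro mult_left_mono) auto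
    ultimately show ?thesis using False by (simp add: mult.commute min_def)
  qed
  have c: "cos (2 * pi * x) = 1 - 2 * (sin (pi * x))\<^sup>2"
    using cos_double_sin[of "pi * x"] by (simp add: mult.assoc)
  have expand: "(a * c - 1)\<^sup>2 + (a * s)\<^sup>2 = a\<^sup>2 * (c\<^sup>2 + s\<^sup>2) - 2 * a * c + 1" for a c s :: real
    by (simp add: power2_eq_square algebra_simps)
  have "(norm (of_real \<rho> * cis (2 * pi * x) - 1))\<^sup>2 = (\<rho> * cos (2 * pi * x) - 1)\<^sup>2 + (\<rho> * sin (2 * pi * x))\<^sup>2"
    by (simp add: cmod_power2)
  also have "\<dots> = \<rho>\<^sup>2 * ((cos (2 * pi * x))\<^sup>2 + (sin (2 * pi * x))\<^sup>2) - 2 * \<rho> * cos (2 * pi * x) + 1"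
    by (rule expand)
  also have "\<dots> = (\<rho> - 1)\<^sup>2 + 4 * \<rho> * (sin (pi * x))\<^sup>2"
    unfolding c sin_squared_eq[of "2 * pi * x"] by (simp add: power2_eq_square algebra_simps)
  finally have n: "(norm (of_real \<rho> * cis (2 * pi * x) - 1))\<^sup>2 = (\<rho> - 1)\<^sup>2 + 4 * \<rho> * (sin (pi * x))\<^sup>2" .
  have "(\<rho> - 1)\<^sup>2 \<le> (norm (of_real \<rho> * cis (2 * pi * x) - 1))\<^sup>2" unfolding n using \<rho>1 by simp
  hence 1: "\<rho> - 1 \<le> norm (of_real \<rho> * cis (2 * pi * x) - 1)" by (rule power2_le_imp_le) simp
  have "y * 1 \<le> y * (2 * pi)" using assms pi_ge_two by (intro mult_left_mono) auto
  hence 2: "y \<le> norm (of_real \<rho> * cis (2 * pi * x) - 1)" using 1 \<rho> by (simp add: mult_ac)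
  have m: "0 \<le> min x (1 - x)" using assms by auto
  have "(min x (1 - x))\<^sup>2 \<le> (sin (pi * x))\<^sup>2" using s m by (intro power_mono) auto
  also have "1 * (sin (pi * x))\<^sup>2 \<le> 4 * \<rho> * (sin (pi * x))\<^sup>2" using \<rho>1 by (intro mult_right_mono) auto
  hence "(sin (pi * x))\<^sup>2 \<le> (norm (of_real \<rho> * cis (2 * pi * x) - 1))\<^sup>2" unfolding n using zero_le_power2[of "\<rho> - 1"] by linarith
  finally have "min x (1 - x) \<le> norm (of_real \<rho> * cis (2 * pi * x) - 1)" by (rule power2_le_imp_le) simp
  moreover have "(a + b) / 2 \<le> c" if "a \<le> c" "b \<le> c" for a b c :: real using that by simp
  ultimately show ?thesis unfolding w using 2 by blast
qed

text \<open>A geometric sum. At height \<open>1 / N\<close> the power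
  \<open>|w|^N = exp (2 pi)\<close> stays bounded, so only the denominator \<open>|w - 1|\<close>
  matters.\<close>

lemma Dirichlet_kernel_bound:
  assumes "0 \<le> x" "x \<le> 1" "N > 0"
  shows "norm (\<Sum>n=1..N. nome (of_real x + \<i> * of_real (- (1 / real N))) ^ n)
     \<le> 4 * exp (4 * pi) * (1 / (x + 1 / real N) + 1 / (1 - x + 1 / real N))"
proof -
  define y where "y = 1 / real N"
  have y: "y > 0" using assms by (simp add: y_def)
  define w where "w = nome (of_real x + \<i> * of_real (- y))"
  have nw: "norm w = exp (2 * pi * y)" unfolding w_def norm_nome by simp
  have nwN: "norm w ^ N = exp (2 * pi)" unfolding nw exp_of_nat_mult[symmetric] using assms by (simp add: y_def)
  have "y \<le> 1" using assms by (simp add: y_def)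
  hence nw1: "norm w \<le> exp (2 * pi)" unfolding nw by simp
  define L where "L = norm (w - 1)"
  have L: "L \<ge> (min x (1 - x) + y) / 2" unfolding L_def w_def by (rule norm_nome_minus_1_ge[OF assms(1,2) y])
  hence L0: "L > 0" using assms y by (auto simp: min_def split: if_splits)
  have "w \<noteq> 1" using L0 by (auto simp: L_def)
  have "(\<Sum>n=1..N. w ^ n) * (w - 1) = w * (w ^ N - 1)"
  proof -
    have "(\<Sum>n=1..N. w ^ n) = w * (\<Sum>n<N. w ^ n)"
      by (simp add: sum_distrib_left sum.atLeast1_atMost_eq flip: power_Suc)
    thus ?thesis using power_diff_1_eq[of w N] by (simp add: mult_ac)
  qed
  hence "norm (\<Sum>n=1..N. w ^ n) * L = norm w * norm (w ^ N - 1)"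
    unfolding L_def by (metis norm_mult)
  also have "\<dots> \<le> exp (2 * pi) * (2 * exp (2 * pi))"
  proof (intro mult_mono nw1)
    have "norm (w ^ N - 1) \<le> norm w ^ N + 1" using norm_triangle_ineq4[of "w ^ N" 1] by (simp add: norm_power)
    also have "\<dots> \<le> 2 * exp (2 * pi)" unfolding nwN by simp
    finally show "norm (w ^ N - 1) \<le> 2 * exp (2 * pi)" .
  qed auto
  also have "\<dots> = 2 * exp (4 * pi)" by (simp flip: exp_add)
  finally have "norm (\<Sum>n=1..N. w ^ n) \<le> 2 * exp (4 * pi) / L" using L0 by (simp add: field_simps)
  also have "\<dots> \<le> 2 * exp (4 * pi) / ((min x (1 - x) + y) / 2)"
    using L L0 assms y by (intro divide_left_mono mult_pos_pos) (auto simp: min_def)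
  also have "\<dots> = 4 * exp (4 * pi) * (1 / (min x (1 - x) + y))" by simp
  \<comment> \<open>The minimum is one of \<open>x\<close> and \<open>1 - x\<close>; adding both
    fractions gives a bound with an elementary integral.\<close>
  also have "\<dots> \<le> 4 * exp (4 * pi) * (1 / (x + y) + 1 / (1 - x + y))"
    using assms y by (intro mult_left_mono) (auto simp: min_def)
  finally show ?thesis unfolding w_def y_def .
qed

section \<open>Hecke's estimate for coefficient sums\<close>

lemma fps_coeff_contour_integral:
  fixes f :: "complex fps"
  assumes "fps_conv_radius f \<ge> 1" "0 < r" "r < 1"
  shows "((\<lambda>u. eval_fps f u / u ^ Suc n) has_contour_integral (2 * pi * \<i> * fps_nth f n)) (circlepath 0 r)"
proof -
  have sub: "cball (0::complex) r \<subseteq> eball 0 (fps_conv_radius f)"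
  proof
    fix u :: complex assume "u \<in> cball 0 r"
    hence "ereal (norm u) < 1" using assms by (simp add: one_ereal_def)
    from less_le_trans[OF this assms(1)] show "u \<in> eball 0 (fps_conv_radius f)" by (simp add: eball_def)
  qed
  have "((\<lambda>u. eval_fps f u / (u - 0) ^ Suc n) has_contour_integral
      (2 * pi * \<i> / fact n * (deriv ^^ n) (eval_fps f) 0)) (circlepath 0 r)"
  proof (rule Cauchy_has_contour_integral_higher_derivative_circlepath)
    show "continuous_on (cball 0 r) (eval_fps f)"
      using continuous_on_subset[OF continuous_on_eval_fps sub] .
    show "eval_fps f holomorphic_on ball 0 r"
      using sub ball_subset_cball by (intro holomorphic_on_eval_fps) blast
  qed (use assms in auto)
  moreover have "fps_conv_radius f > 0" using assms(1) by (rule less_le_trans[rotated]) simp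
  ultimately show ?thesis by (simp add: fps_nth_conv_deriv)
qed

lemma ln_kernel_integral:
  fixes y :: real
  assumes "y > 0"
  shows "((\<lambda>x. 1 / (x + y) + 1 / (1 - x + y)) has_integral (2 * (ln (1 + y) - ln y))) {0..1}"
proof -
  have "((\<lambda>x. 1 / (x + y) + 1 / (1 - x + y)) has_integral
      ((ln (1 + y) - ln (1 - 1 + y)) - (ln (0 + y) - ln (1 - 0 + y)))) {0..1}"
  proof (rule fundamental_theorem_of_calculus)
    fix x :: real assume x: "x \<in> {0..1}"
    have "((\<lambda>x. ln (x + y) - ln (1 - x + y)) has_real_derivative (1 / (x + y) + 1 / (1 - x + y))) (at x within {0..1})"
      using x assms by (auto intro!: derivative_eq_intros simp: field_simps)
    thus "((\<lambda>x. ln (x + y) - ln (1 - x + y)) has_vector_derivative (1 / (x + y) + 1 / (1 - x + y))) (at x within {0..1})"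
      by (simp add: has_real_derivative_iff_has_vector_derivative)
  qed simp
  thus ?thesis by simp
qed

text \<open>The integrals for the single coefficients are added before norms are taken. Estimating
  each coefficient by \<open>N^k\<close> would lose a factor \<open>N\<close>, whereas the kernel
  costs only its integral norm.\<close>

theorem Hecke_partial_sum_bound:
  assumes rad: "fps_conv_radius f \<ge> 1"
    and bound: "\<And>z. Im z > 0 \<Longrightarrow> norm (qser f z) \<le> C / Im z ^ k"
    and N: "N \<ge> 2"
  shows "norm (\<Sum>n=1..N. fps_nth f n) \<le> C * 16 * exp (4 * pi) * real N ^ k * ln (real N)"
proof -
  define y where "y = 1 / real N"
  have y: "y > 0" using N by (simp add: y_def)
  define r where "r = exp (- 2 * pi * y)"
  have r: "0 < r" "r < 1" using y by (simp_all add: r_def)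
  define z where "z = (\<lambda>x. of_real x + \<i> * of_real y :: complex)"
  define g where "g = (\<lambda>x. qser f (z x) * (\<Sum>n=1..N. nome (of_real x + \<i> * of_real (- y)) ^ n) * (2 * pi * \<i>))"
  \<comment> \<open>\<open>1 / q\<close> is the nome of \<open>- x - i y\<close>; translation by 1
    brings the real part back into \<open>[0, 1]\<close>, where the kernel bound applies.\<close>
  have conj: "nome (z x) * nome (of_real (1 - x) + \<i> * of_real (- y)) = 1" for x
  proof -
    have "nome (z x) * nome (of_real (1 - x) + \<i> * of_real (- y)) = nome (0 + of_int 1)"
      unfolding nome_def z_def by (subst exp_add[symmetric]) (simp add: algebra_simps)
    thus ?thesis unfolding nome_periodic by (simp add: nome_def)
  qed
  have cp: "circlepath 0 r x = nome (z x)" for x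
    unfolding circlepath_def part_circlepath_def linepath_def nome_def z_def r_def exp_of_real[symmetric]
    by (simp flip: exp_add) (simp add: algebra_simps)
  have vd: "vector_derivative (circlepath 0 r) (at x) = 2 * pi * \<i> * nome (z x)" for x
    unfolding cp[symmetric] unfolding circlepath_def vector_derivative_part_circlepath by (simp add: part_circlepath_def)
  have "((\<lambda>u. \<Sum>n=1..N. eval_fps f u / u ^ Suc n) has_contour_integral (\<Sum>n=1..N. 2 * pi * \<i> * fps_nth f n)) (circlepath 0 r)"
    by (intro has_contour_integral_sum fps_coeff_contour_integral rad r) auto
  hence int: "((\<lambda>x. (\<Sum>n=1..N. eval_fps f (nome (z x)) / nome (z x) ^ Suc n) * (2 * pi * \<i> * nome (z x))) has_integral
      (2 * pi * \<i> * (\<Sum>n=1..N. fps_nth f n))) {0..1}"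
    unfolding has_contour_integral cp vd by (simp only: sum_distrib_left)
  have norm_le: "norm ((\<Sum>n=1..N. eval_fps f (nome (z x)) / nome (z x) ^ Suc n) * (2 * pi * \<i> * nome (z x)))
      \<le> 2 * pi * C * real N ^ k * (4 * exp (4 * pi)) * (1 / (x + y) + 1 / (1 - x + y))" if x: "x \<in> {0..1}" for x
  proof -
    define q where "q = nome (z x)"
    define w where "w = nome (of_real (1 - x) + \<i> * of_real (- y))"
    have qw: "w = 1 / q" using conj[of x] unfolding q_def w_def by (metis nonzero_eq_divide_eq mult.commute mult_zero_left zero_neq_one)
    have q0: "q \<noteq> 0" by (simp add: q_def nome_def)
    have eq: "(\<Sum>n=1..N. eval_fps f q / q ^ Suc n) * (2 * pi * \<i> * q) = 2 * pi * \<i> * qser f (z x) * (\<Sum>n=1..N. w ^ n)"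
      unfolding qw sum_distrib_left sum_distrib_right qser_def q_def[symmetric]
      by (intro sum.cong) (use q0 in \<open>auto simp: power_one_over field_simps\<close>)
    have "norm ((\<Sum>n=1..N. eval_fps f q / q ^ Suc n) * (2 * pi * \<i> * q)) = 2 * pi * (norm (qser f (z x)) * norm (\<Sum>n=1..N. w ^ n))"
      unfolding eq by (simp add: norm_mult)
    also have "\<dots> \<le> 2 * pi * (C * real N ^ k * (4 * exp (4 * pi) * (1 / ((1 - x) + 1 / real N) + 1 / (1 - (1 - x) + 1 / real N))))"
    proof (intro mult_left_mono mult_mono)
      have "norm (qser f (z x)) \<le> C / y ^ k" using bound[of "z x"] y by (simp add: z_def)
      thus "norm (qser f (z x)) \<le> C * real N ^ k" by (simp add: y_def power_one_over)
      thus "0 \<le> C * real N ^ k" using norm_ge_zero order_trans by blast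
      show "norm (\<Sum>n=1..N. w ^ n) \<le> 4 * exp (4 * pi) * (1 / ((1 - x) + 1 / real N) + 1 / (1 - (1 - x) + 1 / real N))"
        unfolding w_def y_def by (rule Dirichlet_kernel_bound) (use x N in auto)
    qed auto
    finally show ?thesis unfolding q_def y_def by (simp add: algebra_simps)
  qed
  define B where "B = 2 * pi * C * real N ^ k * (4 * exp (4 * pi))"
  have B: "((\<lambda>x. B * (1 / (x + y) + 1 / (1 - x + y))) has_integral B * (2 * (ln (1 + y) - ln y))) {0..1}"
    by (intro has_integral_mult_right ln_kernel_integral y)
  have "norm (2 * pi * \<i> * (\<Sum>n=1..N. fps_nth f n)) \<le> B * (2 * (ln (1 + y) - ln y))"
    unfolding integral_unique[OF int, symmetric] integral_unique[OF B, symmetric]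
    by (rule integral_norm_bound_integral[OF has_integral_integrable[OF int] has_integral_integrable[OF B]])
       (use norm_le in \<open>simp only: B_def\<close>)
  hence "2 * pi * norm (\<Sum>n=1..N. fps_nth f n) \<le> 2 * pi * (C * real N ^ k * (4 * exp (4 * pi)) * (2 * (ln (1 + y) - ln y)))"
    unfolding B_def norm_mult by (simp add: mult_ac)
  hence le: "norm (\<Sum>n=1..N. fps_nth f n) \<le> C * real N ^ k * (4 * exp (4 * pi)) * (2 * (ln (1 + y) - ln y))"
    by (rule mult_left_le_imp_le) simp
  have "ln (1 + y) - ln y = ln (real (N + 1))"
  proof -
    have "ln (1 + y) - ln y = ln ((1 + y) / y)" using y by (simp add: ln_div)
    also have "(1 + y) / y = real (N + 1)" using N by (simp add: y_def field_simps)
    finally show ?thesis .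
  qed
  also have "\<dots> \<le> ln (real N ^ 2)"
  proof -
    have "N + 1 \<le> N * N" using N mult_le_mono1[of 2 N N] by linarith
    hence "real (N + 1) \<le> real (N * N)" by (simp only: of_nat_le_iff)
    thus ?thesis by (simp add: power2_eq_square)
  qed
  also have "\<dots> = 2 * ln (real N)" using N by (simp add: ln_realpow)
  finally have l: "ln (1 + y) - ln y \<le> 2 * ln (real N)" .
  \<comment> \<open>At \<open>z = i\<close> the bound reads \<open>|f(i)| <= C\<close>.\<close>
  have "C \<ge> 0" using bound[of \<i>] order_trans[OF norm_ge_zero] by fastforce
  \<comment> \<open>The constant 16 is 4 from the kernel, 2 from its two symmetric halves and 2 from
    \<open>ln (N + 1) <= 2 ln N\<close>.\<close>
  hence "C * real N ^ k * (4 * exp (4 * pi)) * (2 * (ln (1 + y) - ln y)) \<le> C * real N ^ k * (4 * exp (4 * pi)) * (2 * (2 * ln (real N)))"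
    using l by (intro mult_left_mono) auto
  with le show ?thesis by (simp add: mult_ac)
qed

section \<open>Coefficient sums of the derivatives of Eisenstein series\<close>

lemma power_diff_bounds:
  fixes a b :: real
  assumes "0 \<le> a" "a \<le> b"
  shows "real (Suc m) * a ^ m * (b - a) \<le> b ^ Suc m - a ^ Suc m"
    and "b ^ Suc m - a ^ Suc m \<le> real (Suc m) * b ^ m * (b - a)"
proof -
  have eq: "b ^ Suc m - a ^ Suc m = (b - a) * (\<Sum>p<Suc m. b ^ p * a ^ (m - p))"
    by (rule diff_power_eq_sum)
  have "(\<Sum>p<Suc m. a ^ m) \<le> (\<Sum>p<Suc m. b ^ p * a ^ (m - p))"
  proof (rule sum_mono)
    fix p assume "p \<in> {..<Suc m}"
    hence "a ^ m = a ^ p * a ^ (m - p)" by (simp flip: power_add)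
    also have "\<dots> \<le> b ^ p * a ^ (m - p)" using assms by (intro mult_right_mono power_mono) auto
    finally show "a ^ m \<le> b ^ p * a ^ (m - p)" .
  qed
  hence "real (Suc m) * a ^ m \<le> (\<Sum>p<Suc m. b ^ p * a ^ (m - p))" by simp
  from mult_left_mono[OF this, of "b - a"] assms
  show "real (Suc m) * a ^ m * (b - a) \<le> b ^ Suc m - a ^ Suc m"
    unfolding eq by (simp add: mult_ac)
  have "(\<Sum>p<Suc m. b ^ p * a ^ (m - p)) \<le> (\<Sum>p<Suc m. b ^ m)"
  proof (rule sum_mono)
    fix p assume "p \<in> {..<Suc m}"
    hence "b ^ m = b ^ p * b ^ (m - p)" by (simp flip: power_add)
    moreover have "b ^ p * a ^ (m - p) \<le> b ^ p * b ^ (m - p)" using assms by (intro mult_left_mono power_mono) auto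
    ultimately show "b ^ p * a ^ (m - p) \<le> b ^ m" by simp
  qed
  hence "(\<Sum>p<Suc m. b ^ p * a ^ (m - p)) \<le> real (Suc m) * b ^ m" by simp
  from mult_left_mono[OF this, of "b - a"] assms
  show "b ^ Suc m - a ^ Suc m \<le> real (Suc m) * b ^ m * (b - a)"
    unfolding eq by (simp add: mult_ac)
qed

lemma power_sum_bounds:
  assumes "m > 0"
  shows "real n ^ Suc m \<le> real (Suc m) * (\<Sum>d=1..n. real d ^ m)"
    and "real (Suc m) * (\<Sum>d=1..n. real d ^ m) \<le> real n ^ Suc m + real (Suc m) * real n ^ m"
proof -
  have "real n ^ Suc m \<le> real (Suc m) * (\<Sum>d=1..n. real d ^ m) \<and>
     real (Suc m) * (\<Sum>d=1..n. real d ^ m) \<le> real n ^ Suc m + real (Suc m) * real n ^ m"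
  proof (induction n)
    case 0
    thus ?case using assms by simp
  next
    case (Suc n)
    have "real (Suc m) * (\<Sum>d=1..Suc n. real d ^ m) = real (Suc m) * (\<Sum>d=1..n. real d ^ m) + real (Suc m) * real (Suc n) ^ m"
      by (simp add: distrib_left)
    moreover have "real (Suc m) * real n ^ m \<le> real (Suc n) ^ Suc m - real n ^ Suc m"
      "real (Suc n) ^ Suc m - real n ^ Suc m \<le> real (Suc m) * real (Suc n) ^ m"
      using power_diff_bounds[of "real n" "real (Suc n)" m] by simp_all
    ultimately show ?case using Suc by linarith
  qed
  thus "real n ^ Suc m \<le> real (Suc m) * (\<Sum>d=1..n. real d ^ m)"
    and "real (Suc m) * (\<Sum>d=1..n. real d ^ m) \<le> real n ^ Suc m + real (Suc m) * real n ^ m" by auto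
qed

text \<open>The real variable \<open>u\<close> is kept because the application has
  \<open>u = N / e\<close> with integer part \<open>n = N div e\<close>.\<close>

lemma power_sum_asymptotic:
  assumes "m > 0" "real n \<le> u" "u \<le> real n + 1"
  shows "\<bar>(\<Sum>d=1..n. real d ^ m) - u ^ Suc m / real (Suc m)\<bar> \<le> u ^ m"
proof -
  define P where "P = (\<Sum>d=1..n. real d ^ m)"
  have b: "u ^ Suc m - real n ^ Suc m \<le> real (Suc m) * u ^ m * (u - real n)"
    "real (Suc m) * real n ^ m * (u - real n) \<le> u ^ Suc m - real n ^ Suc m"
    using power_diff_bounds[of "real n" u m] assms by auto
  have um: "u ^ m \<ge> 0" using assms by simp
  have "real (Suc m) * u ^ m * (u - real n) \<le> real (Suc m) * u ^ m * 1"
    using assms um by (intro mult_left_mono) auto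
  hence 1: "u ^ Suc m - real (Suc m) * u ^ m \<le> real (Suc m) * P"
    using b power_sum_bounds(1)[OF assms(1), of n] unfolding P_def by linarith
  have "0 \<le> real (Suc m) * real n ^ m * (u - real n)" using assms by simp
  moreover have "real (Suc m) * real n ^ m \<le> real (Suc m) * u ^ m"
    using assms by (intro mult_left_mono power_mono) auto
  ultimately have 2: "real (Suc m) * P \<le> u ^ Suc m + real (Suc m) * u ^ m"
    using b power_sum_bounds(2)[OF assms(1), of n] unfolding P_def by linarith
  have "\<bar>real (Suc m) * P - u ^ Suc m\<bar> \<le> real (Suc m) * u ^ m" using 1 2 by linarith
  moreover have "real (Suc m) * P - u ^ Suc m = real (Suc m) * (P - u ^ Suc m / real (Suc m))"
    by (simp add: right_diff_distrib)
  ultimately have "real (Suc m) * \<bar>P - u ^ Suc m / real (Suc m)\<bar> \<le> real (Suc m) * u ^ m"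
    by (simp only: abs_mult abs_of_nat)
  thus ?thesis unfolding P_def by (rule mult_left_le_imp_le) simp
qed

text \<open>Regrouping by \<open>n = e d\<close> moves the large exponent onto the inner sum:
  \<open>n^t d^s = e^t d^(t+s)\<close>.\<close>

lemma divisor_sigma_sum:
  "(\<Sum>n=1..N. real n ^ t * real (divisor_sigma s n)) = (\<Sum>e=1..N. real e ^ t * (\<Sum>d=1..N div e. real d ^ (t + s)))"
proof -
  have "(\<Sum>n=1..N. real n ^ t * real (divisor_sigma s n)) = (\<Sum>n=1..N. \<Sum>d | d dvd n. real n ^ t * real d ^ s)"
    by (simp add: divisor_sigma_def sum_distrib_left)
  also have "\<dots> = (\<Sum>(n, d)\<in>Sigma {1..N} (\<lambda>n. {d. d dvd n}). real n ^ t * real d ^ s)"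
    by (rule sum.Sigma) auto
  also have "\<dots> = (\<Sum>(e, d)\<in>Sigma {1..N} (\<lambda>e. {1..N div e}). real e ^ t * real d ^ (t + s))"
  proof (rule sum.reindex_bij_witness[of _ "\<lambda>(e, d). (e * d, d)" "\<lambda>(n, d). (n div d, d)"])
    fix x assume "x \<in> Sigma {1..N} (\<lambda>n. {d. d dvd n})"
    then obtain e d where x: "x = (d * e, d)" "d * e > 0" "d * e \<le> N" by (auto elim!: dvdE)
    hence de: "d > 0" "e > 0" by auto
    show "(case (case x of (n, d) \<Rightarrow> (n div d, d)) of (e, d) \<Rightarrow> (e * d, d)) = x"
      using x de by (simp add: mult.commute)
    have "d \<le> N div e" using x(3) de by (simp add: less_eq_div_iff_mult_less_eq)
    moreover have "1 * e \<le> d * e" using de by (intro mult_le_mono1) auto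
    hence "e \<le> N" using x(3) unfolding mult_1 by (rule le_trans)
    ultimately show "(case x of (n, d) \<Rightarrow> (n div d, d)) \<in> Sigma {1..N} (\<lambda>e. {1..N div e})"
      using x de by auto
    show "(case (case x of (n, d) \<Rightarrow> (n div d, d)) of (e, d) \<Rightarrow> real e ^ t * real d ^ (t + s)) = (case x of (n, d) \<Rightarrow> real n ^ t * real d ^ s)"
      using x de by (simp add: power_mult_distrib power_add mult_ac)
  next
    fix x assume "x \<in> Sigma {1..N} (\<lambda>e. {1..N div e})"
    then obtain e d where x: "x = (e, d)" "e > 0" "e \<le> N" "d > 0" "d \<le> N div e" by auto
    show "(case (case x of (e, d) \<Rightarrow> (e * d, d)) of (n, d) \<Rightarrow> (n div d, d)) = x" using x by simp
    have "e * d \<le> N" using x by (simp add: less_eq_div_iff_mult_less_eq mult.commute)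
    thus "(case x of (e, d) \<Rightarrow> (e * d, d)) \<in> Sigma {1..N} (\<lambda>n. {d. d dvd n})" using x by auto
  qed
  also have "\<dots> = (\<Sum>e=1..N. \<Sum>d=1..N div e. real e ^ t * real d ^ (t + s))"
    by (rule sum.Sigma[symmetric]) auto
  finally show ?thesis by (simp only: sum_distrib_left)
qed

text \<open>The tail is dominated by the telescoping series of
  \<open>1 / x - 1 / (x + 1)\<close>.\<close>

lemma zeta_even_tail:
  assumes "l > 0" "N > 0"
  shows "\<bar>zeta_even l - (\<Sum>e=1..N. 1 / real e ^ (2 * l))\<bar> \<le> 1 / real N"
proof -
  define h where "h = (\<lambda>n. 1 / real (Suc n) ^ (2 * l))"
  have h: "h sums zeta_even l" unfolding h_def by (rule zeta_even_sums[OF assms(1)])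
  have part: "(\<Sum>e=1..N. 1 / real e ^ (2 * l)) = (\<Sum>n<N. h n)"
    unfolding h_def by (rule sum.reindex_bij_witness[of _ Suc "\<lambda>e. e - 1"]) auto
  have tail: "(\<lambda>n. h (n + N)) sums (zeta_even l - (\<Sum>n<N. h n))"
    using h by (simp add: sums_iff_shift)
  have "(\<lambda>n. 1 / real (n + N)) \<longlonglongrightarrow> 0"
    using LIMSEQ_ignore_initial_segment[OF lim_1_over_n] by simp
  hence tel: "(\<lambda>n. 1 / real (n + N) - 1 / real (Suc n + N)) sums (1 / real (0 + N) - 0)"
    by (rule telescope_sums')
  have le: "h (n + N) \<le> 1 / real (n + N) - 1 / real (Suc n + N)" for n
  proof -
    define x where "x = real (n + N)"
    have x: "x > 0" using assms by (simp add: x_def)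
    have "(x + 1) ^ 2 \<le> (x + 1) ^ (2 * l)" using assms x by (intro power_increasing) auto
    hence "1 / (x + 1) ^ (2 * l) \<le> 1 / (x + 1) ^ 2" using x by (intro divide_left_mono mult_pos_pos) auto
    also have "\<dots> \<le> 1 / x - 1 / (x + 1)" using x by (simp add: divide_simps power2_eq_square)
    finally show ?thesis by (simp add: h_def x_def add_ac)
  qed
  have "zeta_even l - (\<Sum>n<N. h n) \<le> 1 / real (0 + N) - 0"
    by (rule sums_le[OF le tail tel])
  moreover have "0 \<le> zeta_even l - (\<Sum>n<N. h n)"
    using suminf_nonneg[of "\<lambda>n. h (n + N)"] tail by (simp add: sums_iff h_def)
  ultimately show ?thesis unfolding part by simp
qed

text \<open>The inner power sums give \<open>N^(m+1) / (m + 1)\<close> times a truncated zeta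
  series. Completing that series costs \<open>N^m\<close>, and the errors of the inner sums add up
  to at most \<open>N^m\<close> times a harmonic sum.\<close>

theorem divisor_sum_asymptotic:
  assumes l: "l > 0" and N: "N \<ge> 2"
  shows "\<bar>(\<Sum>n=1..N. real n ^ t * real (divisor_sigma (2 * l - 1) n)) - zeta_even l * real N ^ (t + 2 * l) / real (t + 2 * l)\<bar>
     \<le> 4 * real N ^ (t + 2 * l - 1) * ln (real N)"
proof -
  define s where "s = 2 * l - 1"
  define m where "m = t + s"
  define A where "A = (\<Sum>e=1..N. 1 / real e ^ (2 * l))"
  have s: "s > 0" "Suc s = 2 * l" "m > 0" "Suc m = t + 2 * l" using l by (auto simp: s_def m_def)
  define x where "x = real N"
  have x: "x > 0" using N by (simp add: x_def)
  have main: "(\<Sum>e=1..N. real e ^ t * ((x / real e) ^ Suc m / real (Suc m))) = x ^ Suc m / real (Suc m) * A"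
    unfolding A_def sum_distrib_left
  proof (intro sum.cong refl)
    fix e assume "e \<in> {1..N}"
    hence e: "real e \<noteq> 0" by simp
    have "real e ^ Suc m = real e ^ t * real e ^ (2 * l)" unfolding s(4) by (rule power_add)
    thus "real e ^ t * ((x / real e) ^ Suc m / real (Suc m)) = x ^ Suc m / real (Suc m) * (1 / real e ^ (2 * l))"
      unfolding power_divide using e by simp
  qed
  have err: "\<bar>real e ^ t * (\<Sum>d=1..N div e. real d ^ m) - real e ^ t * ((x / real e) ^ Suc m / real (Suc m))\<bar> \<le> x ^ m * inverse (real e)"
    if "e \<in> {1..N}" for e
  proof -
    have e: "real e \<ge> 1" using that by simp
    have "real_of_int \<lfloor>x / real e\<rfloor> = real (N div e)"
      unfolding x_def floor_divide_of_nat_eq by simp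
    hence "real (N div e) \<le> x / real e" "x / real e \<le> real (N div e) + 1"
      using of_int_floor_le[of "x / real e"] real_of_int_floor_add_one_ge[of "x / real e"] by simp_all
    hence "\<bar>(\<Sum>d=1..N div e. real d ^ m) - (x / real e) ^ Suc m / real (Suc m)\<bar> \<le> (x / real e) ^ m"
      by (rule power_sum_asymptotic[OF s(3)])
    hence "real e ^ t * \<bar>(\<Sum>d=1..N div e. real d ^ m) - (x / real e) ^ Suc m / real (Suc m)\<bar> \<le> real e ^ t * (x / real e) ^ m"
      by (rule mult_left_mono) simp
    also have "real e ^ t * (x / real e) ^ m = x ^ m * inverse (real e ^ s)"
      using e by (simp add: m_def power_divide power_add inverse_eq_divide)
    \<comment> \<open>Only for \<open>s = 1\<close>, that is \<open>l = 1\<close>, is this an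
      equality for all \<open>e\<close>; the logarithm stems from that case.\<close>
    also have "real e ^ 1 \<le> real e ^ s" using e s by (intro power_increasing) auto
    hence "x ^ m * inverse (real e ^ s) \<le> x ^ m * inverse (real e)"
      using e x by (intro mult_left_mono le_imp_inverse_le) auto
    finally show ?thesis by (simp only: right_diff_distrib[symmetric] abs_mult) simp
  qed
  have "\<bar>(\<Sum>e=1..N. real e ^ t * (\<Sum>d=1..N div e. real d ^ m)) - x ^ Suc m / real (Suc m) * A\<bar>
     \<le> (\<Sum>e=1..N. x ^ m * inverse (real e))"
    unfolding main[symmetric] sum_subtractf[symmetric] by (rule order_trans[OF sum_abs sum_mono[OF err]])
  also have "\<dots> = x ^ m * harm N" by (simp add: harm_def sum_distrib_left)
  also have "\<dots> \<le> x ^ m * (1 + ln x)"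
  proof -
    have "harm (Suc (N - 1)) - ln (Suc (N - 1)) \<le> harm (Suc 0) - ln (Suc 0)"
      using decseq_harm_diff_ln unfolding decseq_def by (metis le0)
    hence "harm N \<le> 1 + ln x" using N by (simp add: harm_def x_def)
    thus ?thesis using x by (intro mult_left_mono) auto
  qed
  finally have 1: "\<bar>(\<Sum>e=1..N. real e ^ t * (\<Sum>d=1..N div e. real d ^ m)) - x ^ Suc m / real (Suc m) * A\<bar> \<le> x ^ m * (1 + ln x)" .
  have "\<bar>x ^ Suc m / real (Suc m) * A - zeta_even l * x ^ Suc m / real (Suc m)\<bar> = x ^ Suc m / real (Suc m) * \<bar>zeta_even l - A\<bar>"
  proof -
    have "x ^ Suc m / real (Suc m) * A - zeta_even l * x ^ Suc m / real (Suc m) = - (x ^ Suc m / real (Suc m)) * (zeta_even l - A)"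
      by (simp add: right_diff_distrib)
    thus ?thesis using x by (simp add: abs_mult)
  qed
  also have "\<dots> \<le> x ^ Suc m / real (Suc m) * (1 / x)"
    unfolding A_def x_def using zeta_even_tail[OF l, of N] N by (intro mult_left_mono) auto
  also have "\<dots> = x ^ m / real (Suc m)" using x by simp
  also have "\<dots> \<le> x ^ m / 1" using x by (intro divide_left_mono) auto
  finally have 2: "\<bar>x ^ Suc m / real (Suc m) * A - zeta_even l * x ^ Suc m / real (Suc m)\<bar> \<le> x ^ m" by simp
  have tri: "\<bar>a - c\<bar> \<le> p + q" if "\<bar>a - b\<bar> \<le> p" "\<bar>b - c\<bar> \<le> q" for a b c p q :: real
    using that by linarith
  have "ln 2 \<le> ln x" using N x by (simp add: x_def)
  \<comment> \<open>Exactly what turns \<open>2 + ln x\<close> into \<open>4 * ln x\<close>.\<close>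
  hence lnx: "2 / 3 \<le> ln x" using ln2_ge_two_thirds by linarith
  have "\<bar>(\<Sum>e=1..N. real e ^ t * (\<Sum>d=1..N div e. real d ^ m)) - zeta_even l * x ^ Suc m / real (Suc m)\<bar> \<le> x ^ m * (1 + ln x) + x ^ m"
    by (rule tri[OF 1 2])
  also have "\<dots> = x ^ m * (2 + ln x)" by (simp add: distrib_left)
  also have "\<dots> \<le> x ^ m * (4 * ln x)" using lnx x by (intro mult_left_mono) auto
  finally show ?thesis
    unfolding divisor_sigma_sum s_def[symmetric] m_def[symmetric] x_def[symmetric] s(4)[symmetric]
    by (simp only: diff_Suc_1 mult_ac)
qed

subsection \<open>The growth polynomial and the main estimate\<close>

lemma of_real_of_rat: "complex_of_real (of_rat x) = of_rat x"
  by (cases x) (simp add: of_rat_rat)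

text \<open>The coefficient of \<open>h^(- k - l)\<close> in the growth polynomial of a form of
  weight \<open>2 k\<close>.\<close>

definition growth_coeff :: "quasimodular \<Rightarrow> nat \<Rightarrow> real" where
  "growth_coeff F l = of_rat (coeff (Ev F) l) * (- 4 * pi\<^sup>2) ^ l"

text \<open>By homogeneity \<open>2 b + 3 c = k - a\<close>, so the product is
  \<open>(X + 12)^a X^(k - a)\<close>; counted down from degree \<open>k\<close>, its coefficients
  depend on \<open>a\<close> alone.\<close>

lemma coeff_Ev_monomial:
  fixes a b c k l :: nat
  assumes "a + 2 * b + 3 * c = k" "l \<le> k"
  shows "coeff ([:12, 1:] ^ a * ([:0, 1:] ^ 2) ^ b * ([:0, 1:] ^ 3) ^ c :: rat poly) l = of_nat (a choose (k - l)) * 12 ^ (k - l)"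
proof -
  have X: "([:0, 1:] ^ 2) ^ b * ([:0, 1:] ^ 3) ^ c = (monom 1 (2 * b + 3 * c) :: rat poly)"
    by (simp add: monom_altdef power_mult power_add)
  have "coeff ([:12, 1:] ^ a * monom 1 (2 * b + 3 * c) :: rat poly) l =
     (if l < 2 * b + 3 * c then 0 else coeff ([:12, 1:] ^ a) (l - (2 * b + 3 * c)))"
    by (subst mult.commute) (simp add: coeff_monom_mult not_less)
  also have "\<dots> = of_nat (a choose (k - l)) * 12 ^ (k - l)"
  proof (cases "l < 2 * b + 3 * c")
    case True
    thus ?thesis using assms by (simp add: binomial_eq_0)
  next
    case False
    define i where "i = l - (2 * b + 3 * c)"
    have i: "i \<le> a" "k - l = a - i" using False assms by (auto simp: i_def)
    have "coeff ([:12, 1:] ^ a :: rat poly) i = of_nat (a choose i) * 12 ^ (a - i)"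
      using i(1) by (simp add: coeff_linear_poly_power)
    thus ?thesis using False i binomial_symmetric[OF i(1)] by (simp add: i_def)
  qed
  finally show ?thesis unfolding mult.assoc X .
qed

lemma coeff_Ev:
  assumes "homogeneous (2 * k) F" "l \<le> k"
  shows "coeff (Ev F) l = (\<Sum>(a, b, c)\<in>Poly_Mapping.keys F. Poly_Mapping.lookup F (a, b, c) * (of_nat (a choose (k - l)) * 12 ^ (k - l)))"
proof -
  have "coeff (Ev F) l = (\<Sum>e\<in>Poly_Mapping.keys F. coeff (case e of (a, b, c) \<Rightarrow>
      [:Poly_Mapping.lookup F (a, b, c):] * ([:12, 1:] ^ a * ([:0, 1:] ^ 2) ^ b * ([:0, 1:] ^ 3) ^ c)) l)"
    unfolding Ev_def substitute_def by (rule coeff_sum)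
  also have "\<dots> = (\<Sum>(a, b, c)\<in>Poly_Mapping.keys F. Poly_Mapping.lookup F (a, b, c) * (of_nat (a choose (k - l)) * 12 ^ (k - l)))"
  proof (intro sum.cong refl)
    fix e assume e: "e \<in> Poly_Mapping.keys F"
    obtain a b c where abc: "e = (a, b, c)" by (cases e)
    have "a + 2 * b + 3 * c = k" using assms e abc unfolding homogeneous_def by auto
    from coeff_Ev_monomial[OF this assms(2)]
    show "coeff (case e of (a, b, c) \<Rightarrow> [:Poly_Mapping.lookup F (a, b, c):] * ([:12, 1:] ^ a * ([:0, 1:] ^ 2) ^ b * ([:0, 1:] ^ 3) ^ c)) l
       = (case e of (a, b, c) \<Rightarrow> Poly_Mapping.lookup F (a, b, c) * (of_nat (a choose (k - l)) * 12 ^ (k - l)))"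
      unfolding abc prod.case by simp
  qed
  finally show ?thesis .
qed

lemma degree_Ev:
  assumes "homogeneous (2 * k) F"
  shows "degree (Ev F) \<le> k"
  unfolding Ev_def substitute_def
proof (rule degree_sum_le)
  fix e assume e: "e \<in> Poly_Mapping.keys F"
  obtain a b c where abc: "e = (a, b, c)" by (cases e)
  have k: "a + 2 * b + 3 * c = k" using assms e abc unfolding homogeneous_def by auto
  have X: "([:0, 1:] ^ 2) ^ b * ([:0, 1:] ^ 3) ^ c = (monom 1 (2 * b + 3 * c) :: rat poly)"
    by (simp add: monom_altdef power_mult power_add)
  have "degree ([:r:] * ([:12, 1:] ^ a * monom 1 (2 * b + 3 * c)) :: rat poly) \<le> degree ([:12, 1:] ^ a * monom 1 (2 * b + 3 * c) :: rat poly)" for r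
    by (simp add: degree_smult_le)
  also have "degree ([:12, 1:] ^ a * monom 1 (2 * b + 3 * c) :: rat poly) \<le> degree ([:12, 1:] ^ a :: rat poly) + degree (monom 1 (2 * b + 3 * c) :: rat poly)"
    by (rule degree_mult_le)
  also have "\<dots> \<le> k" using k by (simp add: degree_linear_power degree_monom_eq)
  finally show "degree (case e of (a, b, c) \<Rightarrow> [:Poly_Mapping.lookup F (a, b, c):] * ([:12, 1:] ^ a * ([:0, 1:] ^ 2) ^ b * ([:0, 1:] ^ 3) ^ c)) \<le> k"
    unfolding abc prod.case mult.assoc X .
qed simp

lemma growth_eq_sum:
  assumes "homogeneous (2 * k) F" "h \<noteq> 0"
  shows "growth k F h = (\<Sum>l\<le>k. growth_coeff F l * inverse h ^ (k + l))"
proof -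
  let ?p = "map_poly of_rat (Ev F) :: real poly"
  have c: "coeff ?p l = of_rat (coeff (Ev F) l)" for l by (simp add: coeff_map_poly)
  have deg: "degree ?p \<le> k"
    by (rule degree_le) (use degree_Ev[OF assms(1)] in \<open>auto simp: c coeff_eq_0\<close>)
  have "poly ?p x = (\<Sum>l\<le>k. coeff ?p l * x ^ l)" for x
    unfolding poly_altdef by (rule sum.mono_neutral_left) (use deg in \<open>auto simp: coeff_eq_0\<close>)
  hence "growth k F h = (\<Sum>l\<le>k. of_rat (coeff (Ev F) l) * (- 4 * pi\<^sup>2 / h) ^ l) / h ^ k"
    unfolding growth_def by (simp only: c)
  also have "\<dots> = (\<Sum>l\<le>k. growth_coeff F l * inverse h ^ (k + l))"
    unfolding sum_divide_distrib
  proof (intro sum.cong refl)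
    fix l
    have "(- 4 * pi\<^sup>2 / h) ^ l = (- 4 * pi\<^sup>2) ^ l * inverse h ^ l"
      unfolding divide_inverse by (rule power_mult_distrib)
    thus "of_rat (coeff (Ev F) l) * (- 4 * pi\<^sup>2 / h) ^ l / h ^ k = growth_coeff F l * inverse h ^ (k + l)"
      by (simp only: growth_coeff_def power_add power_inverse divide_inverse mult_ac)
  qed
  finally show ?thesis .
qed

text \<open>The missing monomial \<open>E\<^sub>2\<^bsup>k-1\<^esup>\<close> times a form of weight 2 is what forces this relation.\<close>

lemma Ev_coeff_relation:
  assumes "homogeneous (2 * k) F" "k > 0"
  shows "of_nat k * coeff (Ev F) 0 = 12 * coeff (Ev F) 1"
proof -
  have "of_nat k * coeff (Ev F) 0 = (\<Sum>(a, b, c)\<in>Poly_Mapping.keys F. of_nat k * (Poly_Mapping.lookup F (a, b, c) * (of_nat (a choose k) * 12 ^ k)))"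
    using coeff_Ev[OF assms(1), of 0] by (simp add: sum_distrib_left case_prod_unfold)
  also have "\<dots> = (\<Sum>(a, b, c)\<in>Poly_Mapping.keys F. 12 * (Poly_Mapping.lookup F (a, b, c) * (of_nat (a choose (k - 1)) * 12 ^ (k - 1))))"
  proof (intro sum.cong refl)
    fix e assume e: "e \<in> Poly_Mapping.keys F"
    obtain a b c where abc: "e = (a, b, c)" by (cases e)
    have k: "a + 2 * b + 3 * c = k" using assms e abc unfolding homogeneous_def by auto
    have "of_nat k * (of_nat (a choose k) * 12 ^ k) = (12 * (of_nat (a choose (k - 1)) * 12 ^ (k - 1)) :: rat)"
    proof (cases "a = k")
      case True
      obtain k' where "k = Suc k'" using assms(2) by (cases k) auto
      thus ?thesis using True by (simp add: mult_ac)
    next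
      case False
      \<comment> \<open>\<open>a = k - 1\<close> would require \<open>2 b + 3 c = 1\<close>.\<close>
      hence "a < k - 1" using k by presburger
      thus ?thesis by (simp add: binomial_eq_0)
    qed
    thus "(case e of (a, b, c) \<Rightarrow> of_nat k * (Poly_Mapping.lookup F (a, b, c) * (of_nat (a choose k) * 12 ^ k))) =
       (case e of (a, b, c) \<Rightarrow> 12 * (Poly_Mapping.lookup F (a, b, c) * (of_nat (a choose (k - 1)) * 12 ^ (k - 1))))"
      unfolding abc prod.case by (metis mult.left_commute)
  qed
  also have "\<dots> = 12 * coeff (Ev F) 1"
    using coeff_Ev[OF assms(1), of 1] assms(2) by (simp add: sum_distrib_left case_prod_unfold)
  finally show ?thesis .
qed

text \<open>With \<open>g = - 2 pi i\<close> and \<open>u = 6 i / pi\<close> one has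
  \<open>u g = 12\<close> and \<open>g^2 = - 4 pi^2\<close>. Hence
  \<open>12^(k-l) (- 4 pi^2)^l = u^(k-l) g^(k+l)\<close>, and both sides carry the same binomial
  coefficients.\<close>

lemma coeff_principal_poly:
  assumes "homogeneous (2 * k) F" "l \<le> k"
  shows "coeff (principal_poly F) (k - l) = of_real (growth_coeff F l) / (- 2 * of_real pi * \<i>) ^ (k + l)"
proof -
  define g :: complex where "g = - 2 * of_real pi * \<i>"
  define u :: complex where "u = 6 * \<i> / of_real pi"
  have g0: "g \<noteq> 0" by (simp add: g_def)
  have gu: "u * g = 12" by (simp add: g_def u_def)
  have g2: "g ^ 2 = of_real (- 4 * pi\<^sup>2)" by (simp add: g_def power_mult_distrib)
  have "12 ^ (k - l) * of_real ((- 4 * pi\<^sup>2) ^ l) = u ^ (k - l) * g ^ (k + l)"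
  proof -
    have "12 ^ (k - l) * of_real ((- 4 * pi\<^sup>2) ^ l) = (u * g) ^ (k - l) * (g ^ 2) ^ l"
      unfolding gu g2 by simp
    also have "\<dots> = u ^ (k - l) * (g ^ (k - l) * g ^ (2 * l))" by (simp only: power_mult_distrib power_mult mult.assoc)
    also have "g ^ (k - l) * g ^ (2 * l) = g ^ (k + l)" using assms(2) by (simp add: add.commute flip: power_add)
    finally show ?thesis .
  qed
  hence key: "12 ^ (k - l) * of_real ((- 4 * pi\<^sup>2) ^ l) / g ^ (k + l) = u ^ (k - l)" using g0 by simp
  have "coeff (principal_poly F) (k - l) = (\<Sum>(a, b, c)\<in>Poly_Mapping.keys F. of_rat (Poly_Mapping.lookup F (a, b, c)) * (of_nat (a choose (k - l)) * u ^ (k - l)))"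
    unfolding principal_poly_def coeff_sum u_def[symmetric]
  proof (intro sum.cong refl)
    fix e assume e: "e \<in> Poly_Mapping.keys F"
    obtain a b c where abc: "e = (a, b, c)" by (cases e)
    have "coeff ([:1, u:] ^ a) (k - l) = of_nat (a choose (k - l)) * u ^ (k - l)"
    proof (cases "k - l \<le> a")
      case False
      have "degree ([:1, u:] ^ a) \<le> degree [:1, u:] * a" by (rule degree_power_le)
      also have "\<dots> \<le> a" by simp
      finally show ?thesis using False by (simp add: coeff_eq_0 binomial_eq_0)
    qed (simp add: coeff_linear_poly_power)
    thus "coeff (case e of (a, b, c) \<Rightarrow> smult (of_rat (Poly_Mapping.lookup F (a, b, c))) ([:1, u:] ^ a)) (k - l) =
      (case e of (a, b, c) \<Rightarrow> of_rat (Poly_Mapping.lookup F (a, b, c)) * (of_nat (a choose (k - l)) * u ^ (k - l)))"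
      unfolding abc prod.case by simp
  qed
  also have "\<dots> = of_rat (coeff (Ev F) l) * (of_real ((- 4 * pi\<^sup>2) ^ l) / g ^ (k + l))"
    unfolding coeff_Ev[OF assms] of_rat_sum sum_distrib_right key[symmetric]
    by (intro sum.cong) (auto simp: of_rat_mult of_rat_power)
  also have "\<dots> = of_real (growth_coeff F l) / g ^ (k + l)"
    by (simp add: growth_coeff_def of_real_of_rat)
  finally show ?thesis unfolding g_def .
qed

text \<open>Numerator and denominator both carry \<open>(- 2 pi i)^(- k - l)\<close>, so the
  coordinate is real.\<close>

lemma eis_coordinate_eq:
  assumes "homogeneous (2 * k) F" "1 \<le> l" "l \<le> k"
  shows "eis_coordinate k F l = of_real (growth_coeff F l / (zeta_even l * fact (k + l - 1)))"
proof -
  define g :: complex where "g = - 2 * of_real pi * \<i>"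
  have g0: "g \<noteq> 0" by (simp add: g_def)
  have e: "(2 * of_real pi * \<i>) ^ (2 * l) = g ^ (2 * l)" "2 * l + (k - l) - 1 = k + l - 1" "- 2 * of_real pi * \<i> = g"
    using assms by (simp_all add: g_def power_mult power_mult_distrib)
  have "g ^ (k + l) = g ^ (2 * l) * g ^ (k - l)" using assms by (simp add: add.commute flip: power_add)
  hence "eis_principal l (k - l) = of_real (zeta_even l) * fact (k + l - 1) / g ^ (k + l)"
    unfolding eis_principal_def e by simp
  moreover have "coeff (principal_poly F) (k - l) = of_real (growth_coeff F l) / g ^ (k + l)"
    unfolding g_def by (rule coeff_principal_poly[OF assms(1,3)])
  ultimately show ?thesis unfolding eis_coordinate_def using g0 by (simp add: add.commute)
qed

lemma fourier_coeff_eq: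
  assumes "homogeneous (2 * k) F" "n > 0"
  shows "of_rat (fourier_coeff F n) = fps_nth (cuspidal_part k F) n +
     of_real (\<Sum>l=1..k. growth_coeff F l / (zeta_even l * fact (k + l - 1)) * (real n ^ (k - l) * real (divisor_sigma (2 * l - 1) n)))"
proof -
  have "of_rat (fourier_coeff F n) = fps_nth (cuspidal_part k F) n + (\<Sum>l=1..k. eis_coordinate k F l * fps_nth ((fps_XD ^^ (k - l)) (eis_fps l)) n)"
    by (simp add: cuspidal_part_def fourier_coeff_def fps_sum_nth)
  also have "(\<Sum>l=1..k. eis_coordinate k F l * fps_nth ((fps_XD ^^ (k - l)) (eis_fps l)) n) =
     (\<Sum>l=1..k. of_real (growth_coeff F l / (zeta_even l * fact (k + l - 1)) * (real n ^ (k - l) * real (divisor_sigma (2 * l - 1) n))))"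
  proof (intro sum.cong refl)
    fix l assume "l \<in> {1..k}"
    hence l: "1 \<le> l" "l \<le> k" by auto
    have "fps_nth ((fps_XD ^^ (k - l)) (eis_fps l)) n = of_real (real n ^ (k - l) * real (divisor_sigma (2 * l - 1) n))"
      using assms(2) by (simp add: fps_mult_fps_XD_shift eis_fps_def sigma_fps_def)
    thus "eis_coordinate k F l * fps_nth ((fps_XD ^^ (k - l)) (eis_fps l)) n =
      of_real (growth_coeff F l / (zeta_even l * fact (k + l - 1)) * (real n ^ (k - l) * real (divisor_sigma (2 * l - 1) n)))"
      unfolding eis_coordinate_eq[OF assms(1) l] by (simp only: of_real_mult)
  qed
  finally show ?thesis by (simp only: of_real_sum)
qed

text \<open>The divisor sums contribute \<open>zeta (2 l) / (k + l)\<close>, which cancels the zeta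
  value in the coordinate and completes \<open>(k + l - 1)!\<close> to \<open>(k + l)!\<close>. All
  main terms are kept here; the leading one is selected afterwards.\<close>

theorem fourier_coeff_sum_bound:
  assumes F: "homogeneous (2 * k) F" and k: "k > 0"
  obtains C where "\<And>N. N \<ge> 2 \<Longrightarrow> \<bar>(\<Sum>n=1..N. real_of_rat (fourier_coeff F n)) - (\<Sum>l=1..k. growth_coeff F l * real N ^ (k + l) / fact (k + l))\<bar>
     \<le> (C * real N ^ k + (\<Sum>l=1..k. \<bar>growth_coeff F l\<bar> * (4 / zeta_even l) * real N ^ (k + l - 1))) * ln (real N)"
proof -
  obtain C where C: "C \<ge> 0" "\<And>z. Im z > 0 \<Longrightarrow> norm (qser (cuspidal_part k F) z) \<le> C / Im z ^ k"
    using cuspidal_part_bound[OF F k] by blast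
  define \<alpha> where "\<alpha> = (\<lambda>l. growth_coeff F l / (zeta_even l * fact (k + l - 1)))"
  define D where "D = (\<lambda>l N. \<Sum>n=1..N. real n ^ (k - l) * real (divisor_sigma (2 * l - 1) n))"
  have bound: "\<bar>(\<Sum>n=1..N. real_of_rat (fourier_coeff F n)) - (\<Sum>l=1..k. growth_coeff F l * real N ^ (k + l) / fact (k + l))\<bar>
     \<le> (C * 16 * exp (4 * pi) * real N ^ k + (\<Sum>l=1..k. \<bar>growth_coeff F l\<bar> * (4 / zeta_even l) * real N ^ (k + l - 1))) * ln (real N)"
    if N: "N \<ge> 2" for N
  proof -
    have "(of_real (\<Sum>n=1..N. real_of_rat (fourier_coeff F n)) :: complex) = (\<Sum>n=1..N. of_rat (fourier_coeff F n))"
      by (simp only: of_real_sum of_real_of_rat)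
    also have "\<dots> = (\<Sum>n=1..N. fps_nth (cuspidal_part k F) n + of_real (\<Sum>l=1..k. \<alpha> l * (real n ^ (k - l) * real (divisor_sigma (2 * l - 1) n))))"
      unfolding \<alpha>_def by (intro sum.cong refl fourier_coeff_eq[OF F]) auto
    also have "\<dots> = (\<Sum>n=1..N. fps_nth (cuspidal_part k F) n) + of_real (\<Sum>n=1..N. \<Sum>l=1..k. \<alpha> l * (real n ^ (k - l) * real (divisor_sigma (2 * l - 1) n)))"
      by (simp only: sum.distrib of_real_sum)
    also have "(\<Sum>n=1..N. \<Sum>l=1..k. \<alpha> l * (real n ^ (k - l) * real (divisor_sigma (2 * l - 1) n))) = (\<Sum>l=1..k. \<alpha> l * D l N)"
      unfolding D_def sum_distrib_left by (rule sum.swap)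
    finally have "(\<Sum>n=1..N. fps_nth (cuspidal_part k F) n) = of_real ((\<Sum>n=1..N. real_of_rat (fourier_coeff F n)) - (\<Sum>l=1..k. \<alpha> l * D l N))"
      by (simp only: of_real_diff) (simp only: algebra_simps)
    hence "\<bar>(\<Sum>n=1..N. real_of_rat (fourier_coeff F n)) - (\<Sum>l=1..k. \<alpha> l * D l N)\<bar> = norm (\<Sum>n=1..N. fps_nth (cuspidal_part k F) n)"
      by (simp only: norm_of_real)
    also have "\<dots> \<le> C * 16 * exp (4 * pi) * real N ^ k * ln (real N)"
      by (rule Hecke_partial_sum_bound[OF cuspidal_part_conv_radius[OF F k] C(2) N])
    finally have 1: "\<bar>(\<Sum>n=1..N. real_of_rat (fourier_coeff F n)) - (\<Sum>l=1..k. \<alpha> l * D l N)\<bar> \<le> C * 16 * exp (4 * pi) * real N ^ k * ln (real N)" .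
    have "\<bar>\<alpha> l * D l N - growth_coeff F l * real N ^ (k + l) / fact (k + l)\<bar> \<le> \<bar>growth_coeff F l\<bar> * (4 / zeta_even l) * real N ^ (k + l - 1) * ln (real N)"
      if "l \<in> {1..k}" for l
    proof -
      have l: "l > 0" "l \<le> k" using that by auto
      have z: "zeta_even l > 0" by (rule zeta_even_pos[OF l(1)])
      have kl: "k - l + 2 * l = k + l" using l by simp
      have f: "fact (k + l) = real (k + l) * fact (k + l - 1)" using l by (simp add: fact_reduce)
      have "growth_coeff F l * real N ^ (k + l) / fact (k + l) = \<alpha> l * (zeta_even l * real N ^ (k + l) / real (k + l))"
        unfolding \<alpha>_def f using z l by simp
      hence "\<bar>\<alpha> l * D l N - growth_coeff F l * real N ^ (k + l) / fact (k + l)\<bar> = \<bar>\<alpha> l\<bar> * \<bar>D l N - zeta_even l * real N ^ (k + l) / real (k + l)\<bar>"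
        by (simp only: right_diff_distrib[symmetric] abs_mult)
      also have "\<dots> \<le> \<bar>\<alpha> l\<bar> * (4 * real N ^ (k + l - 1) * ln (real N))"
        using divisor_sum_asymptotic[OF l(1) N, of "k - l"] unfolding D_def kl by (intro mult_left_mono) auto
      also have "\<bar>\<alpha> l\<bar> \<le> \<bar>growth_coeff F l\<bar> / zeta_even l"
      proof -
        have "zeta_even l * 1 \<le> zeta_even l * fact (k + l - 1)" using z by (intro mult_left_mono) (auto simp: fact_ge_1)
        hence "\<bar>growth_coeff F l\<bar> / (zeta_even l * fact (k + l - 1)) \<le> \<bar>growth_coeff F l\<bar> / zeta_even l"
          using z by (intro divide_left_mono mult_pos_pos) auto
        thus ?thesis using z by (simp add: \<alpha>_def abs_mult)
      qed
      hence "\<bar>\<alpha> l\<bar> * (4 * real N ^ (k + l - 1) * ln (real N)) \<le> \<bar>growth_coeff F l\<bar> / zeta_even l * (4 * real N ^ (k + l - 1) * ln (real N))"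
        using N by (intro mult_right_mono) auto
      finally show ?thesis by (simp add: mult_ac)
    qed
    hence "\<bar>(\<Sum>l=1..k. \<alpha> l * D l N) - (\<Sum>l=1..k. growth_coeff F l * real N ^ (k + l) / fact (k + l))\<bar>
      \<le> (\<Sum>l=1..k. \<bar>growth_coeff F l\<bar> * (4 / zeta_even l) * real N ^ (k + l - 1) * ln (real N))"
      unfolding sum_subtractf[symmetric] by (intro order_trans[OF sum_abs] sum_mono)
    moreover have "\<bar>a - c\<bar> \<le> p + q" if "\<bar>a - b\<bar> \<le> p" "\<bar>b - c\<bar> \<le> q" for a b c p q :: real
      using that by linarith
    ultimately show ?thesis using 1 unfolding distrib_right sum_distrib_right by blast
  qed
  show ?thesis by (rule that[OF bound])
qed

section \<open>Leading term and final estimate\<close>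

text \<open>A larger degree would make \<open>x^m\<close> negligible against
  \<open>x^(degree p)\<close> and force the leading coefficient to be 0.\<close>

lemma poly_bigo_imp_degree_le:
  fixes p :: "real poly"
  assumes "poly p \<in> O[at_top](\<lambda>x. x ^ m)"
  shows "degree p \<le> m"
proof (rule ccontr)
  assume d: "\<not> degree p \<le> m"
  have "(\<lambda>x::real. x ^ m) \<in> o[at_top](\<lambda>x. x ^ degree p)"
  proof (rule smalloI_tendsto)
    have "((\<lambda>x::real. inverse x ^ (degree p - m)) \<longlongrightarrow> 0 ^ (degree p - m)) at_top"
      by (intro tendsto_power tendsto_inverse_0_at_top filterlim_ident)
    moreover have "\<forall>\<^sub>F x::real in at_top. inverse x ^ (degree p - m) = x ^ m / x ^ degree p"
      using eventually_gt_at_top[of 0]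
    proof eventually_elim
      case (elim x)
      have "x ^ degree p = x ^ m * x ^ (degree p - m)" using d by (simp flip: power_add)
      thus ?case using elim by (simp add: power_one_over inverse_eq_divide)
    qed
    ultimately have "((\<lambda>x::real. x ^ m / x ^ degree p) \<longlongrightarrow> 0 ^ (degree p - m)) at_top"
      by (rule Lim_transform_eventually)
    thus "((\<lambda>x::real. x ^ m / x ^ degree p) \<longlongrightarrow> 0) at_top" using d by (simp add: power_0_left)
    show "\<forall>\<^sub>F x::real in at_top. x ^ degree p \<noteq> 0"
      using eventually_gt_at_top[of 0] by eventually_elim simp
  qed
  hence "poly p \<in> o[at_top](\<lambda>x. x ^ degree p)" using assms landau_o.big_small_trans by blast
  hence "((\<lambda>x. poly p x / x ^ degree p) \<longlongrightarrow> 0) at_top" by (rule smalloD_tendsto)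
  moreover have "((\<lambda>x. poly p x / x ^ degree p) \<longlongrightarrow> lead_coeff p) at_top"
    by (rule tendsto_mono[OF at_top_le_at_infinity poly_divide_tendsto_aux])
  ultimately have "lead_coeff p = 0" using tendsto_unique trivial_limit_at_top_linorder by blast
  with d show False by simp
qed

text \<open>In the variable \<open>x = 1 / h\<close> both the growth polynomial and
  \<open>A h^(-p)\<close> are polynomials, so the asymptotic hypothesis bounds a degree and can be
  read coefficient by coefficient.\<close>

lemma growth_leading_coeff:
  assumes F: "homogeneous (2 * k) F" and k: "k > 0" and A: "A \<noteq> 0"
    and gr: "(\<lambda>h. growth k F h - A * h powi (- int p)) \<in> O[at_right 0](\<lambda>h. h powi (1 - int p))"
  obtains L where "1 \<le> L" "L \<le> k" "p = k + L" "growth_coeff F L = A" "\<And>l. L < l \<Longrightarrow> l \<le> k \<Longrightarrow> growth_coeff F l = 0"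
proof -
  define P where "P = (\<Sum>l\<le>k. monom (growth_coeff F l) (k + l)) - monom A p"
  have "(\<lambda>x::real. growth k F (inverse x) - A * inverse x powi (- int p)) \<in> O[at_top](\<lambda>x. inverse x powi (1 - int p))"
    by (rule landau_o.big.compose[OF gr filterlim_inverse_at_right_top])
  \<comment> \<open>Multiplication by \<open>x\<close> avoids the negative exponent of
    \<open>x^(p-1)\<close> when \<open>p = 0\<close>.\<close>
  hence in1: "(\<lambda>x::real. x * (growth k F (inverse x) - A * inverse x powi (- int p))) \<in> O[at_top](\<lambda>x. x * (inverse x powi (1 - int p)))"
    by (rule landau_o.big.mult_left)
  have ev1: "\<forall>\<^sub>F x::real in at_top. x * (growth k F (inverse x) - A * inverse x powi (- int p)) = poly (pCons 0 P) x"
    using eventually_gt_at_top[of 0]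
  proof eventually_elim
    case (elim x)
    have "growth k F (inverse x) = (\<Sum>l\<le>k. growth_coeff F l * x ^ (k + l))"
      using growth_eq_sum[OF F, of "inverse x"] elim by simp
    moreover have "inverse x powi (- int p) = x ^ p"
      by (simp add: power_int_minus power_inverse)
    ultimately show ?case by (simp add: P_def poly_sum poly_monom)
  qed
  have ev2: "\<forall>\<^sub>F x::real in at_top. x * (inverse x powi (1 - int p)) = x ^ p"
    using eventually_gt_at_top[of 0]
  proof eventually_elim
    case (elim x)
    have "inverse x powi (1 - int p) = inverse x powi 1 * inverse x powi (- int p)"
      using elim by (subst power_int_add[symmetric]) auto
    thus ?case using elim by (simp add: power_int_minus power_inverse)
  qed
  have "poly (pCons 0 P) \<in> O[at_top](\<lambda>x. x ^ p)"
    using in1 unfolding landau_o.big.in_cong[OF ev1] landau_o.big.cong[OF ev2] .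
  hence deg: "degree (pCons 0 P) \<le> p" by (rule poly_bigo_imp_degree_le)
  have P0: "coeff P i = 0" if "i \<ge> p" for i
    using coeff_eq_0[of "pCons 0 P" "Suc i"] deg that by simp
  have cP: "coeff P i = (if k \<le> i \<and> i \<le> 2 * k then growth_coeff F (i - k) else 0) - (if i = p then A else 0)" for i
  proof -
    have "(\<Sum>l\<le>k. if k + l = i then growth_coeff F l else 0) = (\<Sum>l\<in>(if k \<le> i \<and> i \<le> 2 * k then {i - k} else {}). growth_coeff F l)"
      by (rule sum.mono_neutral_cong_right) (auto split: if_splits)
    thus ?thesis by (simp add: P_def coeff_sum)
  qed
  have p: "k \<le> p \<and> p \<le> 2 * k \<and> growth_coeff F (p - k) = A"
    using P0[of p] A by (auto simp: cP split: if_splits)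
  have z: "growth_coeff F l = 0" if "p - k < l" "l \<le> k" for l
    using P0[of "k + l"] that p by (simp add: cP split: if_splits)
  have "p - k \<noteq> 0"
  proof
    \<comment> \<open>Then degree 1 of \<open>Ev F\<close> vanishes, and with it degree 0, which
      would have to produce \<open>A\<close>.\<close>
    assume 0: "p - k = 0"
    have "growth_coeff F 1 = 0" using z[of 1] 0 k by simp
    hence "coeff (Ev F) 1 = 0" by (simp add: growth_coeff_def)
    hence "coeff (Ev F) 0 = 0" using Ev_coeff_relation[OF F k] k by simp
    hence "growth_coeff F 0 = 0" by (simp add: growth_coeff_def)
    thus False using p 0 A by simp
  qed
  thus ?thesis using p z by (intro that[of "p - k"]) auto
qed

text \<open>With \<open>p = k + L\<close> and \<open>L >= 1\<close>, every main term other than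
  \<open>l = L\<close> and the Hecke error fit into the remainder. In weight 0 the form is constant:
  then \<open>p = 0\<close>, and the sum over \<open>n >= 1\<close> vanishes while the main term is
  \<open>A\<close>.\<close>

theorem proposition9p4:
  fixes F :: quasimodular and k p :: nat and A :: real
  assumes "homogeneous (2 * k) F"
    and "k > 0"
    and "A \<noteq> 0"
    and "(\<lambda>h. growth k F h - A * h powi (- int p)) \<in> O[at_right 0](\<lambda>h. h powi (1 - int p))"
  shows "(\<lambda>N::nat. (\<Sum>n = 1..N. real_of_rat (fourier_coeff F n)) - A * real N ^ p / fact p)
           \<in> O(\<lambda>N. real N powi (int p - 1) * ln (real N))"
proof -
  obtain L where L: "1 \<le> L" "L \<le> k" "p = k + L" "growth_coeff F L = A" "\<And>l. L < l \<Longrightarrow> l \<le> k \<Longrightarrow> growth_coeff F l = 0"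
    using growth_leading_coeff[OF assms] by blast
  obtain C where C: "\<And>N. N \<ge> 2 \<Longrightarrow> \<bar>(\<Sum>n=1..N. real_of_rat (fourier_coeff F n)) - (\<Sum>l=1..k. growth_coeff F l * real N ^ (k + l) / fact (k + l))\<bar>
     \<le> (C * real N ^ k + (\<Sum>l=1..k. \<bar>growth_coeff F l\<bar> * (4 / zeta_even l) * real N ^ (k + l - 1))) * ln (real N)"
    using fourier_coeff_sum_bound[OF assms(1,2)] by blast
  \<comment> \<open>The first two summands bound the errors that already carry \<open>ln N\<close>;
    the last bounds the lower main terms, with a factor 2 to supply the missing logarithm.\<close>
  define K where "K = \<bar>C\<bar> + (\<Sum>l=1..k. \<bar>growth_coeff F l\<bar> * (4 / zeta_even l)) + 2 * (\<Sum>l=1..k. \<bar>growth_coeff F l\<bar>)"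
  show ?thesis
  proof (rule bigoI[of _ K])
    show "\<forall>\<^sub>F N in sequentially. norm ((\<Sum>n = 1..N. real_of_rat (fourier_coeff F n)) - A * real N ^ p / fact p)
       \<le> K * norm (real N powi (int p - 1) * ln (real N))"
      using eventually_ge_at_top[of 2]
    proof eventually_elim
      case (elim N)
      define x where "x = real N"
      define S where "S = (\<Sum>n = 1..N. real_of_rat (fourier_coeff F n))"
      define T where "T = (\<Sum>l=1..k. growth_coeff F l * x ^ (k + l) / fact (k + l))"
      have x: "x \<ge> 2" using elim by (simp add: x_def)
      have "ln 2 \<le> ln x" using x by simp
      \<comment> \<open>\<open>ln 2 >= 2/3\<close> makes \<open>2 * ln x\<close> at least 1, so
        terms without a logarithm can be given one.\<close>
      hence lnx: "1 \<le> 2 * ln x" using ln2_ge_two_thirds by linarith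
      have mono: "x ^ i \<le> x ^ (p - 1)" if "i \<le> p - 1" for i using x that by (intro power_increasing) auto
      \<comment> \<open>Here \<open>L >= 1\<close> enters: it gives
        \<open>k <= p - 1\<close>.\<close>
      have "C * x ^ k \<le> \<bar>C\<bar> * x ^ (p - 1)"
        using x L mono[of k] by (intro mult_mono) auto
      moreover have "(\<Sum>l=1..k. \<bar>growth_coeff F l\<bar> * (4 / zeta_even l) * x ^ (k + l - 1)) \<le>
         (\<Sum>l=1..k. \<bar>growth_coeff F l\<bar> * (4 / zeta_even l)) * x ^ (p - 1)"
        unfolding sum_distrib_right
      proof (rule sum_mono)
        fix l assume l: "l \<in> {1..k}"
        show "\<bar>growth_coeff F l\<bar> * (4 / zeta_even l) * x ^ (k + l - 1) \<le> \<bar>growth_coeff F l\<bar> * (4 / zeta_even l) * x ^ (p - 1)"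
        proof (cases "L < l")
          case False
          thus ?thesis using l L zeta_even_pos[of l] by (intro mult_left_mono mono mult_nonneg_nonneg) auto
        qed (use L(5) l in auto)
      qed
      ultimately have "C * x ^ k + (\<Sum>l=1..k. \<bar>growth_coeff F l\<bar> * (4 / zeta_even l) * x ^ (k + l - 1)) \<le>
         (\<bar>C\<bar> + (\<Sum>l=1..k. \<bar>growth_coeff F l\<bar> * (4 / zeta_even l))) * x ^ (p - 1)"
        unfolding distrib_right by (rule add_mono)
      hence "(C * x ^ k + (\<Sum>l=1..k. \<bar>growth_coeff F l\<bar> * (4 / zeta_even l) * x ^ (k + l - 1))) * ln x \<le>
         (\<bar>C\<bar> + (\<Sum>l=1..k. \<bar>growth_coeff F l\<bar> * (4 / zeta_even l))) * x ^ (p - 1) * ln x"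
        using x by (intro mult_right_mono) auto
      with C[OF elim] have 1: "\<bar>S - T\<bar> \<le> (\<bar>C\<bar> + (\<Sum>l=1..k. \<bar>growth_coeff F l\<bar> * (4 / zeta_even l))) * x ^ (p - 1) * ln x"
        unfolding S_def T_def x_def by (rule order_trans)
      have "T - A * x ^ p / fact p = (\<Sum>l\<in>{1..k} - {L}. growth_coeff F l * x ^ (k + l) / fact (k + l))"
        unfolding T_def using L by (subst sum.remove[of "{1..k}" L]) auto
      also have "\<bar>\<dots>\<bar> \<le> (\<Sum>l\<in>{1..k} - {L}. \<bar>growth_coeff F l\<bar> * (x ^ (p - 1) * (2 * ln x)))"
      proof (intro order_trans[OF sum_abs] sum_mono)
        fix l assume l: "l \<in> {1..k} - {L}"
        show "\<bar>growth_coeff F l * x ^ (k + l) / fact (k + l)\<bar> \<le> \<bar>growth_coeff F l\<bar> * (x ^ (p - 1) * (2 * ln x))"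
        proof (cases "L < l")
          case False
          have "x ^ (k + l) / fact (k + l) \<le> x ^ (k + l) / 1"
            using x by (intro divide_left_mono) (auto simp: fact_ge_1)
          also have "\<dots> \<le> x ^ (p - 1) * 1" using False l L mono[of "k + l"] by auto
          also have "\<dots> \<le> x ^ (p - 1) * (2 * ln x)" using lnx x by (intro mult_left_mono) auto
          finally have "\<bar>growth_coeff F l\<bar> * (x ^ (k + l) / fact (k + l)) \<le> \<bar>growth_coeff F l\<bar> * (x ^ (p - 1) * (2 * ln x))"
            by (intro mult_left_mono) auto
          thus ?thesis using x by (simp add: abs_mult)
        qed (use L(5) l in auto)
      qed
      also have "\<dots> \<le> (\<Sum>l=1..k. \<bar>growth_coeff F l\<bar> * (x ^ (p - 1) * (2 * ln x)))"
        using x by (intro sum_mono2) auto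
      also have "\<dots> = 2 * (\<Sum>l=1..k. \<bar>growth_coeff F l\<bar>) * x ^ (p - 1) * ln x"
        by (simp add: sum_distrib_right sum_distrib_left mult_ac)
      finally have 2: "\<bar>T - A * x ^ p / fact p\<bar> \<le> 2 * (\<Sum>l=1..k. \<bar>growth_coeff F l\<bar>) * x ^ (p - 1) * ln x" .
      have "\<bar>a - c\<bar> \<le> q + r" if "\<bar>a - b\<bar> \<le> q" "\<bar>b - c\<bar> \<le> r" for a b c q r :: real
        using that by linarith
      from this[OF 1 2] have "\<bar>S - A * x ^ p / fact p\<bar> \<le> K * (x ^ (p - 1) * ln x)"
        unfolding K_def distrib_right by (simp only: mult.assoc)
      moreover have "int p - 1 = int (p - 1)" using L by simp
      hence "x powi (int p - 1) = x ^ (p - 1)" by (simp only: power_int_of_nat)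
      ultimately show ?case using x unfolding S_def x_def by (simp add: abs_mult)
    qed
  qed
qed

end
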